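(* Let $(X_t)_{t\in\mathbb{Z}}$ be stationary real-valued, $\eta\in(0,1)$, and let $b_n$ be integers with $b_n\to\infty$, $b_n=o(n)$. Let $T_n$, $T_{i,b_n}$, $L_{n,b_n}$, $C_{n,b_n}$ be as defined below, and $C(y)=\inf\{x:\mathbb{P}(\xi_\kappa/\zeta_{\kappa/2}\le x)\ge y\}$. Suppose $\mathbb{E}[X_0]=0$ and either (i) Assumption (FV) holds and $\sigma^2:=\mathrm{var}(X_0)+2\sum_{t\ge1}\mathrm{cov}(X_0,X_t)>0$, or (ii) Assumptions (RV) and (AC+MX) hold with $\kappa\in(1,2)$ and $x\mapsto\mathbb{P}(\xi_\kappa/\zeta_{\kappa/2}\le x)$ is continuous in neighborhoods of $C(\eta/2)$ and $C(1-\eta/2)$. Then $\mathbb{P}(T_n\notin[C_{n,b_n}(\eta/2),C_{n,b_n}(1-\eta/2)])\to\eta$. If instead either Assumption (FV) holds or Assumptions (RV), (AC+MX) hold with $\kappa\in(1,2)$, and $\mathbb{E}[X_0]\neq0$, then $\mathbb{P}(T_n\notin[C_{n,b_n}(\eta/2),C_{n,b_n}(1-\eta/2)])\to1$.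
   Context: $T_n=\sum_{t=1}^nX_t/(\sum_{t=1}^nX_t^2)^{1/2}$; $q_n=n-b_n+1$; $T_{i,b_n}=\sum_{t=i}^{i+b_n-1}X_t/(\sum_{t=i}^{i+b_n-1}X_t^2)^{1/2}$, $i=1,\dots,q_n$; $L_{n,b_n}(x)=q_n^{-1}\sum_{i=1}^{q_n}\mathbf{1}(T_{i,b_n}\le x)$; $C_{n,b_n}(y)=\inf\{x:L_{n,b_n}(x)\ge y\}$. Strong mixing coefficients $\alpha_k=\sup|\mathrm{cov}(g_1(\dots,X_{-1},X_0),g_2(X_k,\dots))|$ over measurable $|g_i|\le1$. Assumption (FV): some $\varepsilon>0$ with $\mathbb{E}|X_0|^{2+\varepsilon}<\infty$ and $\sum_k\alpha_k^{\varepsilon/(2+\varepsilon)}<\infty$. Regular variation of a real variable with index $\kappa$: $\mathbb{P}(X>x)\sim p_+L(x)x^{-\kappa}$, $\mathbb{P}(X<-x)\sim p_-L(x)x^{-\kappa}$ ($L$ slowly varying, $p_\pm\ge0$, $p_++p_-=1$); of a stationary process: $X_0$ regularly varying and a spectral tail process $(\Theta_t)$ exists with $\mathbb{P}(|X_0|^{-1}(X_{-h},\dots,X_h)\in\cdot\mid|X_0|>x)\to\mathbb{P}((\Theta_{-h},\dots,\Theta_h)\in\cdot)$ weakly, all $h\ge0$. Assumption (RV): index $\kappa\in(0,1)\cup(1,2)$. $(a_n)$: $a_n\to\infty$, $n\mathbb{P}(|X_0|>a_n)\to1$. Assumption (AC+MX): integer $r_n\to\infty$, $r_n=o(n)$,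 with $\lim_k\limsup_n n\sum_{t=k}^{r_n}\mathbb{E}[\min\{|X_t|/a_n,1\}\min\{|X_0|/a_n,1\}]=0$, and $\ell_n\to\infty$, $\ell_n=o(r_n)$, $(n/r_n)\alpha_{\ell_n}\to0$. Under (RV),(AC+MX) with $\kappa\in(1,2)$ and $\mathbb{E}X_0=0$, $(\xi_\kappa,\zeta_{\kappa/2})$ denotes the limit in distribution of $a_n^{-1}(\sum_{t=1}^nX_t,(\sum_{t=1}^nX_t^2)^{1/2})$. *)

theory Defs
  imports "HOL-Probability.Probability"
begin

definition stationary :: "'a measure \<Rightarrow> (int \<Rightarrow> 'a \<Rightarrow> real) \<Rightarrow> bool" where
  "stationary M X \<longleftrightarrow>
     (\<forall>t. X t \<in> borel_measurable M) \<and>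
     (\<forall>h I. finite I \<longrightarrow>
        distr M (PiM I (\<lambda>_. borel)) (\<lambda>\<omega>. \<lambda>i\<in>I. X (i + h) \<omega>)
      = distr M (PiM I (\<lambda>_. borel)) (\<lambda>\<omega>. \<lambda>i\<in>I. X i \<omega>))"

definition cov :: "'a measure \<Rightarrow> ('a \<Rightarrow> real) \<Rightarrow> ('a \<Rightarrow> real) \<Rightarrow> real" where
  "cov M U V = (\<integral>\<omega>. U \<omega> * V \<omega> \<partial>M) - (\<integral>\<omega>. U \<omega> \<partial>M) * (\<integral>\<omega>. V \<omega> \<partial>M)"

definition mixing_alpha :: "'a measure \<Rightarrow> (int \<Rightarrow> 'a \<Rightarrow> real) \<Rightarrow> nat \<Rightarrow> real" where
  "mixing_alpha M X k = Sup {\<bar>cov M (\<lambda>\<omega>. g1 (\<lambda>t\<in>{..0}. X t \<omega>))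
                                   (\<lambda>\<omega>. g2 (\<lambda>t\<in>{int k..}. X t \<omega>))\<bar> | g1 g2.
       g1 \<in> borel_measurable (PiM {..0} (\<lambda>_. borel)) \<and>
       g2 \<in> borel_measurable (PiM {int k..} (\<lambda>_. borel)) \<and>
       (\<forall>x. \<bar>g1 x\<bar> \<le> 1) \<and> (\<forall>x. \<bar>g2 x\<bar> \<le> 1)}"

definition assm_FV :: "'a measure \<Rightarrow> (int \<Rightarrow> 'a \<Rightarrow> real) \<Rightarrow> bool" where
  "assm_FV M X \<longleftrightarrow> (\<exists>\<epsilon>>0. integrable M (\<lambda>\<omega>. \<bar>X 0 \<omega>\<bar> powr (2 + \<epsilon>)) \<and>
       summable (\<lambda>k. mixing_alpha M X k powr (\<epsilon> / (2 + \<epsilon>))))"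

definition long_run_var :: "'a measure \<Rightarrow> (int \<Rightarrow> 'a \<Rightarrow> real) \<Rightarrow> real" where
  "long_run_var M X = cov M (X 0) (X 0) + 2 * (\<Sum>t. cov M (X 0) (X (int (Suc t))))"

definition slowly_varying :: "(real \<Rightarrow> real) \<Rightarrow> bool" where
  "slowly_varying L \<longleftrightarrow> L \<in> borel_measurable borel \<and> (\<forall>x>0. L x > 0) \<and>
     (\<forall>c>0. ((\<lambda>x. L (c * x) / L x) \<longlongrightarrow> 1) at_top)"

text \<open>Regular variation of the real random variable Y with index kappa;
  P(Y > x) ~ p_plus L(x) x^(-kappa) is read as the ratio converging to p_plus.\<close>
definition regvar_var :: "'a measure \<Rightarrow> ('a \<Rightarrow> real) \<Rightarrow> real \<Rightarrow> bool" where
  "regvar_var M Y \<kappa> \<longleftrightarrow> (\<exists>L pp pm. slowly_varying L \<and> pp \<ge> 0 \<and> pm \<ge> 0 \<and> pp + pm = 1 \<and>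
     ((\<lambda>x. measure M {\<omega>\<in>space M. Y \<omega> > x} / (L x * x powr (- \<kappa>))) \<longlongrightarrow> pp) at_top \<and>
     ((\<lambda>x. measure M {\<omega>\<in>space M. Y \<omega> < - x} / (L x * x powr (- \<kappa>))) \<longlongrightarrow> pm) at_top)"

text \<open>Window (X_{-h},...,X_h) embedded in int => real (zero outside [-h,h]).\<close>
definition window :: "nat \<Rightarrow> (int \<Rightarrow> real) \<Rightarrow> (int \<Rightarrow> real)" where
  "window h x = (\<lambda>t. if \<bar>t\<bar> \<le> int h then x t else 0)"

text \<open>Regular variation of a stationary process with index kappa: X_0 regularly varying
  and a spectral tail process Theta (law on int => real) exists such that the conditional
  law of |X_0|^{-1}(X_{-h},...,X_h) given |X_0| > x converges weakly to the law of
  (Theta_{-h},...,Theta_h), for every h.\<close>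
definition regvar_proc :: "'a measure \<Rightarrow> (int \<Rightarrow> 'a \<Rightarrow> real) \<Rightarrow> real \<Rightarrow> bool" where
  "regvar_proc M X \<kappa> \<longleftrightarrow> regvar_var M (X 0) \<kappa> \<and>
    (\<exists>\<Theta> :: (int \<Rightarrow> real) measure. prob_space \<Theta> \<and> sets \<Theta> = sets borel \<and>
      (\<forall>h f. continuous_on UNIV f \<and> (\<exists>B. \<forall>z. \<bar>f z\<bar> \<le> B) \<longrightarrow>
        ((\<lambda>x. (\<integral>\<omega>. f (window h (\<lambda>t. X t \<omega> / \<bar>X 0 \<omega>\<bar>))
                     * indicator {\<omega>\<in>space M. \<bar>X 0 \<omega>\<bar> > x} \<omega> \<partial>M)
               / measure M {\<omega>\<in>space M. \<bar>X 0 \<omega>\<bar> > x})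
          \<longlongrightarrow> (\<integral>\<theta>. f (window h \<theta>) \<partial>\<Theta>)) at_top))"

definition assm_RV :: "'a measure \<Rightarrow> (int \<Rightarrow> 'a \<Rightarrow> real) \<Rightarrow> real \<Rightarrow> bool" where
  "assm_RV M X \<kappa> \<longleftrightarrow> regvar_proc M X \<kappa> \<and> (0 < \<kappa> \<and> \<kappa> < 1 \<or> 1 < \<kappa> \<and> \<kappa> < 2)"

definition norm_seq :: "'a measure \<Rightarrow> (int \<Rightarrow> 'a \<Rightarrow> real) \<Rightarrow> (nat \<Rightarrow> real) \<Rightarrow> bool" where
  "norm_seq M X a \<longleftrightarrow> filterlim a at_top sequentially \<and>
     (\<lambda>n. real n * measure M {\<omega>\<in>space M. \<bar>X 0 \<omega>\<bar> > a n}) \<longlonglongrightarrow> 1"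

definition assm_ACMX :: "'a measure \<Rightarrow> (int \<Rightarrow> 'a \<Rightarrow> real) \<Rightarrow> (nat \<Rightarrow> real) \<Rightarrow> bool" where
  "assm_ACMX M X a \<longleftrightarrow> (\<exists>r :: nat \<Rightarrow> nat.
     filterlim r at_top sequentially \<and> (\<lambda>n. real (r n) / real n) \<longlonglongrightarrow> 0 \<and>
     (\<lambda>k. limsup (\<lambda>n. ereal (real n * (\<Sum>t\<in>{k..r n}.
          \<integral>\<omega>. min (\<bar>X (int t) \<omega>\<bar> / a n) 1 * min (\<bar>X 0 \<omega>\<bar> / a n) 1 \<partial>M))))
       \<longlonglongrightarrow> 0 \<and>
     (\<exists>l :: nat \<Rightarrow> nat. filterlim l at_top sequentially \<and>
        (\<lambda>n. real (l n) / real (r n)) \<longlonglongrightarrow> 0 \<and>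
        (\<lambda>n. real n / real (r n) * mixing_alpha M X (l n)) \<longlonglongrightarrow> 0))"

definition conv_distr2 :: "'a measure \<Rightarrow> (nat \<Rightarrow> 'a \<Rightarrow> real \<times> real) \<Rightarrow> (real \<times> real) measure \<Rightarrow> bool" where
  "conv_distr2 M Y \<nu> \<longleftrightarrow> prob_space \<nu> \<and> sets \<nu> = sets borel \<and>
     (\<forall>f :: real \<times> real \<Rightarrow> real. continuous_on UNIV f \<and> (\<exists>B. \<forall>z. \<bar>f z\<bar> \<le> B) \<longrightarrow>
        (\<lambda>n. \<integral>\<omega>. f (Y n \<omega>) \<partial>M) \<longlonglongrightarrow> (\<integral>z. f z \<partial>\<nu>))"

definition scaled_pair :: "(int \<Rightarrow> 'a \<Rightarrow> real) \<Rightarrow> (nat \<Rightarrow> real) \<Rightarrow> nat \<Rightarrow> 'a \<Rightarrow> real \<times> real" where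
  "scaled_pair X a n \<omega> = ((\<Sum>t=1..n. X (int t) \<omega>) / a n,
                           sqrt (\<Sum>t=1..n. (X (int t) \<omega>)\<^sup>2) / a n)"

definition ratio_cdf :: "(real \<times> real) measure \<Rightarrow> real \<Rightarrow> real" where
  "ratio_cdf \<nu> x = measure \<nu> {z. fst z / snd z \<le> x}"

definition ratio_quantile :: "(real \<times> real) measure \<Rightarrow> real \<Rightarrow> real" where
  "ratio_quantile \<nu> y = Inf {x. ratio_cdf \<nu> x \<ge> y}"

definition selfnorm :: "(int \<Rightarrow> 'a \<Rightarrow> real) \<Rightarrow> nat \<Rightarrow> nat \<Rightarrow> 'a \<Rightarrow> real" where
  "selfnorm X i b \<omega> = (\<Sum>t=i..<i+b. X (int t) \<omega>) / sqrt (\<Sum>t=i..<i+b. (X (int t) \<omega>)\<^sup>2)"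

definition Tstat :: "(int \<Rightarrow> 'a \<Rightarrow> real) \<Rightarrow> nat \<Rightarrow> 'a \<Rightarrow> real" where
  "Tstat X n \<omega> = (\<Sum>t=1..n. X (int t) \<omega>) / sqrt (\<Sum>t=1..n. (X (int t) \<omega>)\<^sup>2)"

definition subsample_L :: "(int \<Rightarrow> 'a \<Rightarrow> real) \<Rightarrow> nat \<Rightarrow> nat \<Rightarrow> 'a \<Rightarrow> real \<Rightarrow> real" where
  "subsample_L X n b \<omega> x =
     (let q = n - b + 1 in (\<Sum>i=1..q. if selfnorm X i b \<omega> \<le> x then 1 else 0) / real q)"

definition subsample_C :: "(int \<Rightarrow> 'a \<Rightarrow> real) \<Rightarrow> nat \<Rightarrow> nat \<Rightarrow> 'a \<Rightarrow> real \<Rightarrow> real" where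
  "subsample_C X n b \<omega> y = Inf {x. subsample_L X n b \<omega> x \<ge> y}"

definition noncover_prob :: "'a measure \<Rightarrow> (int \<Rightarrow> 'a \<Rightarrow> real) \<Rightarrow> (nat \<Rightarrow> nat) \<Rightarrow> real \<Rightarrow> nat \<Rightarrow> real" where
  "noncover_prob M X b \<eta> n = measure M {\<omega>\<in>space M.
      Tstat X n \<omega> \<notin> {subsample_C X n (b n) \<omega> (\<eta>/2) .. subsample_C X n (b n) \<omega> (1 - \<eta>/2)}}"

end

theory Submission
  imports Defs
begin

text \<open>
  If the statistic has a limit law F that is continuous near the two quantiles and has no flat piece
  starting there, then the subsample quantiles converge in probability to those of F: the variance of
  the subsample distribution function at a point vanishes, because events of separated blocks decorrelate.

  Under fast mixing, F is a centred normal law. Variables are truncated at a fixed level, with the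
  truncation error controlled in L2 by Davydov's inequality, and characteristic functions are
  computed along Bernstein blocks.

  Under heavy tails, continuity of F is assumed, but two further facts are needed. First, the limit of the
  normaliser is positive almost surely: a sample of size n contains many nearly independent blocks whose
  maxima exceed small multiples of a n. Second, F has no flat piece: splitting the
  sample into two nearly independent parts of relative sizes s and 1 - s interpolates continuously
  between any two values of the limiting ratio, so its support is an interval.

  With a nonzero mean, the statistic of n variables is of order n / V n, where V n is the size of
  the normaliser, and V n / n tends to 0 fast enough for the full sample to outgrow the subsamples.
\<close>

section \<open>Stationary processes and mixing\<close>

text \<open>A flat piece of F is dangerous even though F is continuous near its left end, the
  quantile: F may jump at the right end, and the subsample quantile may land there. This is why F x
  > y is required strictly to the right of the quantile.

  The mixing coefficients are anchored at time 0, and stationarity concerns finite-dimensional laws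
  only. Statistics are therefore treated as functions of finitely many coordinates of a path, which
  can be moved along the time axis. Where only the convergence of \<open>alpha\<close> to 0 enters,
  a gap has a fixed length chosen before n, and a fixed number of observations is negligible.

  In the central limit theorem k \<open>alpha\<close> k tends to 0, but possibly slowly. Gaps are
  thus of the same order as the blocks, and the resulting errors are removed by a second limit, in
  the ratio of gap to block length.

  With a nonzero mean the argument rests on two-sided bounds in probability for the normaliser and
  not on a limit law.\<close>

lemma abs_cov_le:
  assumes "prob_space M" "\<And>\<omega>. \<omega> \<in> space M \<Longrightarrow> \<bar>U \<omega>\<bar> \<le> 1" "\<And>\<omega>. \<omega> \<in> space M \<Longrightarrow> \<bar>V \<omega>\<bar> \<le> 1"
  shows "\<bar>cov M U V\<bar> \<le> 2"
proof -
  interpret prob_space M by fact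
  \<comment> \<open>A function that is not integrable has Bochner integral 0, so the bound covers it
    as well.\<close>
  have *: "\<bar>\<integral>\<omega>. f \<omega> \<partial>M\<bar> \<le> 1" if "\<And>\<omega>. \<omega> \<in> space M \<Longrightarrow> \<bar>f \<omega>\<bar> \<le> 1" for f :: "'a \<Rightarrow> real"
  proof (cases "integrable M f")
    case True
    have "\<bar>\<integral>\<omega>. f \<omega> \<partial>M\<bar> \<le> (\<integral>\<omega>. \<bar>f \<omega>\<bar> \<partial>M)" by simp
    also have "\<dots> \<le> (\<integral>\<omega>. 1 \<partial>M)" using True that by (intro integral_mono) auto
    finally show ?thesis by (simp add: prob_space)
  next
    case False
    then show ?thesis by (simp add: not_integrable_integral_eq)
  qed
  have "\<bar>\<integral>\<omega>. U \<omega> * V \<omega> \<partial>M\<bar> \<le> 1"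
    using assms by (intro *) (auto simp: abs_mult intro!: mult_le_one)
  moreover have "\<bar>(\<integral>\<omega>. U \<omega> \<partial>M) * (\<integral>\<omega>. V \<omega> \<partial>M)\<bar> \<le> 1"
    using assms by (auto simp: abs_mult intro!: mult_le_one *)
  ultimately show ?thesis unfolding cov_def by linarith
qed

lemma (in prob_space) expectation_of_bool:
  "expectation (\<lambda>\<omega>. of_bool (P \<omega>)) = prob {\<omega>\<in>space M. P \<omega>}"
proof -
  have "expectation (\<lambda>\<omega>. of_bool (P \<omega>)) = expectation (indicator {\<omega>\<in>space M. P \<omega>})"
    by (rule Bochner_Integration.integral_cong) (auto simp: indicator_def)
  also have "\<dots> = prob ({\<omega>\<in>space M. P \<omega>} \<inter> space M)" by simp
  also have "{\<omega>\<in>space M. P \<omega>} \<inter> space M = {\<omega>\<in>space M. P \<omega>}" by auto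
  finally show ?thesis .
qed

text \<open>A function of the coordinates in I. Elements of the product space are
  \<open>undefined\<close> outside I whereas sample paths are total; the second clause lets the same
  g be evaluated on both.\<close>

definition cylinder :: "int set \<Rightarrow> ((int \<Rightarrow> real) \<Rightarrow> real) \<Rightarrow> bool" where
  "cylinder I g \<longleftrightarrow> g \<in> borel_measurable (PiM I (\<lambda>_. borel)) \<and> (\<forall>x. g (restrict x I) = g x)"

lemma cylinder_measurable: "cylinder I g \<Longrightarrow> g \<in> borel_measurable (PiM I (\<lambda>_. borel))"
  by (simp add: cylinder_def)

lemma cylinder_restrict: "cylinder I g \<Longrightarrow> g (restrict x I) = g x"
  by (simp add: cylinder_def)

lemma cylinder_mono:
  assumes "cylinder I g" "I \<subseteq> J" shows "cylinder J g"
proof -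
  have "(\<lambda>x. g (restrict x I)) \<in> borel_measurable (PiM J (\<lambda>_. borel))"
    by (rule measurable_compose[OF measurable_restrict_subset[OF assms(2)] cylinder_measurable[OF assms(1)]])
  moreover have "g (restrict x J) = g x" for x
    using assms cylinder_restrict[OF assms(1), of "restrict x J"] cylinder_restrict[OF assms(1), of x]
    by (simp add: restrict_restrict Int_absorb1)
  ultimately show ?thesis using cylinder_restrict[OF assms(1)] by (simp add: cylinder_def)
qed

lemma cylinder_mult:
  assumes "cylinder I f" "cylinder I g" shows "cylinder I (\<lambda>x. f x * g x)"
  using assms unfolding cylinder_def by auto

lemma cylinder_compose:
  assumes "cylinder I f" "h \<in> borel_measurable borel" shows "cylinder I (\<lambda>x. h (f x))"
  using assms unfolding cylinder_def by (auto intro: measurable_compose)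

lemma cylinder_component:
  assumes "i \<in> I" "f \<in> borel_measurable borel" shows "cylinder I (\<lambda>x. f (x i))"
  using assms unfolding cylinder_def by (auto intro!: measurable_compose[OF measurable_component_singleton])

lemma cylinder_sum:
  assumes "\<And>i. i \<in> J \<Longrightarrow> cylinder I (f i)" shows "cylinder I (\<lambda>x. \<Sum>i\<in>J. f i x)"
  using assms unfolding cylinder_def by (auto intro!: borel_measurable_sum sum.cong)

lemma cylinder_divide:
  assumes "cylinder I f" "cylinder I g" shows "cylinder I (\<lambda>x. f x / g x)"
  using assms unfolding cylinder_def by auto

lemma cylinder_pair:
  assumes "cylinder I f" "cylinder I g" "case_prod h \<in> borel_measurable (borel \<Otimes>\<^sub>M borel)"
  shows "cylinder I (\<lambda>x. h (f x) (g x))"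
proof -
  have "(\<lambda>x. case_prod h (f x, g x)) \<in> borel_measurable (PiM I (\<lambda>_. borel))"
    using assms(1,2) unfolding cylinder_def
    by (intro measurable_compose[OF measurable_Pair assms(3)]) auto
  then show ?thesis using assms(1,2) unfolding cylinder_def by auto
qed

section \<open>Stationary paths and covariance bounds for separated windows\<close>

locale stationary_process = prob_space M for M :: "'a measure" +
  fixes X :: "int \<Rightarrow> 'a \<Rightarrow> real"
  assumes stationary_X: "stationary M X"
begin

lemma measurable_X [measurable]: "X t \<in> borel_measurable M"
  using stationary_X by (simp add: stationary_def)

lemma measurable_path: "(\<lambda>\<omega>. \<lambda>i\<in>I. X (i + h) \<omega>) \<in> measurable M (PiM I (\<lambda>_. borel))"
  by (rule measurable_restrict) simp

lemma measurable_cylinder: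
  assumes "cylinder I g" shows "(\<lambda>\<omega>. g (\<lambda>i. X (i + h) \<omega>)) \<in> borel_measurable M"
proof -
  have "(\<lambda>\<omega>. g (\<lambda>i\<in>I. X (i + h) \<omega>)) \<in> borel_measurable M"
    by (rule measurable_compose[OF measurable_path cylinder_measurable[OF assms]])
  then show ?thesis using cylinder_restrict[OF assms] by simp
qed

lemma measurable_cylinder0:
  assumes "cylinder I g" shows "(\<lambda>\<omega>. g (\<lambda>i. X i \<omega>)) \<in> borel_measurable M"
  using measurable_cylinder[OF assms, of 0] by simp

text \<open>The right side is written with the shift 0 so that both sides have the form of
  \<open>measurable_path\<close> and can be rewritten alike.\<close>

lemma distr_shift:
  assumes "finite I"
  shows "distr M (PiM I (\<lambda>_. borel)) (\<lambda>\<omega>. \<lambda>i\<in>I. X (i + h) \<omega>)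
       = distr M (PiM I (\<lambda>_. borel)) (\<lambda>\<omega>. \<lambda>i\<in>I. X (i + 0) \<omega>)"
  using stationary_X assms by (simp add: stationary_def)

lemma expectation_shift:
  assumes "finite I" "cylinder I g"
  shows "(\<integral>\<omega>. g (\<lambda>i. X (i + h) \<omega>) \<partial>M) = (\<integral>\<omega>. g (\<lambda>i. X i \<omega>) \<partial>M)"
proof -
  have *: "(\<integral>\<omega>. g (\<lambda>i. X (i + h) \<omega>) \<partial>M) = (\<integral>x. g x \<partial>distr M (PiM I (\<lambda>_. borel)) (\<lambda>\<omega>. \<lambda>i\<in>I. X (i + h) \<omega>))" for h
    by (subst integral_distr[OF measurable_path cylinder_measurable[OF assms(2)]])
       (simp add: cylinder_restrict[OF assms(2)])
  show ?thesis using *[of h] *[of 0] distr_shift[OF assms(1), of h] by simp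
qed

lemma integrable_shift:
  assumes "finite I" "cylinder I g"
  shows "integrable M (\<lambda>\<omega>. g (\<lambda>i. X (i + h) \<omega>)) \<longleftrightarrow> integrable M (\<lambda>\<omega>. g (\<lambda>i. X i \<omega>))"
proof -
  have *: "integrable M (\<lambda>\<omega>. g (\<lambda>i. X (i + h) \<omega>)) = integrable (distr M (PiM I (\<lambda>_. borel)) (\<lambda>\<omega>. \<lambda>i\<in>I. X (i + h) \<omega>)) g" for h
    by (subst integrable_distr_eq[OF measurable_path cylinder_measurable[OF assms(2)]])
       (simp add: cylinder_restrict[OF assms(2)])
  show ?thesis using *[of h] *[of 0] distr_shift[OF assms(1), of h] by simp
qed

lemma expectation_marginal:
  assumes "f \<in> borel_measurable borel"
  shows "(\<integral>\<omega>. f (X t \<omega>) \<partial>M) = (\<integral>\<omega>. f (X 0 \<omega>) \<partial>M :: real)"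
  using expectation_shift[of "{0}" "\<lambda>x. f (x 0)" t] cylinder_component[of 0 "{0}" f] assms by simp

lemma integrable_marginal:
  fixes f :: "real \<Rightarrow> real"
  assumes "f \<in> borel_measurable borel"
  shows "integrable M (\<lambda>\<omega>. f (X t \<omega>)) \<longleftrightarrow> integrable M (\<lambda>\<omega>. f (X 0 \<omega>))"
  using integrable_shift[of "{0}" "\<lambda>x. f (x 0)" t] cylinder_component[of 0 "{0}" f] assms by simp

abbreviation alpha :: "nat \<Rightarrow> real" where "alpha \<equiv> mixing_alpha M X"

definition alpha_set :: "nat \<Rightarrow> real set" where
  "alpha_set k = {\<bar>cov M (\<lambda>\<omega>. g1 (\<lambda>t\<in>{..0}. X t \<omega>)) (\<lambda>\<omega>. g2 (\<lambda>t\<in>{int k..}. X t \<omega>))\<bar> | g1 g2.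
       g1 \<in> borel_measurable (PiM {..0} (\<lambda>_. borel)) \<and>
       g2 \<in> borel_measurable (PiM {int k..} (\<lambda>_. borel)) \<and>
       (\<forall>x. \<bar>g1 x\<bar> \<le> 1) \<and> (\<forall>x. \<bar>g2 x\<bar> \<le> 1)}"

lemma alpha_eq: "alpha k = Sup (alpha_set k)"
  by (simp add: mixing_alpha_def alpha_set_def)

lemma bdd_above_alpha_set: "bdd_above (alpha_set k)"
proof (rule bdd_aboveI[of _ 2])
  fix x assume "x \<in> alpha_set k"
  then show "x \<le> 2" unfolding alpha_set_def
    by (elim CollectE exE conjE) (simp, rule abs_cov_le[OF prob_space_axioms], simp_all)
qed

lemma zero_in_alpha_set: "0 \<in> alpha_set k"
  unfolding alpha_set_def
  by (rule CollectI, rule exI[of _ "\<lambda>_. 0"], rule exI[of _ "\<lambda>_. 0"]) (simp add: cov_def)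

lemma alpha_nonneg: "0 \<le> alpha k"
  unfolding alpha_eq by (rule cSup_upper[OF zero_in_alpha_set bdd_above_alpha_set])

text \<open>A larger gap leaves fewer functions of the future to choose from: precomposed with a
  restriction, a function of the coordinates from l on is one of those from k on.\<close>

lemma alpha_antimono:
  assumes "k \<le> l" shows "alpha l \<le> alpha k"
  unfolding alpha_eq
proof (rule cSup_subset_mono)
  show "alpha_set l \<noteq> {}" using zero_in_alpha_set by blast
  show "bdd_above (alpha_set k)" by (rule bdd_above_alpha_set)
  show "alpha_set l \<subseteq> alpha_set k"
  proof
    fix x assume "x \<in> alpha_set l"
    then obtain g1 g2 where
      g: "g1 \<in> borel_measurable (PiM {..0} (\<lambda>_. borel))"
         "g2 \<in> borel_measurable (PiM {int l..} (\<lambda>_. borel))"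
         "\<forall>x. \<bar>g1 x\<bar> \<le> 1" "\<forall>x. \<bar>g2 x\<bar> \<le> 1"
      and x: "x = \<bar>cov M (\<lambda>\<omega>. g1 (\<lambda>t\<in>{..0}. X t \<omega>)) (\<lambda>\<omega>. g2 (\<lambda>t\<in>{int l..}. X t \<omega>))\<bar>"
      unfolding alpha_set_def by auto
    have m: "(\<lambda>x. g2 (restrict x {int l..})) \<in> borel_measurable (PiM {int k..} (\<lambda>_. borel))"
      using assms by (intro measurable_compose[OF measurable_restrict_subset g(2)]) auto
    have "restrict (\<lambda>t\<in>{int k..}. X t \<omega>) {int l..} = (\<lambda>t\<in>{int l..}. X t \<omega>)" for \<omega>
      using assms by (auto simp: fun_eq_iff)
    then show "x \<in> alpha_set k" unfolding alpha_set_def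
      by (intro CollectI exI[of _ g1] exI[of _ "\<lambda>x. g2 (restrict x {int l..})"]) (use g m x in auto)
  qed
qed

lemma cov_cylinder_shift:
  assumes "finite I" "finite J" "cylinder I f" "cylinder J g"
  shows "cov M (\<lambda>\<omega>. f (\<lambda>i. X (i + h) \<omega>)) (\<lambda>\<omega>. g (\<lambda>i. X (i + h) \<omega>))
       = cov M (\<lambda>\<omega>. f (\<lambda>i. X i \<omega>)) (\<lambda>\<omega>. g (\<lambda>i. X i \<omega>))"
proof -
  have "cylinder (I \<union> J) (\<lambda>x. f x * g x)"
    using assms by (intro cylinder_mult) (auto elim: cylinder_mono)
  from expectation_shift[OF _ this, of h] expectation_shift[OF assms(1,3), of h]
    expectation_shift[OF assms(2,4), of h] assms(1,2)
  show ?thesis by (simp add: cov_def)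
qed

text \<open>The coefficient compares the past of time 0 with the future of time k. A shift by -s
  brings both windows into that position, and a function of a finite window counts as one of the
  whole half-line.\<close>

lemma abs_cov_cylinder_le1:
  assumes "finite I" "finite J" "I \<subseteq> {..s}" "J \<subseteq> {s + int k..}" "cylinder I f" "cylinder J g"
    and "\<And>x. \<bar>f x\<bar> \<le> 1" "\<And>x. \<bar>g x\<bar> \<le> 1"
  shows "\<bar>cov M (\<lambda>\<omega>. f (\<lambda>i. X i \<omega>)) (\<lambda>\<omega>. g (\<lambda>i. X i \<omega>))\<bar> \<le> alpha k"
proof -
  \<comment> \<open>Reading the path at i - s turns positions up to s into positions up to
    0.\<close>
  define f' where "f' x = f (\<lambda>i\<in>I. x (i - s))" for x
  define g' where "g' x = g (\<lambda>i\<in>J. x (i - s))" for x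
  have f': "f' \<in> borel_measurable (PiM {..0} (\<lambda>_. borel))" unfolding f'_def
    using assms(3)
    by (intro measurable_compose[OF measurable_restrict cylinder_measurable[OF assms(5)]] measurable_component_singleton) auto
  have g': "g' \<in> borel_measurable (PiM {int k..} (\<lambda>_. borel))" unfolding g'_def
    using assms(4)
    by (intro measurable_compose[OF measurable_restrict cylinder_measurable[OF assms(6)]] measurable_component_singleton) auto
  have ef: "f' (\<lambda>t\<in>{..0}. X t \<omega>) = f (\<lambda>i. X (i + (- s)) \<omega>)" for \<omega>
  proof -
    have "(\<lambda>i\<in>I. (\<lambda>t\<in>{..0}. X t \<omega>) (i - s)) = restrict (\<lambda>i. X (i + (- s)) \<omega>) I"
      using assms(3) by (auto simp: fun_eq_iff)
    then show ?thesis unfolding f'_def by (simp add: cylinder_restrict[OF assms(5)])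
  qed
  have eg: "g' (\<lambda>t\<in>{int k..}. X t \<omega>) = g (\<lambda>i. X (i + (- s)) \<omega>)" for \<omega>
  proof -
    have "(\<lambda>i\<in>J. (\<lambda>t\<in>{int k..}. X t \<omega>) (i - s)) = restrict (\<lambda>i. X (i + (- s)) \<omega>) J"
      using assms(4) by (auto simp: fun_eq_iff)
    then show ?thesis unfolding g'_def by (simp add: cylinder_restrict[OF assms(6)])
  qed
  have "\<bar>cov M (\<lambda>\<omega>. f' (\<lambda>t\<in>{..0}. X t \<omega>)) (\<lambda>\<omega>. g' (\<lambda>t\<in>{int k..}. X t \<omega>))\<bar> \<in> alpha_set k"
    unfolding alpha_set_def
    by (intro CollectI exI[of _ f'] exI[of _ g'] conjI refl f' g') (simp_all add: f'_def g'_def assms)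
  then have "\<bar>cov M (\<lambda>\<omega>. f' (\<lambda>t\<in>{..0}. X t \<omega>)) (\<lambda>\<omega>. g' (\<lambda>t\<in>{int k..}. X t \<omega>))\<bar> \<le> alpha k"
    unfolding alpha_eq by (rule cSup_upper[OF _ bdd_above_alpha_set])
  then show ?thesis unfolding ef eg using cov_cylinder_shift[OF assms(1,2,5,6), of "- s"] by simp
qed

lemma abs_cov_cylinder_le:
  assumes "finite I" "finite J" "I \<subseteq> {..s}" "J \<subseteq> {s + int k..}" "cylinder I f" "cylinder J g"
    and "\<And>x. \<bar>f x\<bar> \<le> B" "\<And>x. \<bar>g x\<bar> \<le> C" "B > 0" "C > 0"
  shows "\<bar>cov M (\<lambda>\<omega>. f (\<lambda>i. X i \<omega>)) (\<lambda>\<omega>. g (\<lambda>i. X i \<omega>))\<bar> \<le> B * C * alpha k"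
proof -
  have "\<bar>cov M (\<lambda>\<omega>. f (\<lambda>i. X i \<omega>) / B) (\<lambda>\<omega>. g (\<lambda>i. X i \<omega>) / C)\<bar> \<le> alpha k"
    using assms
    by (intro abs_cov_cylinder_le1[OF assms(1-4), of "\<lambda>x. f x / B" "\<lambda>x. g x / C"])
       (auto intro!: cylinder_compose[of _ _ "\<lambda>y. y / B"] cylinder_compose[of _ _ "\<lambda>y. y / C"])
  also have "cov M (\<lambda>\<omega>. f (\<lambda>i. X i \<omega>) / B) (\<lambda>\<omega>. g (\<lambda>i. X i \<omega>) / C) =
      cov M (\<lambda>\<omega>. f (\<lambda>i. X i \<omega>)) (\<lambda>\<omega>. g (\<lambda>i. X i \<omega>)) / (B * C)"
    using assms(9,10) by (simp add: cov_def diff_divide_distrib)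
  finally show ?thesis using assms(9,10)
    by (simp add: abs_divide abs_mult pos_divide_le_eq mult.commute)
qed

lemma prob_shift:
  assumes "finite I" "cylinder I (\<lambda>x. of_bool (P x))"
  shows "prob {\<omega>\<in>space M. P (\<lambda>i. X (i + h) \<omega>)} = prob {\<omega>\<in>space M. P (\<lambda>i. X i \<omega>)}"
  using expectation_shift[OF assms, of h] by (simp only: expectation_of_bool)

lemma prob_mixing:
  assumes "finite I" "finite J" "I \<subseteq> {..s}" "J \<subseteq> {s + int k..}"
    and "cylinder I (\<lambda>x. of_bool (P x))" "cylinder J (\<lambda>x. of_bool (Q x))"
  shows "\<bar>prob {\<omega>\<in>space M. P (\<lambda>i. X i \<omega>) \<and> Q (\<lambda>i. X i \<omega>)} -
           prob {\<omega>\<in>space M. P (\<lambda>i. X i \<omega>)} * prob {\<omega>\<in>space M. Q (\<lambda>i. X i \<omega>)}\<bar> \<le> alpha k"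
proof -
  have "\<bar>cov M (\<lambda>\<omega>. of_bool (P (\<lambda>i. X i \<omega>))) (\<lambda>\<omega>. of_bool (Q (\<lambda>i. X i \<omega>)))\<bar> \<le> alpha k"
    by (rule abs_cov_cylinder_le1[OF assms]) auto
  then show ?thesis by (simp add: cov_def expectation_of_bool of_bool_conj[symmetric])
qed

end

section \<open>Subsampling quantiles\<close>

text \<open>The square expands into q^2 covariances. In each row at most 2 m indices lie within
  distance m, each costing an extra 2 B^2; the others cost at most A.\<close>

lemma (in prob_space) second_moment_average_le:
  fixes Z :: "nat \<Rightarrow> 'a \<Rightarrow> real"
  assumes meas: "\<And>i. Z i \<in> borel_measurable M" and bound: "\<And>i \<omega>. \<bar>Z i \<omega>\<bar> \<le> B"
    and mean: "\<And>i. i \<in> {1..q} \<Longrightarrow> expectation (Z i) = p"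
    and cov: "\<And>i j. i \<in> {1..q} \<Longrightarrow> j \<in> {1..q} \<Longrightarrow> i + m \<le> j \<Longrightarrow> \<bar>cov M (Z i) (Z j)\<bar> \<le> A"
    and q: "q > 0" and A: "A \<ge> 0"
  shows "expectation (\<lambda>\<omega>. ((\<Sum>i=1..q. Z i \<omega>) / real q - p)\<^sup>2) \<le> 4 * real m * B\<^sup>2 / real q + A"
proof -
  have B: "B \<ge> 0" using bound[of 0 undefined] by linarith
  have int: "integrable M (Z i)" for i
    using bound meas by (intro integrable_const_bound[where B = B]) auto
  have intm: "integrable M (\<lambda>\<omega>. Z i \<omega> * Z j \<omega>)" for i j
    using bound meas B
    by (intro integrable_const_bound[where B = "B * B"]) (auto simp: abs_mult intro!: mult_mono AE_I2)
  have mean': "\<bar>expectation (Z i)\<bar> \<le> B" for i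
  proof -
    have "\<bar>expectation (Z i)\<bar> \<le> expectation (\<lambda>\<omega>. \<bar>Z i \<omega>\<bar>)" by simp
    also have "\<dots> \<le> expectation (\<lambda>_. B)" using int bound by (intro integral_mono) auto
    finally show ?thesis by (simp add: prob_space)
  qed
  have cb: "\<bar>cov M (Z i) (Z j)\<bar> \<le> 2 * B\<^sup>2" for i j
  proof -
    have "\<bar>expectation (\<lambda>\<omega>. Z i \<omega> * Z j \<omega>)\<bar> \<le> expectation (\<lambda>\<omega>. \<bar>Z i \<omega> * Z j \<omega>\<bar>)" by simp
    also have "\<dots> \<le> expectation (\<lambda>_. B * B)" using integrable_abs[OF intm[of i j]] bound B
      by (intro integral_mono) (auto simp: abs_mult intro!: mult_mono)
    finally have "\<bar>expectation (\<lambda>\<omega>. Z i \<omega> * Z j \<omega>)\<bar> \<le> B * B" by (simp add: prob_space)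
    moreover have "\<bar>expectation (Z i) * expectation (Z j)\<bar> \<le> B * B"
      using mean' B by (auto simp: abs_mult intro!: mult_mono)
    ultimately show ?thesis unfolding cov_def power2_eq_square by linarith
  qed
  have sym: "cov M (Z i) (Z j) = cov M (Z j) (Z i)" for i j
    by (simp add: cov_def mult.commute)
  have row: "(\<Sum>j=1..q. cov M (Z i) (Z j)) \<le> real q * A + 4 * real m * B\<^sup>2" if i: "i \<in> {1..q}" for i
  proof -
    have "(\<Sum>j=1..q. cov M (Z i) (Z j)) \<le> (\<Sum>j=1..q. A + (if i < j + m \<and> j < i + m then 2 * B\<^sup>2 else 0))"
    proof (rule sum_mono)
      fix j assume j: "j \<in> {1..q}"
      show "cov M (Z i) (Z j) \<le> A + (if i < j + m \<and> j < i + m then 2 * B\<^sup>2 else 0)"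
        using cov[OF i j] cov[OF j i] sym[of i j] cb[of i j] A
        by (cases "i + m \<le> j"; cases "j + m \<le> i") auto
    qed
    also have "\<dots> = real q * A + real (card {j\<in>{1..q}. i < j + m \<and> j < i + m}) * (2 * B\<^sup>2)"
      by (simp add: sum.distrib sum.If_cases Int_def)
    also have "\<dots> \<le> real q * A + real (2 * m) * (2 * B\<^sup>2)"
    proof -
      have "card {j\<in>{1..q}. i < j + m \<and> j < i + m} \<le> card {i + 1 - m..<i + m}"
        by (intro card_mono) auto
      also have "\<dots> \<le> 2 * m" by simp
      finally show ?thesis by (intro add_left_mono mult_right_mono) auto
    qed
    finally show ?thesis by simp
  qed
  have "expectation (\<lambda>\<omega>. ((\<Sum>i=1..q. Z i \<omega>) / real q - p)\<^sup>2)
      = expectation (\<lambda>\<omega>. (\<Sum>i=1..q. \<Sum>j=1..q. (Z i \<omega> - p) * (Z j \<omega> - p)) / (real q)\<^sup>2)"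
  proof (rule Bochner_Integration.integral_cong[OF refl])
    fix \<omega>
    have "(\<Sum>i=1..q. Z i \<omega>) / real q - p = (\<Sum>i=1..q. Z i \<omega> - p) / real q"
      using q by (simp add: sum_subtractf field_simps)
    then show "((\<Sum>i=1..q. Z i \<omega>) / real q - p)\<^sup>2 = (\<Sum>i=1..q. \<Sum>j=1..q. (Z i \<omega> - p) * (Z j \<omega> - p)) / (real q)\<^sup>2"
      by (simp add: power_divide power2_eq_square sum_product)
  qed
  also have "\<dots> = (\<Sum>i=1..q. \<Sum>j=1..q. expectation (\<lambda>\<omega>. (Z i \<omega> - p) * (Z j \<omega> - p))) / (real q)\<^sup>2"
    using int intm by (simp add: algebra_simps Bochner_Integration.integral_sum)
  also have "(\<Sum>i=1..q. \<Sum>j=1..q. expectation (\<lambda>\<omega>. (Z i \<omega> - p) * (Z j \<omega> - p))) = (\<Sum>i=1..q. \<Sum>j=1..q. cov M (Z i) (Z j))"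
  proof (intro sum.cong refl)
    fix i j assume "i \<in> {1..q}" "j \<in> {1..q}"
    then show "expectation (\<lambda>\<omega>. (Z i \<omega> - p) * (Z j \<omega> - p)) = cov M (Z i) (Z j)"
      using int intm mean by (simp add: cov_def algebra_simps prob_space)
  qed
  also have "\<dots> / (real q)\<^sup>2 \<le> (\<Sum>i=1..q. real q * A + 4 * real m * B\<^sup>2) / (real q)\<^sup>2"
    by (intro divide_right_mono sum_mono row) auto
  also have "\<dots> = 4 * real m * B\<^sup>2 / real q + A"
    using q by (simp add: power2_eq_square field_simps)
  finally show ?thesis .
qed

lemma (in prob_space) prob_abs_ge_le_second_moment:
  assumes "Y \<in> borel_measurable M" "integrable M (\<lambda>\<omega>. (Y \<omega>)\<^sup>2)" "e > 0"
  shows "prob {\<omega>\<in>space M. \<bar>Y \<omega>\<bar> \<ge> e} \<le> expectation (\<lambda>\<omega>. (Y \<omega>)\<^sup>2) / e\<^sup>2"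
proof -
  have "prob {\<omega>\<in>space M. \<bar>Y \<omega>\<bar> \<ge> e} = prob {\<omega>\<in>space M. (Y \<omega>)\<^sup>2 \<ge> e\<^sup>2}"
    using assms(3) abs_le_square_iff[of e] by (intro arg_cong[where f = prob]) auto
  also have "\<dots> \<le> expectation (\<lambda>\<omega>. (Y \<omega>)\<^sup>2) / e\<^sup>2"
    using assms by (intro integral_Markov_inequality_measure[where A = "{}"]) auto
  finally show ?thesis .
qed

section \<open>Self-normalised sums and empirical quantiles as functions of the path\<close>

definition selfnorm_path :: "nat \<Rightarrow> nat \<Rightarrow> (int \<Rightarrow> real) \<Rightarrow> real" where
  "selfnorm_path i b x = (\<Sum>t=i..<i+b. x (int t)) / sqrt (\<Sum>t=i..<i+b. (x (int t))\<^sup>2)"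

lemma cylinder_selfnorm_path: "cylinder {int i..<int (i + b)} (selfnorm_path i b)"
  unfolding selfnorm_path_def
  by (intro cylinder_divide cylinder_sum cylinder_compose[where h = sqrt] cylinder_component
      cylinder_component[where f = "\<lambda>x. x\<^sup>2"] cylinder_component[where f = "\<lambda>x. x"]) auto

lemma cylinder_selfnorm_path_le: "cylinder {int i..<int (i + b)} (\<lambda>x. of_bool (selfnorm_path i b x \<le> c))"
  by (rule cylinder_compose[OF cylinder_selfnorm_path]) measurable

lemma selfnorm_eq_path: "selfnorm X i b \<omega> = selfnorm_path i b (\<lambda>t. X t \<omega>)"
  by (simp add: selfnorm_def selfnorm_path_def)

lemma selfnorm_path_shift: "selfnorm_path i b x = selfnorm_path 1 b (\<lambda>t. x (t + (int i - 1)))"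
proof -
  have *: "(\<Sum>t=i..<i+b. f (int t)) = (\<Sum>t=1..<1+b. f (int t + (int i - 1)))" for f :: "int \<Rightarrow> real"
    by (rule sum.reindex_bij_witness[where i = "\<lambda>t. t + i - 1" and j = "\<lambda>t. t + 1 - i"]) (auto simp: algebra_simps of_nat_diff)
  show ?thesis unfolding selfnorm_path_def *[of x] *[of "\<lambda>t. (x t)\<^sup>2"] ..
qed

lemma Tstat_eq_path: "Tstat X n \<omega> = selfnorm_path 1 n (\<lambda>t. X t \<omega>)"
  by (simp add: Tstat_def selfnorm_path_def atLeastLessThanSuc_atLeastAtMost)

lemma subsample_L_mono: "x \<le> y \<Longrightarrow> subsample_L X n b \<omega> x \<le> subsample_L X n b \<omega> y"
  unfolding subsample_L_def Let_def by (intro divide_right_mono sum_mono) auto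

text \<open>At the largest subsample statistic the empirical distribution function equals 1.
  Together with the lower bound by the smallest one, this makes \<open>Inf\<close> a genuine
  infimum.\<close>

lemma subsample_quantile_set_nonempty:
  assumes "y \<le> 1" shows "{x. subsample_L X n b \<omega> x \<ge> y} \<noteq> {}"
proof -
  define x where "x = Max ((\<lambda>i. selfnorm X i b \<omega>) ` {1..n - b + 1})"
  have "selfnorm X i b \<omega> \<le> x" if "i \<in> {1..n - b + 1}" for i
    unfolding x_def using that by (intro Max_ge) auto
  then have "subsample_L X n b \<omega> x = (\<Sum>i=1..n-b+1. 1) / real (n - b + 1)"
    unfolding subsample_L_def Let_def by (intro arg_cong2[where f = "(/)"] sum.cong) auto
  also have "\<dots> = 1" by simp
  finally show ?thesis using assms by (auto intro!: exI[of _ x])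
qed

lemma subsample_quantile_set_bdd_below:
  assumes "y > 0" shows "bdd_below {x. subsample_L X n b \<omega> x \<ge> y}"
proof -
  define z where "z = Min ((\<lambda>i. selfnorm X i b \<omega>) ` {1..n - b + 1})"
  have z: "z \<le> selfnorm X i b \<omega>" if "i \<in> {1..n - b + 1}" for i
    unfolding z_def using that by (intro Min_le) auto
  have "subsample_L X n b \<omega> x = 0" if "x < z" for x
    unfolding subsample_L_def Let_def using z that by (force intro!: sum.neutral)
  then show ?thesis using assms by (intro bdd_belowI[of _ z]) (force simp: not_less[symmetric])
qed

lemma subsample_C_le:
  assumes "y > 0" "subsample_L X n b \<omega> x \<ge> y" shows "subsample_C X n b \<omega> y \<le> x"
  unfolding subsample_C_def using assms subsample_quantile_set_bdd_below[OF assms(1)] by (intro cInf_lower) auto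

lemma subsample_C_ge:
  assumes "y \<le> 1" "subsample_L X n b \<omega> x < y" shows "x \<le> subsample_C X n b \<omega> y"
  unfolding subsample_C_def
proof (rule cInf_greatest[OF subsample_quantile_set_nonempty[OF assms(1)]])
  fix z assume "z \<in> {x. y \<le> subsample_L X n b \<omega> x}"
  then show "x \<le> z" using subsample_L_mono[of z x X n b \<omega>] assms(2) by (cases "x \<le> z") auto
qed

lemma subsample_C_mono:
  assumes "0 < y" "y \<le> z" "z \<le> 1"
  shows "subsample_C X n b \<omega> y \<le> subsample_C X n b \<omega> z"
  unfolding subsample_C_def using assms
  by (intro cInf_superset_mono subsample_quantile_set_bdd_below subsample_quantile_set_nonempty) auto

text \<open>Monotonicity lets the witness be rational, which turns the event into a countable union
  and yields measurability of the quantile.\<close>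

lemma subsample_C_less_iff:
  assumes "0 < y" "y \<le> 1"
  shows "subsample_C X n b \<omega> y < c \<longleftrightarrow> (\<exists>r\<in>\<rat>. r < c \<and> y \<le> subsample_L X n b \<omega> r)"
proof
  assume "subsample_C X n b \<omega> y < c"
  then obtain x where x: "y \<le> subsample_L X n b \<omega> x" "x < c"
    unfolding subsample_C_def by (auto dest!: cInf_lessD[OF subsample_quantile_set_nonempty[OF assms(2)]])
  obtain r where "r \<in> \<rat>" "x < r" "r < c" using Rats_dense_in_real[OF x(2)] by auto
  then show "\<exists>r\<in>\<rat>. r < c \<and> y \<le> subsample_L X n b \<omega> r"
    using subsample_L_mono[of x r X n b \<omega>] x(1) by (intro bexI[of _ r]) auto
next
  assume "\<exists>r\<in>\<rat>. r < c \<and> y \<le> subsample_L X n b \<omega> r"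
  then show "subsample_C X n b \<omega> y < c" using subsample_C_le[OF assms(1)] by (meson order_le_less_trans)
qed

context stationary_process
begin

lemma measurable_selfnorm [measurable]: "selfnorm X i b \<in> borel_measurable M"
  using measurable_cylinder0[OF cylinder_selfnorm_path, of i b] by (simp add: selfnorm_eq_path[abs_def])

lemma measurable_Tstat [measurable]: "Tstat X n \<in> borel_measurable M"
  using measurable_cylinder0[OF cylinder_selfnorm_path, of 1 n] by (simp add: Tstat_eq_path[abs_def])

lemma measurable_subsample_L [measurable]: "(\<lambda>\<omega>. subsample_L X n b \<omega> x) \<in> borel_measurable M"
  unfolding subsample_L_def Let_def by measurable

lemma measurable_subsample_C:
  assumes "0 < y" "y \<le> 1" shows "(\<lambda>\<omega>. subsample_C X n b \<omega> y) \<in> borel_measurable M"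
proof (subst borel_measurable_iff_less, intro allI)
  fix c
  have "{\<omega> \<in> space M. subsample_C X n b \<omega> y < c} =
      (\<Union>r\<in>\<rat> \<inter> {..<c}. {\<omega>\<in>space M. y \<le> subsample_L X n b \<omega> r})"
    by (auto simp: subsample_C_less_iff[OF assms])
  also have "\<dots> \<in> sets M"
    by (intro sets.countable_UN' countable_Int1 countable_rat) auto
  finally show "{\<omega> \<in> space M. subsample_C X n b \<omega> y < c} \<in> sets M" .
qed

lemma selfnorm_cov_le:
  assumes "i + (b + k) \<le> j"
  shows "\<bar>cov M (\<lambda>\<omega>. of_bool (selfnorm X i b \<omega> \<le> c)) (\<lambda>\<omega>. of_bool (selfnorm X j b \<omega> \<le> c))\<bar> \<le> alpha k"
  unfolding selfnorm_eq_path using assms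
  by (intro abs_cov_cylinder_le1[where s = "int (i + b)", OF _ _ _ _ cylinder_selfnorm_path_le cylinder_selfnorm_path_le]) auto

text \<open>By stationarity every window has the law of the statistic of a sample of size b, so this
  common probability is the mean of the empirical distribution function.\<close>

lemma prob_selfnorm_le: "prob {\<omega>\<in>space M. selfnorm X i b \<omega> \<le> c} = prob {\<omega>\<in>space M. Tstat X b \<omega> \<le> c}"
proof -
  have "cylinder {1..<int (1 + b)} (\<lambda>x. of_bool (selfnorm_path 1 b x \<le> c))"
    using cylinder_selfnorm_path_le[of 1 b c] by simp
  from prob_shift[OF _ this, of "int i - 1"] show ?thesis
    by (simp add: selfnorm_eq_path Tstat_eq_path selfnorm_path_shift[of i])
qed

text \<open>Windows of length b whose starts differ by at least b + k are k apart, so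
  \<open>second_moment_average_le\<close> applies with separation b + k, B = 1 and A =
  \<open>alpha\<close> k.\<close>

lemma subsample_L_second_moment:
  "expectation (\<lambda>\<omega>. (subsample_L X n b \<omega> c - prob {\<omega>\<in>space M. Tstat X b \<omega> \<le> c})\<^sup>2)
     \<le> 4 * real (b + k) / real (n - b + 1) + alpha k"
proof -
  have "expectation (\<lambda>\<omega>. ((\<Sum>i=1..n-b+1. of_bool (selfnorm X i b \<omega> \<le> c)) / real (n - b + 1)
       - prob {\<omega>\<in>space M. Tstat X b \<omega> \<le> c})\<^sup>2) \<le> 4 * real (b + k) * 1\<^sup>2 / real (n - b + 1) + alpha k"
    by (rule second_moment_average_le)
       (auto simp: prob_selfnorm_le expectation_of_bool alpha_nonneg intro!: selfnorm_cov_le)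
  then show ?thesis by (simp add: subsample_L_def of_bool_def)
qed

lemma subsample_L_bounded: "0 \<le> subsample_L X n b \<omega> x" "subsample_L X n b \<omega> x \<le> 1"
proof -
  show "0 \<le> subsample_L X n b \<omega> x" unfolding subsample_L_def Let_def by (intro divide_nonneg_nonneg sum_nonneg) auto
  have "(\<Sum>i=1..n-b+1. if selfnorm X i b \<omega> \<le> x then 1 else 0) \<le> (\<Sum>i=1..n-b+1. 1::real)"
    by (intro sum_mono) auto
  then show "subsample_L X n b \<omega> x \<le> 1" unfolding subsample_L_def Let_def by simp
qed

text \<open>The threshold c n may move with n because the nonzero-mean case evaluates the empirical
  distribution function along moving thresholds.\<close>

lemma subsample_L_concentrates:
  assumes b: "(\<lambda>n. real (b n) / real n) \<longlonglongrightarrow> 0" and \<alpha>: "alpha \<longlonglongrightarrow> 0" and e: "e > 0"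
  shows "(\<lambda>n. prob {\<omega>\<in>space M. \<bar>subsample_L X n (b n) \<omega> (c n) - prob {\<omega>\<in>space M. Tstat X (b n) \<omega> \<le> c n}\<bar> \<ge> e}) \<longlonglongrightarrow> 0"
proof -
  define V where "V n = expectation (\<lambda>\<omega>. (subsample_L X n (b n) \<omega> (c n) - prob {\<omega>\<in>space M. Tstat X (b n) \<omega> \<le> c n})\<^sup>2)" for n
  have V0: "V n \<ge> 0" for n unfolding V_def by simp
  have "V \<longlonglongrightarrow> 0"
  proof (rule tendstoI)
    fix r :: real assume r: "r > 0"
    \<comment> \<open>The gap k is fixed before n, so that (b n + k) / n still tends to 0.\<close>
    have "eventually (\<lambda>k. alpha k < r / 2) sequentially"
      using \<alpha> r by (intro order_tendstoD) auto
    then obtain k where k: "alpha k < r / 2" by (auto simp: eventually_sequentially)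
    have lim: "(\<lambda>n. 4 * (real (b n) / real n + real k / real n) / (1 - real (b n) / real n)) \<longlonglongrightarrow> 4 * (0 + 0) / (1 - 0)"
      using b by (intro tendsto_intros lim_const_over_n) auto
    then have ev: "eventually (\<lambda>n. 4 * (real (b n) / real n + real k / real n) / (1 - real (b n) / real n) < r / 2) sequentially"
      using r by (intro order_tendstoD[OF lim]) auto
    have ev2: "eventually (\<lambda>n. real (b n) / real n < 1) sequentially"
      using b by (intro order_tendstoD) auto
    show "eventually (\<lambda>n. dist (V n) 0 < r) sequentially"
      using ev ev2 eventually_gt_at_top[of 0]
    proof eventually_elim
      case (elim n)
      have bn: "b n < n" using elim by simp
      have "V n \<le> 4 * real (b n + k) / real (n - b n + 1) + alpha k"
        unfolding V_def by (rule subsample_L_second_moment)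
      also have "4 * real (b n + k) / real (n - b n + 1) \<le> 4 * real (b n + k) / (real n - real (b n))"
        using bn by (intro divide_left_mono) auto
      also have "\<dots> = 4 * (real (b n) / real n + real k / real n) / (1 - real (b n) / real n)"
        using bn elim by (simp add: field_simps)
      finally have "V n < r" using elim(1) k by linarith
      then show ?case using V0[of n] by (simp add: dist_real_def)
    qed
  qed
  then have "(\<lambda>n. V n / e\<^sup>2) \<longlonglongrightarrow> 0 / e\<^sup>2" by (intro tendsto_intros) (use e in auto)
  then have lim: "(\<lambda>n. V n / e\<^sup>2) \<longlonglongrightarrow> 0" by simp
  show ?thesis
  proof (rule tendsto_sandwich[OF _ _ tendsto_const lim]; intro always_eventually allI)
    fix n
    have "integrable M (\<lambda>\<omega>. (subsample_L X n (b n) \<omega> (c n) - prob {\<omega>\<in>space M. Tstat X (b n) \<omega> \<le> c n})\<^sup>2)"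
    proof (rule integrable_const_bound[where B = 1], rule AE_I2)
      fix \<omega>
      have "\<bar>subsample_L X n (b n) \<omega> (c n) - prob {\<omega>\<in>space M. Tstat X (b n) \<omega> \<le> c n}\<bar> \<le> 1"
        using subsample_L_bounded[of n "b n" \<omega> "c n"] prob_le_1[of "{\<omega>\<in>space M. Tstat X (b n) \<omega> \<le> c n}"]
          measure_nonneg[of M "{\<omega>\<in>space M. Tstat X (b n) \<omega> \<le> c n}"] by linarith
      then show "norm ((subsample_L X n (b n) \<omega> (c n) - prob {\<omega>\<in>space M. Tstat X (b n) \<omega> \<le> c n})\<^sup>2) \<le> 1"
        by (simp add: abs_square_le_1)
    qed measurable
    then show "prob {\<omega>\<in>space M. \<bar>subsample_L X n (b n) \<omega> (c n) - prob {\<omega>\<in>space M. Tstat X (b n) \<omega> \<le> c n}\<bar> \<ge> e} \<le> V n / e\<^sup>2"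
      unfolding V_def using e by (intro prob_abs_ge_le_second_moment) auto
  qed simp
qed

text \<open>Eventually the mean lies below the midpoint of p and y, so reaching y takes a deviation
  of at least (y - p) / 2.\<close>

lemma subsample_L_ge_vanishes:
  assumes b: "(\<lambda>n. real (b n) / real n) \<longlonglongrightarrow> 0" and \<alpha>: "alpha \<longlonglongrightarrow> 0"
    and p: "(\<lambda>n. prob {\<omega>\<in>space M. Tstat X (b n) \<omega> \<le> c n}) \<longlonglongrightarrow> p" and py: "p < y"
  shows "(\<lambda>n. prob {\<omega>\<in>space M. subsample_L X n (b n) \<omega> (c n) \<ge> y}) \<longlonglongrightarrow> 0"
proof (rule tendsto_sandwich[OF _ _ tendsto_const subsample_L_concentrates[OF b \<alpha>, of "(y - p) / 2" c]])
  have "eventually (\<lambda>n. prob {\<omega>\<in>space M. Tstat X (b n) \<omega> \<le> c n} < (p + y) / 2) sequentially"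
    using p py by (intro order_tendstoD) auto
  then show "eventually (\<lambda>n. prob {\<omega>\<in>space M. subsample_L X n (b n) \<omega> (c n) \<ge> y} \<le>
    prob {\<omega>\<in>space M. \<bar>subsample_L X n (b n) \<omega> (c n) - prob {\<omega>\<in>space M. Tstat X (b n) \<omega> \<le> c n}\<bar> \<ge> (y - p) / 2}) sequentially"
  proof eventually_elim
    case (elim n)
    show ?case
    proof (rule finite_measure_mono)
      have *: "\<bar>L - P\<bar> \<ge> (y - p) / 2" if "L \<ge> y" "P < (p + y) / 2" for L P
        using that py by (simp add: field_simps abs_if)
      show "{\<omega>\<in>space M. subsample_L X n (b n) \<omega> (c n) \<ge> y} \<subseteq> {\<omega>\<in>space M. \<bar>subsample_L X n (b n) \<omega> (c n) - prob {\<omega>\<in>space M. Tstat X (b n) \<omega> \<le> c n}\<bar> \<ge> (y - p) / 2}"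
        using * elim by blast
    qed measurable
  qed
qed (use py in auto)

lemma subsample_L_less_vanishes:
  assumes b: "(\<lambda>n. real (b n) / real n) \<longlonglongrightarrow> 0" and \<alpha>: "alpha \<longlonglongrightarrow> 0"
    and p: "(\<lambda>n. prob {\<omega>\<in>space M. Tstat X (b n) \<omega> \<le> c n}) \<longlonglongrightarrow> p" and py: "y < p"
  shows "(\<lambda>n. prob {\<omega>\<in>space M. subsample_L X n (b n) \<omega> (c n) < y}) \<longlonglongrightarrow> 0"
proof (rule tendsto_sandwich[OF _ _ tendsto_const subsample_L_concentrates[OF b \<alpha>, of "(p - y) / 2" c]])
  have "eventually (\<lambda>n. prob {\<omega>\<in>space M. Tstat X (b n) \<omega> \<le> c n} > (p + y) / 2) sequentially"
    using p py by (intro order_tendstoD) auto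
  then show "eventually (\<lambda>n. prob {\<omega>\<in>space M. subsample_L X n (b n) \<omega> (c n) < y} \<le>
    prob {\<omega>\<in>space M. \<bar>subsample_L X n (b n) \<omega> (c n) - prob {\<omega>\<in>space M. Tstat X (b n) \<omega> \<le> c n}\<bar> \<ge> (p - y) / 2}) sequentially"
  proof eventually_elim
    case (elim n)
    show ?case
    proof (rule finite_measure_mono)
      have *: "\<bar>L - P\<bar> \<ge> (p - y) / 2" if "L < y" "P > (p + y) / 2" for L P
        using that py by (simp add: field_simps abs_if)
      show "{\<omega>\<in>space M. subsample_L X n (b n) \<omega> (c n) < y} \<subseteq> {\<omega>\<in>space M. \<bar>subsample_L X n (b n) \<omega> (c n) - prob {\<omega>\<in>space M. Tstat X (b n) \<omega> \<le> c n}\<bar> \<ge> (p - y) / 2}"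
        using * elim by blast
    qed measurable
  qed
qed (use py in auto)

end

section \<open>From empirical quantiles to the noncoverage probability\<close>

context stationary_process
begin

lemma prob_greater_eq:
  fixes Y :: "'a \<Rightarrow> real"
  assumes [measurable]: "Y \<in> borel_measurable M"
  shows "prob {\<omega>\<in>space M. Y \<omega> > c} = 1 - prob {\<omega>\<in>space M. Y \<omega> \<le> c}"
proof -
  have "{\<omega>\<in>space M. Y \<omega> > c} = space M - {\<omega>\<in>space M. Y \<omega> \<le> c}" by auto
  then show ?thesis by (simp add: prob_compl)
qed

text \<open>Falling below the lower quantile and exceeding the upper one exclude each other, since
  the quantiles are ordered.\<close>

lemma noncover_prob_eq:
  assumes "0 < \<eta>" "\<eta> < 1"
  shows "noncover_prob M X b \<eta> n =
     prob {\<omega>\<in>space M. Tstat X n \<omega> < subsample_C X n (b n) \<omega> (\<eta>/2)} +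
     prob {\<omega>\<in>space M. Tstat X n \<omega> > subsample_C X n (b n) \<omega> (1 - \<eta>/2)}"
proof -
  have [measurable]: "(\<lambda>\<omega>. subsample_C X n (b n) \<omega> (\<eta>/2)) \<in> borel_measurable M"
    "(\<lambda>\<omega>. subsample_C X n (b n) \<omega> (1 - \<eta>/2)) \<in> borel_measurable M"
    using assms by (auto intro!: measurable_subsample_C)
  have le: "subsample_C X n (b n) \<omega> (\<eta>/2) \<le> subsample_C X n (b n) \<omega> (1 - \<eta>/2)" for \<omega>
    using assms by (intro subsample_C_mono) auto
  have "{\<omega>\<in>space M. Tstat X n \<omega> \<notin> {subsample_C X n (b n) \<omega> (\<eta>/2) .. subsample_C X n (b n) \<omega> (1 - \<eta>/2)}}
     = {\<omega>\<in>space M. Tstat X n \<omega> < subsample_C X n (b n) \<omega> (\<eta>/2)} \<union>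
       {\<omega>\<in>space M. Tstat X n \<omega> > subsample_C X n (b n) \<omega> (1 - \<eta>/2)}"
    by auto
  moreover have "{\<omega>\<in>space M. Tstat X n \<omega> < subsample_C X n (b n) \<omega> (\<eta>/2)} \<inter>
       {\<omega>\<in>space M. Tstat X n \<omega> > subsample_C X n (b n) \<omega> (1 - \<eta>/2)} = {}"
  proof (rule equals0I)
    fix \<omega> assume "\<omega> \<in> {\<omega>\<in>space M. Tstat X n \<omega> < subsample_C X n (b n) \<omega> (\<eta>/2)} \<inter>
       {\<omega>\<in>space M. Tstat X n \<omega> > subsample_C X n (b n) \<omega> (1 - \<eta>/2)}"
    then show False using le[of \<omega>] by simp
  qed
  ultimately show ?thesis unfolding noncover_prob_def
    by (simp add: finite_measure_Union)
qed

text \<open>Comparisons with a deterministic threshold c: L(c) >= y forces the quantile to be at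
  most c, and L(c) < y forces it to be at least c. In the second case equality can occur, hence the
  extra point c' < c when T has to lie strictly below the quantile.\<close>

lemma subsample_C_exceedance_bounds:
  assumes y: "0 < y" "y \<le> 1"
  shows "prob {\<omega>\<in>space M. Tstat X n \<omega> < subsample_C X n b \<omega> y}
      \<le> prob {\<omega>\<in>space M. Tstat X n \<omega> \<le> c} + prob {\<omega>\<in>space M. subsample_L X n b \<omega> c < y}"
    and "prob {\<omega>\<in>space M. Tstat X n \<omega> > c} - prob {\<omega>\<in>space M. subsample_L X n b \<omega> c < y}
      \<le> prob {\<omega>\<in>space M. Tstat X n \<omega> > subsample_C X n b \<omega> y}"
    and "c' < c \<Longrightarrow> prob {\<omega>\<in>space M. Tstat X n \<omega> \<le> c'} - prob {\<omega>\<in>space M. subsample_L X n b \<omega> c \<ge> y}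
      \<le> prob {\<omega>\<in>space M. Tstat X n \<omega> < subsample_C X n b \<omega> y}"
    and "prob {\<omega>\<in>space M. Tstat X n \<omega> > subsample_C X n b \<omega> y}
      \<le> prob {\<omega>\<in>space M. Tstat X n \<omega> > c} + prob {\<omega>\<in>space M. subsample_L X n b \<omega> c \<ge> y}"
proof -
  note [measurable] = measurable_subsample_C[OF y]
  have C1: "y \<le> subsample_L X n b \<omega> c \<Longrightarrow> subsample_C X n b \<omega> y \<le> c" for \<omega>
    using subsample_C_le[OF y(1)] .
  have C2: "subsample_L X n b \<omega> c < y \<Longrightarrow> c \<le> subsample_C X n b \<omega> y" for \<omega>
    using subsample_C_ge[OF y(2)] .
  have sub: "prob A \<le> prob B + prob C" if "A \<subseteq> B \<union> C" "B \<in> sets M" "C \<in> sets M" for A B C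
    using finite_measure_mono[OF that(1)] measure_Un_le[OF that(2,3)] that by (meson order_trans sets.Un)
  show "prob {\<omega>\<in>space M. Tstat X n \<omega> < subsample_C X n b \<omega> y}
      \<le> prob {\<omega>\<in>space M. Tstat X n \<omega> \<le> c} + prob {\<omega>\<in>space M. subsample_L X n b \<omega> c < y}"
    by (rule sub) (auto simp: not_less not_le dest!: C1)
  have "prob {\<omega>\<in>space M. Tstat X n \<omega> > c} \<le> prob {\<omega>\<in>space M. Tstat X n \<omega> > subsample_C X n b \<omega> y}
      + prob {\<omega>\<in>space M. subsample_L X n b \<omega> c < y}"
    by (rule sub) (auto simp: not_less not_le dest!: C1)
  then show "prob {\<omega>\<in>space M. Tstat X n \<omega> > c} - prob {\<omega>\<in>space M. subsample_L X n b \<omega> c < y}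
      \<le> prob {\<omega>\<in>space M. Tstat X n \<omega> > subsample_C X n b \<omega> y}" by simp
  show "prob {\<omega>\<in>space M. Tstat X n \<omega> > subsample_C X n b \<omega> y}
      \<le> prob {\<omega>\<in>space M. Tstat X n \<omega> > c} + prob {\<omega>\<in>space M. subsample_L X n b \<omega> c \<ge> y}"
    by (rule sub) (auto simp: not_less not_le dest!: C2)
  show "prob {\<omega>\<in>space M. Tstat X n \<omega> \<le> c'} - prob {\<omega>\<in>space M. subsample_L X n b \<omega> c \<ge> y}
      \<le> prob {\<omega>\<in>space M. Tstat X n \<omega> < subsample_C X n b \<omega> y}" if "c' < c"
  proof -
    have "prob {\<omega>\<in>space M. Tstat X n \<omega> \<le> c'} \<le> prob {\<omega>\<in>space M. Tstat X n \<omega> < subsample_C X n b \<omega> y}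
        + prob {\<omega>\<in>space M. subsample_L X n b \<omega> c \<ge> y}"
      by (rule sub) (use that in \<open>auto simp: not_less not_le dest!: C2\<close>)
    then show ?thesis by simp
  qed
qed

lemma subsample_quantile_exceedance:
  fixes F :: "real \<Rightarrow> real"
  assumes b: "filterlim b at_top sequentially" "(\<lambda>n. real (b n) / real n) \<longlonglongrightarrow> 0" and \<alpha>: "alpha \<longlonglongrightarrow> 0"
    and conv: "\<And>x. isCont F x \<Longrightarrow> (\<lambda>n. prob {\<omega>\<in>space M. Tstat X n \<omega> \<le> x}) \<longlonglongrightarrow> F x"
    and y: "0 < y" "y < 1"
    and \<delta>: "\<delta> > 0" "\<And>x. x \<in> ball c \<delta> \<Longrightarrow> isCont F x"
    and below: "\<And>x. x < c \<Longrightarrow> F x < y" and above: "\<And>x. c < x \<Longrightarrow> y < F x"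
  shows "(\<lambda>n. prob {\<omega>\<in>space M. Tstat X n \<omega> < subsample_C X n (b n) \<omega> y}) \<longlonglongrightarrow> y"
    and "(\<lambda>n. prob {\<omega>\<in>space M. Tstat X n \<omega> > subsample_C X n (b n) \<omega> y}) \<longlonglongrightarrow> 1 - y"
proof -
  have cont: "isCont F c" using \<delta> by simp
  have left: "(F \<longlongrightarrow> F c) (at_left c)" and right: "(F \<longlongrightarrow> F c) (at_right c)"
    using cont by (auto simp: isCont_def filterlim_at_split)
  \<comment> \<open>The hypotheses give strict inequalities on either side of c; continuity turns
    them into F c = y.\<close>
  have "F c \<le> y" by (rule tendsto_upperbound[OF left]) (auto simp: eventually_at_filter intro!: always_eventually less_imp_le below)
  moreover have "y \<le> F c" by (rule tendsto_lowerbound[OF right]) (auto simp: eventually_at_filter intro!: always_eventually less_imp_le above)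
  ultimately have Fc: "F c = y" by simp
  have main: "eventually (\<lambda>n. \<bar>prob {\<omega>\<in>space M. Tstat X n \<omega> < subsample_C X n (b n) \<omega> y} - y\<bar> < e
     \<and> \<bar>prob {\<omega>\<in>space M. Tstat X n \<omega> > subsample_C X n (b n) \<omega> y} - (1 - y)\<bar> < e) sequentially" if e: "e > 0" for e
  proof -
    obtain d where d: "d > 0" "\<And>x. \<bar>x - c\<bar> < d \<Longrightarrow> \<bar>F x - F c\<bar> < e / 4"
      using cont e unfolding continuous_at_eps_delta dist_real_def by (meson divide_pos_pos zero_less_numeral)
    define h where "h = min d \<delta> / 2"
    have h: "h > 0" "h < d" "h < \<delta>" using d \<delta> by (auto simp: h_def)
    \<comment> \<open>All probes lie in the ball where F is continuous. There are two on the left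
      because the lower bound for the event T < C uses a threshold for T that is strictly smaller
      than the one for L.\<close>
    define x1 x1' x2 where "x1 = c - h" and "x1' = c - h / 2" and "x2 = c + h"
    have cx: "isCont F x1" "isCont F x1'" "isCont F x2"
      using h by (auto simp: x1_def x1'_def x2_def dist_real_def intro!: \<delta>(2))
    have Fx: "F x1 > y - e / 4" "F x2 < y + e / 4"
    proof -
      have "\<bar>F x1 - y\<bar> < e / 4" "\<bar>F x2 - y\<bar> < e / 4"
        using d(2)[of x1] d(2)[of x2] h by (simp_all add: x1_def x2_def Fc)
      then show "F x1 > y - e / 4" "F x2 < y + e / 4" by linarith+
    qed
    have convb: "(\<lambda>n. prob {\<omega>\<in>space M. Tstat X (b n) \<omega> \<le> x}) \<longlonglongrightarrow> F x" if "isCont F x" for x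
      by (rule filterlim_compose[OF conv[OF that] b(1)])
    have L1: "eventually (\<lambda>n. prob {\<omega>\<in>space M. subsample_L X n (b n) \<omega> x1 \<ge> y} < e / 4) sequentially"
      using subsample_L_ge_vanishes[OF b(2) \<alpha> convb[OF cx(1)], of y] below[of x1] h e
      by (intro order_tendstoD(2)[of _ 0]) (auto simp: x1_def)
    have L1': "eventually (\<lambda>n. prob {\<omega>\<in>space M. subsample_L X n (b n) \<omega> x1' \<ge> y} < e / 4) sequentially"
      using subsample_L_ge_vanishes[OF b(2) \<alpha> convb[OF cx(2)], of y] below[of x1'] h e
      by (intro order_tendstoD(2)[of _ 0]) (auto simp: x1'_def)
    have L2: "eventually (\<lambda>n. prob {\<omega>\<in>space M. subsample_L X n (b n) \<omega> x2 < y} < e / 4) sequentially"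
      using subsample_L_less_vanishes[OF b(2) \<alpha> convb[OF cx(3)], of y] above[of x2] h e
      by (intro order_tendstoD(2)[of _ 0]) (auto simp: x2_def)
    have T1: "eventually (\<lambda>n. \<bar>prob {\<omega>\<in>space M. Tstat X n \<omega> \<le> x1} - F x1\<bar> < e / 4) sequentially"
      using tendstoD[OF conv[OF cx(1)], of "e / 4"] e by (simp add: dist_real_def)
    have T2: "eventually (\<lambda>n. \<bar>prob {\<omega>\<in>space M. Tstat X n \<omega> \<le> x2} - F x2\<bar> < e / 4) sequentially"
      using tendstoD[OF conv[OF cx(3)], of "e / 4"] e by (simp add: dist_real_def)
    have Fc': "F x1 < y" "F x2 > y" using below[of x1] above[of x2] h by (auto simp: x1_def x2_def)
    have xx: "x1 < x1'" using h by (simp add: x1_def x1'_def)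
    show ?thesis using L1 L1' L2 T1 T2
    proof eventually_elim
      case (elim n)
      have y': "y \<le> 1" using y by simp
      show ?case
        using elim Fx Fc' subsample_C_exceedance_bounds(1,2)[OF y(1) y', where n = n and b = "b n" and c = x2]
          subsample_C_exceedance_bounds(4)[OF y(1) y', where n = n and b = "b n" and c = x1]
          subsample_C_exceedance_bounds(3)[OF y(1) y' xx, where n = n and b = "b n"] prob_greater_eq[OF measurable_Tstat, of x1 n]
          prob_greater_eq[OF measurable_Tstat, of x2 n]
        by linarith
    qed
  qed
  show "(\<lambda>n. prob {\<omega>\<in>space M. Tstat X n \<omega> < subsample_C X n (b n) \<omega> y}) \<longlonglongrightarrow> y"
    by (rule tendstoI, rule eventually_mono[OF main]) (auto simp: dist_real_def)
  show "(\<lambda>n. prob {\<omega>\<in>space M. Tstat X n \<omega> > subsample_C X n (b n) \<omega> y}) \<longlonglongrightarrow> 1 - y"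
    by (rule tendstoI, rule eventually_mono[OF main]) (auto simp: dist_real_def)
qed

theorem noncover_prob_tendsto:
  fixes F :: "real \<Rightarrow> real"
  assumes b: "filterlim b at_top sequentially" "(\<lambda>n. real (b n) / real n) \<longlonglongrightarrow> 0" and \<alpha>: "alpha \<longlonglongrightarrow> 0"
    and \<eta>: "0 < \<eta>" "\<eta> < 1"
    and conv: "\<And>x. isCont F x \<Longrightarrow> (\<lambda>n. prob {\<omega>\<in>space M. Tstat X n \<omega> \<le> x}) \<longlonglongrightarrow> F x"
    and \<delta>1: "\<exists>\<delta>>0. \<forall>x\<in>ball c1 \<delta>. isCont F x" and c1: "\<And>x. x < c1 \<Longrightarrow> F x < \<eta>/2" "\<And>x. c1 < x \<Longrightarrow> \<eta>/2 < F x"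
    and \<delta>2: "\<exists>\<delta>>0. \<forall>x\<in>ball c2 \<delta>. isCont F x" and c2: "\<And>x. x < c2 \<Longrightarrow> F x < 1 - \<eta>/2" "\<And>x. c2 < x \<Longrightarrow> 1 - \<eta>/2 < F x"
  shows "noncover_prob M X b \<eta> \<longlonglongrightarrow> \<eta>"
proof -
  have 1: "(\<lambda>n. prob {\<omega>\<in>space M. Tstat X n \<omega> < subsample_C X n (b n) \<omega> (\<eta>/2)}) \<longlonglongrightarrow> \<eta>/2"
    using \<delta>1 \<eta> subsample_quantile_exceedance(1)[OF b \<alpha> conv _ _ _ _ c1] by force
  have 2: "(\<lambda>n. prob {\<omega>\<in>space M. Tstat X n \<omega> > subsample_C X n (b n) \<omega> (1 - \<eta>/2)}) \<longlonglongrightarrow> 1 - (1 - \<eta>/2)"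
    using \<delta>2 \<eta> subsample_quantile_exceedance(2)[OF b \<alpha> conv _ _ _ _ c2] by force
  have "(\<lambda>n. noncover_prob M X b \<eta> n) \<longlonglongrightarrow> \<eta>/2 + (1 - (1 - \<eta>/2))"
    unfolding noncover_prob_eq[OF \<eta>] by (intro tendsto_add 1 2)
  then show ?thesis by simp
qed

lemma noncover_prob_le_1: "noncover_prob M X b \<eta> n \<le> 1"
  unfolding noncover_prob_def by simp

text \<open>One side of the interval suffices: most subsample statistics are at most c n, hence so
  is the upper quantile, while the full statistic exceeds c n.\<close>

theorem noncover_prob_tendsto_1_pos:
  assumes b: "(\<lambda>n. real (b n) / real n) \<longlonglongrightarrow> 0" and \<alpha>: "alpha \<longlonglongrightarrow> 0" and \<eta>: "0 < \<eta>" "\<eta> < 1"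
    and sub: "(\<lambda>n. prob {\<omega>\<in>space M. Tstat X (b n) \<omega> \<le> c n}) \<longlonglongrightarrow> 1"
    and full: "(\<lambda>n. prob {\<omega>\<in>space M. Tstat X n \<omega> > c n}) \<longlonglongrightarrow> 1"
  shows "noncover_prob M X b \<eta> \<longlonglongrightarrow> 1"
proof (rule tendsto_sandwich[OF _ _ _ tendsto_const])
  have "(\<lambda>n. prob {\<omega>\<in>space M. subsample_L X n (b n) \<omega> (c n) < 1 - \<eta>/2}) \<longlonglongrightarrow> 0"
    by (rule subsample_L_less_vanishes[OF b \<alpha> sub]) (use \<eta> in auto)
  from tendsto_diff[OF full this]
  show "(\<lambda>n. prob {\<omega>\<in>space M. Tstat X n \<omega> > c n} - prob {\<omega>\<in>space M. subsample_L X n (b n) \<omega> (c n) < 1 - \<eta>/2}) \<longlonglongrightarrow> 1"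
    by simp
  show "eventually (\<lambda>n. prob {\<omega>\<in>space M. Tstat X n \<omega> > c n} - prob {\<omega>\<in>space M. subsample_L X n (b n) \<omega> (c n) < 1 - \<eta>/2} \<le> noncover_prob M X b \<eta> n) sequentially"
  proof (intro always_eventually allI)
    fix n
    show "prob {\<omega>\<in>space M. Tstat X n \<omega> > c n} - prob {\<omega>\<in>space M. subsample_L X n (b n) \<omega> (c n) < 1 - \<eta>/2} \<le> noncover_prob M X b \<eta> n"
      unfolding noncover_prob_eq[OF \<eta>] using \<eta> 
      by (intro order_trans[OF subsample_C_exceedance_bounds(2)]) auto
  qed
qed (auto simp: noncover_prob_le_1)

text \<open>The mirror image at the lower quantile. Two thresholds c' < c appear because the full
  statistic has to fall strictly below a quantile that is only known to be at least c.\<close>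

theorem noncover_prob_tendsto_1_neg:
  assumes b: "(\<lambda>n. real (b n) / real n) \<longlonglongrightarrow> 0" and \<alpha>: "alpha \<longlonglongrightarrow> 0" and \<eta>: "0 < \<eta>" "\<eta> < 1"
    and sub: "(\<lambda>n. prob {\<omega>\<in>space M. Tstat X (b n) \<omega> \<le> c n}) \<longlonglongrightarrow> 0"
    and full: "(\<lambda>n. prob {\<omega>\<in>space M. Tstat X n \<omega> \<le> c' n}) \<longlonglongrightarrow> 1" and less: "eventually (\<lambda>n. c' n < c n) sequentially"
  shows "noncover_prob M X b \<eta> \<longlonglongrightarrow> 1"
proof (rule tendsto_sandwich[OF _ _ _ tendsto_const])
  have "(\<lambda>n. prob {\<omega>\<in>space M. subsample_L X n (b n) \<omega> (c n) \<ge> \<eta>/2}) \<longlonglongrightarrow> 0"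
    by (rule subsample_L_ge_vanishes[OF b \<alpha> sub]) (use \<eta> in auto)
  from tendsto_diff[OF full this]
  show "(\<lambda>n. prob {\<omega>\<in>space M. Tstat X n \<omega> \<le> c' n} - prob {\<omega>\<in>space M. subsample_L X n (b n) \<omega> (c n) \<ge> \<eta>/2}) \<longlonglongrightarrow> 1"
    by simp
  show "eventually (\<lambda>n. prob {\<omega>\<in>space M. Tstat X n \<omega> \<le> c' n} - prob {\<omega>\<in>space M. subsample_L X n (b n) \<omega> (c n) \<ge> \<eta>/2} \<le> noncover_prob M X b \<eta> n) sequentially"
    using less
  proof eventually_elim
    case (elim n)
    then show ?case
      unfolding noncover_prob_eq[OF \<eta>] using \<eta> 
      by (intro order_trans[OF subsample_C_exceedance_bounds(3)]) auto
  qed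
qed (auto simp: noncover_prob_le_1)

section \<open>Weak law of large numbers under mixing\<close>

lemma cov_pair_marginal_le:
  assumes f: "f \<in> borel_measurable borel" "\<And>x. \<bar>f x\<bar> \<le> B" "B > 0" and g: "g \<in> borel_measurable borel" "\<And>x. \<bar>g x\<bar> \<le> C" "C > 0"
    and "s + int k \<le> t"
  shows "\<bar>cov M (\<lambda>\<omega>. f (X s \<omega>)) (\<lambda>\<omega>. g (X t \<omega>))\<bar> \<le> B * C * alpha k"
  using assms
  by (intro abs_cov_cylinder_le[of "{s}" "{t}" s k "\<lambda>x. f (x s)" "\<lambda>x. g (x t)"])
     (auto intro!: cylinder_component)

lemma integrable_bounded:
  assumes "Y \<in> borel_measurable M" "\<And>\<omega>. \<omega> \<in> space M \<Longrightarrow> \<bar>Y \<omega>\<bar> \<le> B" shows "integrable M (Y :: 'a \<Rightarrow> real)"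
  using assms by (intro integrable_const_bound[where B = B]) auto

lemma abs_expectation_le_sqrt:
  assumes "Y \<in> borel_measurable M" "integrable M (\<lambda>\<omega>. (Y \<omega>)\<^sup>2)"
  shows "expectation (\<lambda>\<omega>. \<bar>Y \<omega>\<bar>) \<le> sqrt (expectation (\<lambda>\<omega>. (Y \<omega>)\<^sup>2))"
proof -
  have i: "integrable M Y" using square_integrable_imp_integrable[OF assms] .
  have "(expectation (\<lambda>\<omega>. \<bar>Y \<omega>\<bar>))\<^sup>2 \<le> expectation (\<lambda>\<omega>. \<bar>Y \<omega>\<bar>\<^sup>2)"
    by (rule jensens_inequality[where I = UNIV and q = "\<lambda>x. x\<^sup>2"]) (use i assms in \<open>auto intro!: convex_power2\<close>)
  then show ?thesis by (intro real_le_rsqrt) simp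
qed

text \<open>Only a first moment is assumed, as a tail index below 2 excludes a second one.
  Truncation at K splits the error: the truncated average converges in L2 by the decay of
  covariances, and the remainder is small in L1 uniformly in n by stationarity.\<close>

lemma law_of_large_numbers:
  fixes f :: "real \<Rightarrow> real"
  assumes \<alpha>: "alpha \<longlonglongrightarrow> 0" and f [measurable]: "f \<in> borel_measurable borel" and int: "integrable M (\<lambda>\<omega>. f (X 0 \<omega>))" and e: "e > 0"
  shows "(\<lambda>n. prob {\<omega>\<in>space M. \<bar>(\<Sum>t=1..n. f (X (int t) \<omega>)) / real n - expectation (\<lambda>\<omega>. f (X 0 \<omega>))\<bar> \<ge> e}) \<longlonglongrightarrow> 0"
proof -
  define \<mu> where "\<mu> = expectation (\<lambda>\<omega>. f (X 0 \<omega>))"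
  define D where "D n = expectation (\<lambda>\<omega>. \<bar>(\<Sum>t=1..n. f (X (int t) \<omega>)) / real n - \<mu>\<bar>)" for n
  have intt: "integrable M (\<lambda>\<omega>. f (X t \<omega>))" for t using integrable_marginal[OF f, of t] int by simp
  have D0: "D n \<ge> 0" for n unfolding D_def by simp
  have "D \<longlonglongrightarrow> 0"
  proof (rule tendstoI)
    fix r :: real assume r: "r > 0"
    define g where "g K x = max (- K) (min K (f x))" for K x
    have gm [measurable]: "g K \<in> borel_measurable borel" for K unfolding g_def by measurable
    have "(\<lambda>K. expectation (\<lambda>\<omega>. \<bar>f (X 0 \<omega>) - g (real K) (X 0 \<omega>)\<bar>)) \<longlonglongrightarrow> expectation (\<lambda>\<omega>. 0)"
    proof (rule integral_dominated_convergence[where w = "\<lambda>\<omega>. \<bar>f (X 0 \<omega>)\<bar>"])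
      show "AE \<omega> in M. (\<lambda>K. \<bar>f (X 0 \<omega>) - g (real K) (X 0 \<omega>)\<bar>) \<longlonglongrightarrow> 0"
      proof (rule AE_I2, rule tendsto_eventually)
        fix \<omega>
        show "eventually (\<lambda>K. \<bar>f (X 0 \<omega>) - g (real K) (X 0 \<omega>)\<bar> = 0) sequentially"
          using eventually_ge_at_top[of "nat \<lceil>\<bar>f (X 0 \<omega>)\<bar>\<rceil>"]
        proof eventually_elim
          case (elim K)
          then have "\<bar>f (X 0 \<omega>)\<bar> \<le> real K" by linarith
          then show ?case by (auto simp: g_def)
        qed
      qed
      show "AE \<omega> in M. norm \<bar>f (X 0 \<omega>) - g (real K) (X 0 \<omega>)\<bar> \<le> \<bar>f (X 0 \<omega>)\<bar>" for K
        by (rule AE_I2) (auto simp: g_def max_def min_def)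
    qed (use int in simp_all)
    then have "eventually (\<lambda>K. expectation (\<lambda>\<omega>. \<bar>f (X 0 \<omega>) - g (real K) (X 0 \<omega>)\<bar>) < r / 4) sequentially"
      using r by (intro order_tendstoD(2)[of _ "expectation (\<lambda>\<omega>. 0)"]) auto
    then have "eventually (\<lambda>K. expectation (\<lambda>\<omega>. \<bar>f (X 0 \<omega>) - g (real K) (X 0 \<omega>)\<bar>) < r / 4 \<and> K > 0) sequentially"
      using eventually_gt_at_top[of 0] by eventually_elim auto
    then obtain K0 where K0: "expectation (\<lambda>\<omega>. \<bar>f (X 0 \<omega>) - g (real K0) (X 0 \<omega>)\<bar>) < r / 4" "K0 > 0"
      by (auto simp: eventually_sequentially)
    define K where "K = real K0"
    have K: "expectation (\<lambda>\<omega>. \<bar>f (X 0 \<omega>) - g K (X 0 \<omega>)\<bar>) < r / 4" "K > 0" using K0 by (auto simp: K_def)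
    have gb: "\<bar>g K x\<bar> \<le> K" for x using K by (auto simp: g_def max_def min_def)
    have gi: "integrable M (\<lambda>\<omega>. g K (X t \<omega>))" for t
      by (rule integrable_bounded[where B = K]) (use gb in auto)
    define \<mu>' where "\<mu>' = expectation (\<lambda>\<omega>. g K (X 0 \<omega>))"
    \<comment> \<open>The order of choices is K, k, n: the covariance bound K^2 \<open>alpha\<close>
      k is made small for the fixed K, the rest vanishes as n grows. Three errors of at most r / 4
      leave room below r.\<close>
    have "(\<lambda>k. K * K * alpha k) \<longlonglongrightarrow> K * K * 0" by (intro tendsto_intros \<alpha>)
    then have "eventually (\<lambda>k. K * K * alpha k < (r / 4)\<^sup>2 / 2) sequentially"
      using r by (intro order_tendstoD(2)[of _ "K * K * 0"]) auto
    then obtain k where k: "K * K * alpha k < (r / 4)\<^sup>2 / 2" by (auto simp: eventually_sequentially)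
    have "eventually (\<lambda>n. 4 * real k * K\<^sup>2 / real n < (r / 4)\<^sup>2 / 2) sequentially"
      using r by (intro order_tendstoD(2)[OF lim_const_over_n]) auto
    then show "eventually (\<lambda>n. dist (D n) 0 < r) sequentially" using eventually_gt_at_top[of 0]
    proof eventually_elim
      case (elim n)
      let ?Y = "\<lambda>\<omega>. (\<Sum>t=1..n. g K (X (int t) \<omega>)) / real n - \<mu>'"
      have Yb: "\<bar>?Y \<omega>\<bar> \<le> K + \<bar>\<mu>'\<bar>" for \<omega>
      proof -
        have "\<bar>\<Sum>t=1..n. g K (X (int t) \<omega>)\<bar> \<le> (\<Sum>t=1..n. \<bar>g K (X (int t) \<omega>)\<bar>)" by (rule sum_abs)
        also have "\<dots> \<le> real n * K" using sum_bounded_above[of "{1..n}" "\<lambda>t. \<bar>g K (X (int t) \<omega>)\<bar>" K] gb by simp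
        finally have "\<bar>(\<Sum>t=1..n. g K (X (int t) \<omega>)) / real n\<bar> \<le> K" using elim(2) by (simp add: abs_divide field_simps)
        then show ?thesis by linarith
      qed
      have "expectation (\<lambda>\<omega>. (?Y \<omega>)\<^sup>2) \<le> 4 * real k * K\<^sup>2 / real n + K * K * alpha k"
      proof (rule second_moment_average_le)
        show "expectation (\<lambda>\<omega>. g K (X (int i) \<omega>)) = \<mu>'" for i
          unfolding \<mu>'_def by (rule expectation_marginal) simp
        show "\<bar>cov M (\<lambda>\<omega>. g K (X (int i) \<omega>)) (\<lambda>\<omega>. g K (X (int j) \<omega>))\<bar> \<le> K * K * alpha k" if "i + k \<le> j" for i j
          using that K gb by (intro cov_pair_marginal_le) auto
        show "0 \<le> K * K * alpha k" using K alpha_nonneg by simp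
      qed (use gb elim in auto)
      then have "expectation (\<lambda>\<omega>. (?Y \<omega>)\<^sup>2) \<le> (r / 4)\<^sup>2" using elim(1) k by linarith
      then have "sqrt (expectation (\<lambda>\<omega>. (?Y \<omega>)\<^sup>2)) \<le> r / 4" using r by (intro real_le_lsqrt) auto
      moreover have "expectation (\<lambda>\<omega>. \<bar>?Y \<omega>\<bar>) \<le> sqrt (expectation (\<lambda>\<omega>. (?Y \<omega>)\<^sup>2))"
      proof (rule abs_expectation_le_sqrt)
        show "integrable M (\<lambda>\<omega>. (?Y \<omega>)\<^sup>2)"
          by (rule integrable_bounded[where B = "(K + \<bar>\<mu>'\<bar>)\<^sup>2"]) (use Yb in \<open>auto simp: abs_le_square_iff[symmetric] intro: order_trans[OF _ abs_ge_self]\<close>)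
      qed simp
      ultimately have EY: "expectation (\<lambda>\<omega>. \<bar>?Y \<omega>\<bar>) \<le> r / 4" by linarith
      have Ydiff: "integrable M (\<lambda>\<omega>. \<bar>f (X (int t) \<omega>) - g K (X (int t) \<omega>)\<bar>)" for t using gi intt by auto
      have Et: "expectation (\<lambda>\<omega>. \<bar>f (X (int t) \<omega>) - g K (X (int t) \<omega>)\<bar>) = expectation (\<lambda>\<omega>. \<bar>f (X 0 \<omega>) - g K (X 0 \<omega>)\<bar>)" for t
        by (rule expectation_marginal[of "\<lambda>x. \<bar>f x - g K x\<bar>"]) simp
      have "D n \<le> expectation (\<lambda>\<omega>. \<bar>?Y \<omega>\<bar> + ((\<Sum>t=1..n. \<bar>f (X (int t) \<omega>) - g K (X (int t) \<omega>)\<bar>) / real n + \<bar>\<mu>' - \<mu>\<bar>))"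
        unfolding D_def
      proof (rule integral_mono)
        fix \<omega>
        have "(\<Sum>t=1..n. f (X (int t) \<omega>)) / real n - \<mu> = ?Y \<omega> + ((\<Sum>t=1..n. f (X (int t) \<omega>) - g K (X (int t) \<omega>)) / real n + (\<mu>' - \<mu>))"
          by (simp add: sum_subtractf diff_divide_distrib)
        moreover have "\<bar>(\<Sum>t=1..n. f (X (int t) \<omega>) - g K (X (int t) \<omega>)) / real n\<bar> \<le> (\<Sum>t=1..n. \<bar>f (X (int t) \<omega>) - g K (X (int t) \<omega>)\<bar>) / real n"
          by (auto simp: abs_divide intro!: divide_right_mono)
        ultimately show "\<bar>(\<Sum>t=1..n. f (X (int t) \<omega>)) / real n - \<mu>\<bar> \<le> \<bar>?Y \<omega>\<bar> + ((\<Sum>t=1..n. \<bar>f (X (int t) \<omega>) - g K (X (int t) \<omega>)\<bar>) / real n + \<bar>\<mu>' - \<mu>\<bar>)"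
          by linarith
      qed (use gi intt Ydiff in auto)
      also have "\<dots> = expectation (\<lambda>\<omega>. \<bar>?Y \<omega>\<bar>) + ((\<Sum>t=1..n. expectation (\<lambda>\<omega>. \<bar>f (X (int t) \<omega>) - g K (X (int t) \<omega>)\<bar>)) / real n + \<bar>\<mu>' - \<mu>\<bar>)"
        using gi Ydiff by (simp add: prob_space)
      also have "(\<Sum>t=1..n. expectation (\<lambda>\<omega>. \<bar>f (X (int t) \<omega>) - g K (X (int t) \<omega>)\<bar>)) / real n = expectation (\<lambda>\<omega>. \<bar>f (X 0 \<omega>) - g K (X 0 \<omega>)\<bar>)"
        unfolding Et using elim(2) by simp
      also have "\<bar>\<mu>' - \<mu>\<bar> \<le> expectation (\<lambda>\<omega>. \<bar>f (X 0 \<omega>) - g K (X 0 \<omega>)\<bar>)"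
      proof -
        have "\<mu>' - \<mu> = expectation (\<lambda>\<omega>. g K (X 0 \<omega>) - f (X 0 \<omega>))" unfolding \<mu>'_def \<mu>_def using gi[of 0] int by simp
        then have "\<bar>\<mu>' - \<mu>\<bar> \<le> expectation (\<lambda>\<omega>. \<bar>g K (X 0 \<omega>) - f (X 0 \<omega>)\<bar>)" by simp
        then show ?thesis by (simp add: abs_minus_commute)
      qed
      finally have "D n < r" using EY K(1) r by simp
      then show ?case using D0[of n] by (simp add: dist_real_def)
    qed
  qed
  then have "(\<lambda>n. D n / e) \<longlonglongrightarrow> 0 / e" by (intro tendsto_intros) (use e in auto)
  then have lim: "(\<lambda>n. D n / e) \<longlonglongrightarrow> 0" by simp
  show ?thesis unfolding \<mu>_def[symmetric]
  proof (rule tendsto_sandwich[OF _ _ tendsto_const lim]; intro always_eventually allI)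
    fix n
    show "prob {\<omega>\<in>space M. \<bar>(\<Sum>t=1..n. f (X (int t) \<omega>)) / real n - \<mu>\<bar> \<ge> e} \<le> D n / e"
      unfolding D_def using intt e by (intro integral_Markov_inequality_measure[where A = "{}"]) auto
  qed simp
qed

end

section \<open>Heavy tails\<close>

lemma of_bool_Ball_eq_prod:
  "finite A \<Longrightarrow> (of_bool (\<forall>t\<in>A. P t) :: real) = (\<Prod>t\<in>A. of_bool (P t))"
  by (induction A rule: finite_induct) auto

lemma cylinder_all_le:
  assumes "finite A" shows "cylinder A (\<lambda>x. of_bool (\<forall>t\<in>A. \<bar>x t\<bar> \<le> c))"
proof -
  have "(\<lambda>x. \<Prod>t\<in>A. of_bool (\<bar>x t\<bar> \<le> c) :: real) \<in> borel_measurable (PiM A (\<lambda>_. borel))"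
    by (intro borel_measurable_prod measurable_compose[OF measurable_component_singleton, where g = "\<lambda>y. of_bool (\<bar>y\<bar> \<le> c)"]) auto
  then show ?thesis unfolding cylinder_def by (simp add: of_bool_Ball_eq_prod[OF assms])
qed

text \<open>The floor and the subtraction of a fixed gap k, truncated at 0 or not, change the length
  by at most k + 1.\<close>

lemma tendsto_floor_scaled:
  assumes "\<rho> \<ge> 0"
  shows "(\<lambda>n. real (nat \<lfloor>\<rho> * real n\<rfloor> - k) / real n) \<longlonglongrightarrow> \<rho>"
proof (rule LIM_zero_cancel, rule tendsto_rabs_zero_cancel)
  have lim: "(\<lambda>n. (real k + 1) / real n) \<longlonglongrightarrow> 0" by (rule lim_const_over_n)
  show "(\<lambda>n. \<bar>real (nat \<lfloor>\<rho> * real n\<rfloor> - k) / real n - \<rho>\<bar>) \<longlonglongrightarrow> 0"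
  proof (rule tendsto_sandwich[OF _ _ tendsto_const lim])
    show "eventually (\<lambda>n. \<bar>real (nat \<lfloor>\<rho> * real n\<rfloor> - k) / real n - \<rho>\<bar> \<le> (real k + 1) / real n) sequentially"
      using eventually_gt_at_top[of 0]
    proof eventually_elim
      case (elim n)
      have fl: "real (nat \<lfloor>\<rho> * real n\<rfloor>) = of_int \<lfloor>\<rho> * real n\<rfloor>" using assms by simp
      have 1: "real (nat \<lfloor>\<rho> * real n\<rfloor>) \<le> \<rho> * real n" "\<rho> * real n < real (nat \<lfloor>\<rho> * real n\<rfloor>) + 1"
        unfolding fl by linarith+
      have 2: "real (nat \<lfloor>\<rho> * real n\<rfloor> - k) \<le> real (nat \<lfloor>\<rho> * real n\<rfloor>)"
        "real (nat \<lfloor>\<rho> * real n\<rfloor>) - real k \<le> real (nat \<lfloor>\<rho> * real n\<rfloor> - k)" by linarith+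
      have "\<bar>real (nat \<lfloor>\<rho> * real n\<rfloor> - k) - \<rho> * real n\<bar> \<le> real k + 1"
        using 1 2 by linarith
      moreover have "real (nat \<lfloor>\<rho> * real n\<rfloor> - k) / real n - \<rho> = (real (nat \<lfloor>\<rho> * real n\<rfloor> - k) - \<rho> * real n) / real n"
        using elim by (simp add: field_simps)
      ultimately show ?case using elim by (simp add: abs_divide divide_right_mono)
    qed
  qed auto
qed

section \<open>Exceedances and maxima of mixing sequences\<close>

context stationary_process
begin

definition tail :: "real \<Rightarrow> real" where "tail x = prob {\<omega>\<in>space M. \<bar>X 0 \<omega>\<bar> > x}"

definition max_le_prob :: "nat \<Rightarrow> real \<Rightarrow> real" where
  "max_le_prob n c = prob {\<omega>\<in>space M. \<forall>t\<in>{1..int n}. \<bar>X t \<omega>\<bar> \<le> c}"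

lemma tail_antimono: "x \<le> y \<Longrightarrow> tail y \<le> tail x"
  unfolding tail_def by (intro finite_measure_mono) auto

lemma tail_nonneg: "0 \<le> tail x" by (simp add: tail_def)

lemma tail_marginal: "prob {\<omega>\<in>space M. \<bar>X t \<omega>\<bar> > x} = tail x"
  using prob_shift[of "{0}" "\<lambda>z. \<bar>z 0\<bar> > x" t] cylinder_component[of 0 "{0}" "\<lambda>z. of_bool (\<bar>z\<bar> > x)"]
  by (simp add: tail_def)

lemma max_le_prob_mono: "c \<le> d \<Longrightarrow> max_le_prob n c \<le> max_le_prob n d"
  unfolding max_le_prob_def by (intro finite_measure_mono) (auto intro: order_trans)

text \<open>J windows of length m, each followed by a gap of length k, fit into n. Restricting the
  maximum to the windows only increases the probability, and every further window costs one mixing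
  error.\<close>

lemma max_le_prob_block:
  assumes "J * (m + k) \<le> n"
  shows "max_le_prob n c \<le> max_le_prob m c ^ J + real J * alpha k"
proof -
  define B where "B j = {int (j * (m + k)) + 1..int (j * (m + k)) + int m}" for j
  define A where "A J = (\<Union>j<J. B j)" for J
  have finA: "finite (A J)" for J by (auto simp: A_def B_def)
  \<comment> \<open>The union stops k before J (m + k), so the gap after its last window is still
    free: this is the separation used in the induction.\<close>
  have Asub: "A J \<subseteq> {1..int (J * (m + k)) - int k}" for J
  proof
    fix t assume "t \<in> A J"
    then obtain j where j: "j < J" "t \<in> B j" by (auto simp: A_def)
    have "(j + 1) * (m + k) \<le> J * (m + k)" using j(1) by (intro mult_right_mono) auto
    then have "j * (m + k) + (m + k) \<le> J * (m + k)" by simp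
    then have "int (j * (m + k)) + int (m + k) \<le> int (J * (m + k))" by linarith
    then show "t \<in> {1..int (J * (m + k)) - int k}" using j(2) of_nat_0_le_iff[of "j * (m + k)", where 'a = int]
      unfolding B_def atLeastAtMost_iff by linarith
  qed
  have pB: "prob {\<omega>\<in>space M. \<forall>t\<in>B j. \<bar>X t \<omega>\<bar> \<le> c} = max_le_prob m c" for j
  proof -
    have "(\<forall>t\<in>B j. \<bar>X t \<omega>\<bar> \<le> c) \<longleftrightarrow> (\<forall>t\<in>{1..int m}. \<bar>X (t + int (j * (m + k))) \<omega>\<bar> \<le> c)" for \<omega>
    proof -
      have "B j = (\<lambda>t. t + int (j * (m + k))) ` {1..int m}" by (simp add: B_def add.commute)
      then show ?thesis by (simp only:) blast
    qed
    then show ?thesis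
      using prob_shift[OF _ cylinder_all_le[of "{1..int m}" c], where h = "int (j * (m + k))"] by (simp add: max_le_prob_def)
  qed
  have p01: "0 \<le> max_le_prob m c" "max_le_prob m c \<le> 1" by (auto simp: max_le_prob_def)
  have main: "prob {\<omega>\<in>space M. \<forall>t\<in>A J. \<bar>X t \<omega>\<bar> \<le> c} \<le> max_le_prob m c ^ J + real J * alpha k" for J
  proof (induction J)
    case 0
    then show ?case by simp
  next
    case (Suc J)
    have A: "A J \<subseteq> {..int (J * (m + k)) - int k}" using Asub[of J] by auto
    have B: "B J \<subseteq> {int (J * (m + k)) - int k + int k..}" by (auto simp: B_def)
    have finB: "finite (B J)" by (simp add: B_def)
    note mix = prob_mixing[OF finA finB A B cylinder_all_le[OF finA, of J c] cylinder_all_le[OF finB, of c], THEN abs_le_D1]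
    have eq: "{\<omega>\<in>space M. \<forall>t\<in>A (Suc J). \<bar>X t \<omega>\<bar> \<le> c} = {\<omega>\<in>space M. (\<forall>t\<in>A J. \<bar>X t \<omega>\<bar> \<le> c) \<and> (\<forall>t\<in>B J. \<bar>X t \<omega>\<bar> \<le> c)}"
      by (auto simp: A_def less_Suc_eq)
    have "prob {\<omega>\<in>space M. \<forall>t\<in>A (Suc J). \<bar>X t \<omega>\<bar> \<le> c} \<le> prob {\<omega>\<in>space M. \<forall>t\<in>A J. \<bar>X t \<omega>\<bar> \<le> c} * max_le_prob m c + alpha k"
      using mix unfolding eq pB by linarith
    also have "\<dots> \<le> (max_le_prob m c ^ J + real J * alpha k) * max_le_prob m c + alpha k"
      using Suc p01 by (intro add_right_mono mult_right_mono) auto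
    also have "\<dots> \<le> max_le_prob m c ^ Suc J + real (Suc J) * alpha k"
      using mult_left_le[OF p01(2), of "real J * alpha k"] alpha_nonneg[of k] by (simp add: algebra_simps)
    finally show ?case .
  qed
  have "int (J * (m + k)) \<le> int n" using assms by (simp only: of_nat_le_iff)
  then have "A J \<subseteq> {1..int n}" using Asub[of J] by force
  then have "max_le_prob n c \<le> prob {\<omega>\<in>space M. \<forall>t\<in>A J. \<bar>X t \<omega>\<bar> \<le> c}" unfolding max_le_prob_def
    using finA by (intro finite_measure_mono) (auto intro!: sets.sets_Collect_finite_All)
  then show ?thesis using main[of J] by linarith
qed

lemma joint_exceedance_shift:
  "prob {\<omega>\<in>space M. \<bar>X (s + d) \<omega>\<bar> > c \<and> \<bar>X s \<omega>\<bar> > c} = prob {\<omega>\<in>space M. \<bar>X d \<omega>\<bar> > c \<and> \<bar>X 0 \<omega>\<bar> > c}"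
proof -
  have "cylinder {0, d} (\<lambda>x. of_bool (\<bar>x d\<bar> > c) * of_bool (\<bar>x 0\<bar> > c))"
    by (intro cylinder_mult cylinder_component[where f = "\<lambda>y. of_bool (\<bar>y\<bar> > c)"]) auto
  then have "cylinder {0, d} (\<lambda>x. of_bool (\<bar>x d\<bar> > c \<and> \<bar>x 0\<bar> > c))" by (simp add: of_bool_conj)
  from prob_shift[OF _ this, of s] show ?thesis by (simp add: add.commute)
qed

text \<open>Bonferroni on the sparse grid of multiples of k0, so that only lags of at least k0 occur.\<close>
lemma exceedance_prob_ge:
  assumes "k0 > 0" "k0 * w \<le> r"
  shows "prob {\<omega>\<in>space M. \<exists>j\<in>{1..w}. \<bar>X (int (k0 * j)) \<omega>\<bar> > c} \<ge>
     real w * (tail c - (\<Sum>t\<in>{k0..r}. prob {\<omega>\<in>space M. \<bar>X (int t) \<omega>\<bar> > c \<and> \<bar>X 0 \<omega>\<bar> > c}))"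
  using assms(2)
proof (induction w)
  case 0
  then show ?case by simp
next
  case (Suc w)
  let ?D = "\<Sum>t\<in>{k0..r}. prob {\<omega>\<in>space M. \<bar>X (int t) \<omega>\<bar> > c \<and> \<bar>X 0 \<omega>\<bar> > c}"
  let ?A = "\<lambda>j. {\<omega>\<in>space M. \<bar>X (int (k0 * j)) \<omega>\<bar> > c}"
  let ?B = "{\<omega>\<in>space M. \<exists>j\<in>{1..w}. \<bar>X (int (k0 * j)) \<omega>\<bar> > c}"
  have Bm: "?B \<in> sets M" by measurable
  have Am: "?A j \<in> sets M" for j by measurable
  have "prob (?B \<inter> ?A (Suc w)) \<le> prob (\<Union>j\<in>{1..w}. ?A j \<inter> ?A (Suc w))"
    by (rule finite_measure_mono) (use Am in auto)
  also have "\<dots> \<le> (\<Sum>j\<in>{1..w}. prob (?A j \<inter> ?A (Suc w)))"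
    by (rule finite_measure_subadditive_finite) (use Am in auto)
  also have "\<dots> = (\<Sum>j\<in>{1..w}. prob {\<omega>\<in>space M. \<bar>X (int (k0 * (Suc w - j))) \<omega>\<bar> > c \<and> \<bar>X 0 \<omega>\<bar> > c})"
  proof (rule sum.cong[OF refl])
    fix j assume j: "j \<in> {1..w}"
    have "int (k0 * Suc w) = int (k0 * j) + int (k0 * (Suc w - j))"
    proof -
      have "k0 * Suc w = k0 * j + k0 * (Suc w - j)" using j by (simp flip: distrib_left)
      then show ?thesis by (simp only: of_nat_add)
    qed
    then have "?A j \<inter> ?A (Suc w) = {\<omega>\<in>space M. \<bar>X (int (k0 * j) + int (k0 * (Suc w - j))) \<omega>\<bar> > c \<and> \<bar>X (int (k0 * j)) \<omega>\<bar> > c}" by auto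
    then show "prob (?A j \<inter> ?A (Suc w)) = prob {\<omega>\<in>space M. \<bar>X (int (k0 * (Suc w - j))) \<omega>\<bar> > c \<and> \<bar>X 0 \<omega>\<bar> > c}"
      by (simp only: joint_exceedance_shift)
  qed
  also have "\<dots> = (\<Sum>t\<in>(\<lambda>j. k0 * (Suc w - j)) ` {1..w}. prob {\<omega>\<in>space M. \<bar>X (int t) \<omega>\<bar> > c \<and> \<bar>X 0 \<omega>\<bar> > c})"
    using assms(1) by (subst sum.reindex) (auto simp: inj_on_def)
  also have "\<dots> \<le> ?D"
  proof (rule sum_mono2)
    show "(\<lambda>j. k0 * (Suc w - j)) ` {1..w} \<subseteq> {k0..r}"
    proof (rule image_subsetI)
      fix j assume j: "j \<in> {1..w}"
      have "k0 * 1 \<le> k0 * (Suc w - j)" using j by (intro mult_left_mono) auto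
      moreover have "k0 * (Suc w - j) \<le> k0 * Suc w" by (intro mult_left_mono) auto
      ultimately show "k0 * (Suc w - j) \<in> {k0..r}" using Suc.prems by auto
    qed
  qed auto
  finally have inter: "prob (?B \<inter> ?A (Suc w)) \<le> ?D" .
  have "{\<omega>\<in>space M. \<exists>j\<in>{1..Suc w}. \<bar>X (int (k0 * j)) \<omega>\<bar> > c} = ?B \<union> ?A (Suc w)"
  proof -
    have "{1..Suc w} = insert (Suc w) {1..w}" by auto
    then show ?thesis by (simp only:) blast
  qed
  then have "prob {\<omega>\<in>space M. \<exists>j\<in>{1..Suc w}. \<bar>X (int (k0 * j)) \<omega>\<bar> > c} = prob ?B + prob (?A (Suc w)) - prob (?B \<inter> ?A (Suc w))"
    using measure_Un3[OF fmeasurableI fmeasurableI, of ?B M "?A (Suc w)"] Bm Am by (simp add: emeasure_eq_measure less_top)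
  moreover have "prob (?A (Suc w)) = tail c" by (rule tail_marginal)
  moreover have "k0 * w \<le> r" using Suc.prems by simp
  ultimately show ?case using Suc.IH inter by (simp add: algebra_simps)
qed

text \<open>On the joint exceedance both factors equal 1. This is how the anti-clustering condition,
  stated with truncated moments, controls pairs of exceedances.\<close>

lemma joint_exceedance_le:
  assumes "c > 0"
  shows "prob {\<omega>\<in>space M. \<bar>X t \<omega>\<bar> > c \<and> \<bar>X 0 \<omega>\<bar> > c} \<le> (\<integral>\<omega>. min (\<bar>X t \<omega>\<bar> / c) 1 * min (\<bar>X 0 \<omega>\<bar> / c) 1 \<partial>M)"
proof -
  have "prob {\<omega>\<in>space M. \<bar>X t \<omega>\<bar> > c \<and> \<bar>X 0 \<omega>\<bar> > c} = expectation (\<lambda>\<omega>. of_bool (\<bar>X t \<omega>\<bar> > c \<and> \<bar>X 0 \<omega>\<bar> > c))"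
    by (rule expectation_of_bool[symmetric])
  also have "\<dots> \<le> expectation (\<lambda>\<omega>. min (\<bar>X t \<omega>\<bar> / c) 1 * min (\<bar>X 0 \<omega>\<bar> / c) 1)"
  proof (rule integral_mono)
    show "integrable M (\<lambda>\<omega>. of_bool (\<bar>X t \<omega>\<bar> > c \<and> \<bar>X 0 \<omega>\<bar> > c) :: real)"
      by (rule integrable_bounded[where B = 1]) auto
    show "integrable M (\<lambda>\<omega>. min (\<bar>X t \<omega>\<bar> / c) 1 * min (\<bar>X 0 \<omega>\<bar> / c) 1)"
      by (rule integrable_bounded[where B = 1]) (use assms in \<open>auto simp: abs_mult intro!: mult_le_one\<close>)
    show "of_bool (\<bar>X t \<omega>\<bar> > c \<and> \<bar>X 0 \<omega>\<bar> > c) \<le> min (\<bar>X t \<omega>\<bar> / c) 1 * min (\<bar>X 0 \<omega>\<bar> / c) 1" for \<omega>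
      using assms by (auto simp: min_def field_simps)
  qed
  finally show ?thesis .
qed

end

section \<open>Regularly varying tails and norming constants\<close>

locale heavy_tailed_process = stationary_process +
  fixes \<kappa> :: real and a :: "nat \<Rightarrow> real"
  assumes kappa: "1 < \<kappa>" "\<kappa> < 2"
    and regvar: "regvar_var M (X 0) \<kappa>"
    and norm: "norm_seq M X a"
    and acmx: "assm_ACMX M X a"
begin

lemma a_at_top: "filterlim a at_top sequentially" using norm by (simp add: norm_seq_def)

lemma a_pos: "eventually (\<lambda>n. a n > 0) sequentially"
  using a_at_top by (auto simp: filterlim_at_top_dense)

lemma n_tail_a: "(\<lambda>n. real n * tail (a n)) \<longlonglongrightarrow> 1" using norm by (simp add: norm_seq_def tail_def)

text \<open>The one-sided limits add up to 1 because the weights do; x > 0 makes the one-sided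
  events disjoint.\<close>

lemma tail_asymp:
  obtains L where "slowly_varying L" "((\<lambda>x. tail x / (L x * x powr - \<kappa>)) \<longlongrightarrow> 1) at_top"
proof -
  obtain L pp pm where L: "slowly_varying L" "pp + pm = 1"
     "((\<lambda>x. measure M {\<omega>\<in>space M. X 0 \<omega> > x} / (L x * x powr (- \<kappa>))) \<longlongrightarrow> pp) at_top"
     "((\<lambda>x. measure M {\<omega>\<in>space M. X 0 \<omega> < - x} / (L x * x powr (- \<kappa>))) \<longlongrightarrow> pm) at_top"
    using regvar by (auto simp: regvar_var_def)
  have "((\<lambda>x. measure M {\<omega>\<in>space M. X 0 \<omega> > x} / (L x * x powr (- \<kappa>)) + measure M {\<omega>\<in>space M. X 0 \<omega> < - x} / (L x * x powr (- \<kappa>))) \<longlongrightarrow> 1) at_top"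
    using tendsto_add[OF L(3,4)] L(2) by simp
  moreover have "eventually (\<lambda>x. measure M {\<omega>\<in>space M. X 0 \<omega> > x} / (L x * x powr (- \<kappa>)) + measure M {\<omega>\<in>space M. X 0 \<omega> < - x} / (L x * x powr (- \<kappa>)) = tail x / (L x * x powr - \<kappa>)) at_top"
    using eventually_gt_at_top[of 0]
  proof eventually_elim
    case (elim x)
    have "{\<omega>\<in>space M. \<bar>X 0 \<omega>\<bar> > x} = {\<omega>\<in>space M. X 0 \<omega> > x} \<union> {\<omega>\<in>space M. X 0 \<omega> < - x}" by auto
    moreover have "{\<omega>\<in>space M. X 0 \<omega> > x} \<inter> {\<omega>\<in>space M. X 0 \<omega> < - x} = {}" using elim by auto
    ultimately have "tail x = measure M {\<omega>\<in>space M. X 0 \<omega> > x} + measure M {\<omega>\<in>space M. X 0 \<omega> < - x}"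
      unfolding tail_def by (simp add: finite_measure_Union)
    then show ?case by (simp add: add_divide_distrib)
  qed
  ultimately have "((\<lambda>x. tail x / (L x * x powr - \<kappa>)) \<longlongrightarrow> 1) at_top"
    by (rule Lim_transform_eventually)
  then show ?thesis using L(1) that by blast
qed

text \<open>A tail that vanishes somewhere vanishes from there on, and then the quotient with the
  regularly varying function could not tend to 1.\<close>

lemma tail_pos: "0 < tail x"
proof -
  obtain L where L: "((\<lambda>x. tail x / (L x * x powr - \<kappa>)) \<longlongrightarrow> 1) at_top" using tail_asymp by blast
  have "eventually (\<lambda>y. tail y / (L y * y powr - \<kappa>) > 0 \<and> y \<ge> x) at_top"
    using order_tendstoD(1)[OF L, of 0] eventually_ge_at_top[of x] by (simp add: eventually_conj_iff)
  then obtain y where y: "tail y / (L y * y powr - \<kappa>) > 0" "y \<ge> x" using eventually_happens by force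
  have "tail y \<noteq> 0" using y(1) by auto
  then show ?thesis using tail_nonneg[of y] tail_antimono[OF y(2)] by simp
qed

lemma tail_scale:
  assumes c: "c > 0" shows "((\<lambda>x. tail (c * x) / tail x) \<longlongrightarrow> c powr - \<kappa>) at_top"
proof -
  obtain L where L: "slowly_varying L" "((\<lambda>x. tail x / (L x * x powr - \<kappa>)) \<longlongrightarrow> 1) at_top" using tail_asymp by blast
  let ?R = "\<lambda>x. tail x / (L x * x powr - \<kappa>)"
  have cx: "filterlim (\<lambda>x. c * x) at_top at_top"
    using c by (intro filterlim_tendsto_pos_mult_at_top[OF tendsto_const] filterlim_ident) 
  have "((\<lambda>x. ?R (c * x) * (L (c * x) / L x) * c powr - \<kappa> / ?R x) \<longlongrightarrow> 1 * 1 * c powr - \<kappa> / 1) at_top"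
    using L(1) c by (intro tendsto_intros filterlim_compose[OF L(2) cx] L(2)) (auto simp: slowly_varying_def)
  moreover have "eventually (\<lambda>x. ?R (c * x) * (L (c * x) / L x) * c powr - \<kappa> / ?R x = tail (c * x) / tail x) at_top"
    using eventually_gt_at_top[of 0]
  proof eventually_elim
    case (elim x)
    have "L x > 0" "L (c * x) > 0" using elim c L(1) by (auto simp: slowly_varying_def)
    then show ?case using elim c tail_pos[of x] by (simp add: powr_mult field_simps)
  qed
  ultimately have "((\<lambda>x. tail (c * x) / tail x) \<longlongrightarrow> 1 * 1 * c powr - \<kappa> / 1) at_top"
    by (rule Lim_transform_eventually)
  then show ?thesis by simp
qed

lemma n_tail_scaled_a:
  assumes c: "c > 0" shows "(\<lambda>n. real n * tail (c * a n)) \<longlonglongrightarrow> c powr - \<kappa>"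
proof -
  have "(\<lambda>n. (real n * tail (a n)) * (tail (c * a n) / tail (a n))) \<longlonglongrightarrow> 1 * c powr - \<kappa>"
    by (intro tendsto_mult n_tail_a filterlim_compose[OF tail_scale[OF c] a_at_top])
  then show ?thesis using tail_pos by (simp add: less_imp_neq[THEN not_sym])
qed

text \<open>The sequence a is determined only through n \<open>tail\<close> (a n) -> 1, so neither
  its monotonicity nor an inverse of the tail is at hand. Instead the limits 1 of m
  \<open>tail\<close> (a m) and \<rho> c^(-\<kappa>) of m \<open>tail\<close> (c a n) are compared.
  The second exceeds 1 exactly for c < \<rho>^(1/\<kappa>), and the monotone tail converts this into
  a comparison of a m with c a n.\<close>

lemma a_ratio:
  assumes m: "filterlim m at_top sequentially" and \<rho>: "(\<lambda>n. real (m n) / real n) \<longlonglongrightarrow> \<rho>" "\<rho> > 0"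
  shows "(\<lambda>n. a (m n) / a n) \<longlonglongrightarrow> \<rho> powr (1 / \<kappa>)"
proof (rule order_tendstoI)
  have mt: "(\<lambda>n. real (m n) * tail (a (m n))) \<longlonglongrightarrow> 1" by (rule filterlim_compose[OF n_tail_a m])
  have mc: "(\<lambda>n. real (m n) * tail (c * a n)) \<longlonglongrightarrow> \<rho> * c powr - \<kappa>" if c: "c > 0" for c
  proof -
    have "(\<lambda>n. (real (m n) / real n) * (real n * tail (c * a n))) \<longlonglongrightarrow> \<rho> * c powr - \<kappa>"
      by (intro tendsto_mult \<rho>(1) n_tail_scaled_a[OF c])
    moreover have "eventually (\<lambda>n. (real (m n) / real n) * (real n * tail (c * a n)) = real (m n) * tail (c * a n)) sequentially"
      using eventually_gt_at_top[of 0] by eventually_elim simp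
    ultimately show ?thesis by (rule Lim_transform_eventually)
  qed
  have pw: "c powr - \<kappa> * c powr \<kappa> = 1" if "c > 0" for c
    using that by (simp flip: powr_add)
  have l: "(\<rho> powr (1 / \<kappa>)) powr \<kappa> = \<rho>" using \<rho> kappa by (simp add: powr_powr)
  show "eventually (\<lambda>n. c < a (m n) / a n) sequentially" if "c < \<rho> powr (1 / \<kappa>)" for c
  proof -
    \<comment> \<open>The given c may be negative; raising it to a positive value still below the
      limit makes its powers usable.\<close>
    define d where "d = max c (\<rho> powr (1 / \<kappa>) / 2)"
    have d: "d > 0" "d < \<rho> powr (1 / \<kappa>)" "c \<le> d" using that \<rho> by (auto simp: d_def less_max_iff_disj)
    have "d powr \<kappa> < (\<rho> powr (1 / \<kappa>)) powr \<kappa>" using d kappa by (intro powr_less_mono2) auto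
    then have dl: "d powr \<kappa> < \<rho>" using l by simp
    have "1 = d powr - \<kappa> * d powr \<kappa>" using pw d by simp
    also have "\<dots> < d powr - \<kappa> * \<rho>" using dl d by (intro mult_strict_left_mono) auto
    finally have gt: "1 < \<rho> * d powr - \<kappa>" by (simp add: mult.commute)
    then obtain z where z: "1 < z" "z < \<rho> * d powr - \<kappa>" using dense by blast
    show ?thesis using order_tendstoD(2)[OF mt z(1)] order_tendstoD(1)[OF mc[OF d(1)] z(2)] a_pos
    proof eventually_elim
      case (elim n)
      have "real (m n) * tail (a (m n)) < real (m n) * tail (d * a n)" using elim by linarith
      then have "tail (a (m n)) < tail (d * a n)" by (simp add: mult_less_cancel_left)
      then have "d * a n < a (m n)" using tail_antimono[of "a (m n)" "d * a n"] by force
      then have "d < a (m n) / a n" using elim(3) by (simp add: field_simps)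
      then show ?case using d by simp
    qed
  qed
  show "eventually (\<lambda>n. a (m n) / a n < c) sequentially" if "\<rho> powr (1 / \<kappa>) < c" for c
  proof -
    have d: "c > 0" using that \<rho> by (smt (verit) powr_gt_zero)
    have "(\<rho> powr (1 / \<kappa>)) powr \<kappa> < c powr \<kappa>" using that \<rho> kappa by (intro powr_less_mono2) auto
    then have dl: "\<rho> < c powr \<kappa>" using l by simp
    have "c powr - \<kappa> * \<rho> < c powr - \<kappa> * c powr \<kappa>" using dl d by (intro mult_strict_left_mono) auto
    also have "\<dots> = 1" using pw d by simp
    finally have gt: "\<rho> * c powr - \<kappa> < 1" by (simp add: mult.commute)
    then obtain z where z: "\<rho> * c powr - \<kappa> < z" "z < 1" using dense by blast
    show ?thesis using order_tendstoD(1)[OF mt z(2)] order_tendstoD(2)[OF mc[OF d(1)] z(1)] a_pos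
    proof eventually_elim
      case (elim n)
      have "real (m n) * tail (c * a n) < real (m n) * tail (a (m n))" using elim by linarith
      then have "tail (c * a n) < tail (a (m n))" by (simp add: mult_less_cancel_left)
      then have "a (m n) < c * a n" using tail_antimono[of "c * a n" "a (m n)"] by force
      then show ?case using elim(3) by (simp add: field_simps)
    qed
  qed
qed

text \<open>Since n / r n is eventually at least 1, \<open>alpha\<close> is small along l n;
  monotonicity in the gap extends this to the whole sequence.\<close>

lemma alpha_tendsto_0: "alpha \<longlonglongrightarrow> 0"
proof -
  obtain r l :: "nat \<Rightarrow> nat" where r: "(\<lambda>n. real (r n) / real n) \<longlonglongrightarrow> 0"
    and l: "(\<lambda>n. real n / real (r n) * alpha (l n)) \<longlonglongrightarrow> 0" and rr: "filterlim r at_top sequentially"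
    using acmx by (auto simp: assm_ACMX_def)
  show ?thesis
  proof (rule tendstoI)
    fix e :: real assume e: "e > 0"
    have "eventually (\<lambda>n. real n / real (r n) * alpha (l n) < e) sequentially"
      using l e by (intro order_tendstoD) auto
    moreover have "eventually (\<lambda>n. real (r n) / real n < 1) sequentially" using r by (intro order_tendstoD) auto
    moreover have "eventually (\<lambda>n. 1 \<le> r n) sequentially" using rr by (simp add: filterlim_at_top)
    ultimately have "eventually (\<lambda>n. alpha (l n) < e) sequentially" using eventually_gt_at_top[of 0]
    proof eventually_elim
      case (elim n)
      have "1 \<le> real n / real (r n)" using elim by (simp add: field_simps)
      then have "1 * alpha (l n) \<le> real n / real (r n) * alpha (l n)" using alpha_nonneg by (intro mult_right_mono) auto
      then show ?case using elim by linarith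
    qed
    then obtain n where n: "alpha (l n) < e" by (auto simp: eventually_sequentially)
    show "eventually (\<lambda>k. dist (alpha k) 0 < e) sequentially" using eventually_ge_at_top[of "l n"]
    proof eventually_elim
      case (elim k)
      then show ?case using alpha_antimono[OF elim] n alpha_nonneg[of k] by (simp add: dist_real_def)
    qed
  qed
qed

end

context heavy_tailed_process
begin

text \<open>Bonferroni bounds the exceedance probability of one block of length r from below, and about n / r
  blocks, separated by gaps of length l, are nearly independent.\<close>
lemma max_le_prob_bounded_away:
  obtains q where "0 \<le> q" "q < 1" "eventually (\<lambda>n. max_le_prob n (a n) \<le> q) sequentially"
proof -
  obtain r l :: "nat \<Rightarrow> nat" where r: "filterlim r at_top sequentially" "(\<lambda>n. real (r n) / real n) \<longlonglongrightarrow> 0"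
    and ac: "(\<lambda>k. limsup (\<lambda>n. ereal (real n * (\<Sum>t\<in>{k..r n}.
          \<integral>\<omega>. min (\<bar>X (int t) \<omega>\<bar> / a n) 1 * min (\<bar>X 0 \<omega>\<bar> / a n) 1 \<partial>M)))) \<longlonglongrightarrow> 0"
    and l: "(\<lambda>n. real (l n) / real (r n)) \<longlonglongrightarrow> 0" "(\<lambda>n. real n / real (r n) * alpha (l n)) \<longlonglongrightarrow> 0"
    using acmx by (auto simp: assm_ACMX_def)
  have "eventually (\<lambda>k. limsup (\<lambda>n. ereal (real n * (\<Sum>t\<in>{k..r n}.
          \<integral>\<omega>. min (\<bar>X (int t) \<omega>\<bar> / a n) 1 * min (\<bar>X 0 \<omega>\<bar> / a n) 1 \<partial>M))) < ereal (1/4) \<and> k > 0) sequentially"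
    using order_tendstoD(2)[OF ac, of "ereal (1/4)"] eventually_gt_at_top[of 0] by (simp add: eventually_conj_iff)
  then obtain k0 where k0: "limsup (\<lambda>n. ereal (real n * (\<Sum>t\<in>{k0..r n}.
          \<integral>\<omega>. min (\<bar>X (int t) \<omega>\<bar> / a n) 1 * min (\<bar>X 0 \<omega>\<bar> / a n) 1 \<partial>M))) < ereal (1/4)" "k0 > 0"
    using eventually_happens by force
  have D: "eventually (\<lambda>n. real n * (\<Sum>t\<in>{k0..r n}.
          \<integral>\<omega>. min (\<bar>X (int t) \<omega>\<bar> / a n) 1 * min (\<bar>X 0 \<omega>\<bar> / a n) 1 \<partial>M) < 1/4) sequentially"
    using Limsup_lessD[OF k0(1)] by (rule eventually_mono) (simp only: less_ereal.simps)
  \<comment> \<open>At least n / (4 r) blocks, each with exceedance probability at least r / (4 k0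
    n), give the exponent 1 / (16 k0). The midpoint \<open>q\<close> of x and 1 leaves room for the
    mixing error.\<close>
  define x where "x = exp (- 1 / (16 * real k0))"
  have x: "0 < x" "x < 1" using k0(2) by (auto simp: x_def)
  define q where "q = (1 + x) / 2"
  have q: "x < q" "q < 1" "0 \<le> q" using x by (auto simp: q_def)
  have "eventually (\<lambda>n. max_le_prob n (a n) \<le> q) sequentially"
  proof -
    have e1: "eventually (\<lambda>n. real n * tail (a n) > 3/4) sequentially" using n_tail_a by (intro order_tendstoD) auto
    have e2: "eventually (\<lambda>n. r n \<ge> k0 \<and> r n \<ge> 1) sequentially"
      using r(1) by (simp add: filterlim_at_top eventually_conj_iff)
    have e3: "eventually (\<lambda>n. real (r n) / real n < 1/4) sequentially" using r(2) by (intro order_tendstoD) auto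
    have e4: "eventually (\<lambda>n. real (l n) / real (r n) < 1) sequentially" using l(1) by (intro order_tendstoD) auto
    have e5: "eventually (\<lambda>n. real n / real (r n) * alpha (l n) < q - x) sequentially" using l(2) q by (intro order_tendstoD) auto
    show ?thesis using D e1 e2 e3 e4 e5 a_pos eventually_gt_at_top[of 0]
    proof eventually_elim
      case (elim n)
      let ?r = "r n" and ?l = "l n"
      \<comment> \<open>Number of grid points in a block of length r; rounding costs at most a
        factor 2, hence w >= r / (2 k0).\<close>
      define w where "w = ?r div k0"
      have kw: "k0 * w \<le> ?r" by (simp add: w_def)
      have w1: "w \<ge> 1" using elim(3) k0(2) by (simp add: w_def div_greater_zero_iff Suc_le_eq)
      have "?r < k0 * (w + 1)" unfolding w_def using k0(2) by (metis Suc_eq_plus1 dividend_less_times_div mult_Suc_right)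
      then have "real ?r < real (k0 * (w + 1))" by (simp only: of_nat_less_iff)
      also have "\<dots> \<le> real k0 * (2 * real w)" using w1 k0(2) by simp
      finally have w2: "real ?r / (2 * real k0) \<le> real w" using k0(2) by (simp add: field_simps)
      \<comment> \<open>Product of the lower bounds r / (2 k0) for w and 1 / (2 n) for
        \<open>tail\<close> (a n) - 1 / (4 n), the latter from n \<open>tail\<close> (a n) >
        3/4.\<close>
      define h where "h = real ?r / (4 * real k0 * real n)"
      have joint: "(\<Sum>t\<in>{k0..?r}. prob {\<omega>\<in>space M. \<bar>X (int t) \<omega>\<bar> > a n \<and> \<bar>X 0 \<omega>\<bar> > a n}) \<le> 1 / (4 * real n)"
      proof -
        have "(\<Sum>t\<in>{k0..?r}. prob {\<omega>\<in>space M. \<bar>X (int t) \<omega>\<bar> > a n \<and> \<bar>X 0 \<omega>\<bar> > a n}) \<le> (\<Sum>t\<in>{k0..r n}.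
          \<integral>\<omega>. min (\<bar>X (int t) \<omega>\<bar> / a n) 1 * min (\<bar>X 0 \<omega>\<bar> / a n) 1 \<partial>M)"
          using elim by (intro sum_mono joint_exceedance_le) auto
        also have "\<dots> \<le> 1 / (4 * real n)" using elim by (simp add: field_simps)
        finally show ?thesis .
      qed
      have "max_le_prob ?r (a n) \<le> 1 - prob {\<omega>\<in>space M. \<exists>j\<in>{1..w}. \<bar>X (int (k0 * j)) \<omega>\<bar> > a n}"
      proof -
        have "max_le_prob ?r (a n) \<le> prob (space M - {\<omega>\<in>space M. \<exists>j\<in>{1..w}. \<bar>X (int (k0 * j)) \<omega>\<bar> > a n})"
          unfolding max_le_prob_def
        proof (rule finite_measure_mono)
          show "{\<omega>\<in>space M. \<forall>t\<in>{1..int ?r}. \<bar>X t \<omega>\<bar> \<le> a n} \<subseteq> space M - {\<omega>\<in>space M. \<exists>j\<in>{1..w}. \<bar>X (int (k0 * j)) \<omega>\<bar> > a n}"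
          proof
            fix \<omega> assume \<omega>: "\<omega> \<in> {\<omega>\<in>space M. \<forall>t\<in>{1..int ?r}. \<bar>X t \<omega>\<bar> \<le> a n}"
            have "\<bar>X (int (k0 * j)) \<omega>\<bar> \<le> a n" if "j \<in> {1..w}" for j
            proof -
              have "k0 * j \<le> k0 * w" using that by (intro mult_left_mono) auto
              then have "k0 * j \<le> ?r" using kw by linarith
              moreover have "1 \<le> k0 * j" using that k0(2) by (simp add: Suc_le_eq)
              ultimately have "int (k0 * j) \<in> {1..int ?r}" unfolding atLeastAtMost_iff by linarith
              then show ?thesis using \<omega> by blast
            qed
            then show "\<omega> \<in> space M - {\<omega>\<in>space M. \<exists>j\<in>{1..w}. \<bar>X (int (k0 * j)) \<omega>\<bar> > a n}"
              using \<omega> by (auto simp: not_less simp del: of_nat_mult)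
          qed
        qed measurable
        then show ?thesis by (simp add: prob_compl)
      qed
      also have "\<dots> \<le> 1 - real w * (tail (a n) - 1 / (4 * real n))"
      proof -
        have "real w * (tail (a n) - 1 / (4 * real n)) \<le> real w * (tail (a n) - (\<Sum>t\<in>{k0..?r}. prob {\<omega>\<in>space M. \<bar>X (int t) \<omega>\<bar> > a n \<and> \<bar>X 0 \<omega>\<bar> > a n}))"
          using joint by (intro mult_left_mono) auto
        then show ?thesis using exceedance_prob_ge[OF k0(2) kw, of "a n"] by linarith
      qed
      also have "\<dots> \<le> 1 - h"
      proof -
        have "1 / (2 * real n) \<le> tail (a n) - 1 / (4 * real n)" using elim by (simp add: field_simps)
        then have "real w * (1 / (2 * real n)) \<le> real w * (tail (a n) - 1 / (4 * real n))" by (intro mult_left_mono) auto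
        moreover have "real ?r / (2 * real k0) * (1 / (2 * real n)) \<le> real w * (1 / (2 * real n))" using w2 by (intro mult_right_mono) auto
        moreover have "h = real ?r / (2 * real k0) * (1 / (2 * real n))" by (simp add: h_def)
        ultimately show ?thesis by linarith
      qed
      also have "\<dots> \<le> exp (- h)" using exp_ge_add_one_self[of "- h"] by simp
      finally have block: "max_le_prob ?r (a n) \<le> exp (- h)" .
      \<comment> \<open>J is at least n / (4 r): one factor 2 comes from the gaps, as l <= r, and
        one from rounding.\<close>
      define J where "J = n div (?r + ?l)"
      have rl: "?r + ?l > 0" using elim by simp
      have lr: "real ?l \<le> real ?r" using elim by (simp add: field_simps)
      have rn: "4 * real ?r \<le> real n" using elim by (simp add: field_simps)
      have "?r + ?l \<le> n" using lr rn by linarith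
      then have J1: "J \<ge> 1" using rl by (simp add: J_def div_greater_zero_iff Suc_le_eq)
      have "n < (?r + ?l) * (J + 1)" unfolding J_def using rl by (metis Suc_eq_plus1 dividend_less_times_div mult_Suc_right)
      then have "real n < real ((?r + ?l) * (J + 1))" by (simp only: of_nat_less_iff)
      also have "\<dots> = (real ?r + real ?l) * (real J + 1)" by (simp only: of_nat_mult of_nat_add of_nat_1)
      also have "\<dots> \<le> (2 * real ?r) * (2 * real J)" using J1 lr by (intro mult_mono) auto
      finally have J2: "real n / (4 * real ?r) \<le> real J" using elim by (simp add: field_simps)
      have "J * (?r + ?l) \<le> n" by (simp add: J_def)
      then have J3: "real J * real ?r \<le> real n"
        by (metis le_add1 mult_le_mono2 of_nat_le_iff of_nat_mult order_trans)
      have "max_le_prob n (a n) \<le> max_le_prob ?r (a n) ^ J + real J * alpha ?l"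
        by (rule max_le_prob_block) (simp add: J_def)
      also have "max_le_prob ?r (a n) ^ J \<le> exp (- h) ^ J" by (intro power_mono block) (simp add: max_le_prob_def)
      also have "exp (- h) ^ J = exp (- (real J * h))" by (simp flip: exp_of_nat_mult)
      also have "\<dots> \<le> x"
      proof -
        have "real n / (4 * real ?r) * h \<le> real J * h" using J2 by (intro mult_right_mono) (auto simp: h_def)
        moreover have "real n / (4 * real ?r) * h = 1 / (16 * real k0)" using elim by (simp add: h_def)
        ultimately show ?thesis unfolding x_def by simp
      qed
      also have "real J * alpha ?l \<le> real n / real ?r * alpha ?l"
        using J3 elim by (intro mult_right_mono alpha_nonneg) (simp add: field_simps)
      finally show ?case using elim by simp
    qed
  qed
  then show ?thesis using that q by blast
qed

text \<open>The sample is cut into J stretches of length m ~ n / J. Each has its maximum below a m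
  with probability at most q, and a m / a n tends to J^(-1/\<kappa>), so a small multiple of a n is
  exceeded except with probability about q^J.\<close>

lemma max_le_prob_small:
  assumes "e > 0"
  obtains \<epsilon> where "\<epsilon> > 0" "eventually (\<lambda>n. max_le_prob n (\<epsilon> * a n) < e) sequentially"
proof -
  obtain q where q: "0 \<le> q" "q < 1" "eventually (\<lambda>n. max_le_prob n (a n) \<le> q) sequentially"
    using max_le_prob_bounded_away by blast
  have "(\<lambda>J. q ^ J) \<longlonglongrightarrow> 0" using q by (intro LIMSEQ_realpow_zero) auto
  then have "eventually (\<lambda>J. q ^ J < e / 2 \<and> J > 0) sequentially"
    using order_tendstoD(2)[of "\<lambda>J. q ^ J" 0 sequentially "e / 2"] assms eventually_gt_at_top[of 0] by (simp add: eventually_conj_iff)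
  then obtain J where J: "q ^ J < e / 2" "J > 0" using eventually_happens by force
  have "(\<lambda>k. real J * alpha k) \<longlonglongrightarrow> real J * 0" by (intro tendsto_intros alpha_tendsto_0)
  then have "eventually (\<lambda>k. real J * alpha k < e / 2) sequentially" using assms by (intro order_tendstoD) auto
  then obtain k where k: "real J * alpha k < e / 2" by (auto simp: eventually_sequentially)
  \<comment> \<open>The gap k is taken out of each stretch, so that J (m + k) <= n.\<close>
  define m where "m n = nat \<lfloor>1 / real J * real n\<rfloor> - k" for n
  have mn: "(\<lambda>n. real (m n) / real n) \<longlonglongrightarrow> 1 / real J" unfolding m_def by (rule tendsto_floor_scaled) simp
  have m_top: "filterlim m at_top sequentially"
  proof (rule filterlim_at_top[THEN iffD2], rule allI)
    fix Z
    show "eventually (\<lambda>n. Z \<le> m n) sequentially" using eventually_ge_at_top[of "J * (Z + k)"]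
    proof eventually_elim
      case (elim n)
      then have "real (J * (Z + k)) \<le> real n" by (simp only: of_nat_le_iff)
      then have "real (Z + k) \<le> 1 / real J * real n" using J(2) by (simp add: field_simps)
      then have "int (Z + k) \<le> \<lfloor>1 / real J * real n\<rfloor>" by (simp add: le_floor_iff)
      then show ?case unfolding m_def by linarith
    qed
  qed
  have ar: "(\<lambda>n. a (m n) / a n) \<longlonglongrightarrow> (1 / real J) powr (1 / \<kappa>)"
    by (rule a_ratio[OF m_top mn]) (use J in simp)
  define \<epsilon> where "\<epsilon> = (1 / real J) powr (1 / \<kappa>) / 2"
  have \<epsilon>: "\<epsilon> > 0" "\<epsilon> < (1 / real J) powr (1 / \<kappa>)" using J by (auto simp: \<epsilon>_def)
  have e1: "eventually (\<lambda>n. \<epsilon> < a (m n) / a n) sequentially" using ar \<epsilon> by (intro order_tendstoD)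
  have e2: "eventually (\<lambda>n. max_le_prob (m n) (a (m n)) \<le> q) sequentially"
    using filterlim_iff[THEN iffD1, OF m_top] q(3) by blast
  have e3: "eventually (\<lambda>n. m n > 0) sequentially" using m_top[unfolded filterlim_at_top, rule_format, of 1] by (simp add: Suc_le_eq)
  have "eventually (\<lambda>n. max_le_prob n (\<epsilon> * a n) < e) sequentially"
    using e1 e2 e3 a_pos
  proof eventually_elim
    case (elim n)
    have "\<epsilon> * a n \<le> a (m n)" using elim by (simp add: field_simps)
    then have "max_le_prob (m n) (\<epsilon> * a n) \<le> q" using max_le_prob_mono[of "\<epsilon> * a n" "a (m n)" "m n"] elim by linarith
    moreover have "max_le_prob n (\<epsilon> * a n) \<le> max_le_prob (m n) (\<epsilon> * a n) ^ J + real J * alpha k"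
    proof (rule max_le_prob_block)
      have "m n + k = nat \<lfloor>1 / real J * real n\<rfloor>" using elim unfolding m_def by simp
      then have "real (m n + k) \<le> 1 / real J * real n" by (simp add: of_nat_floor)
      then have "real (J * (m n + k)) \<le> real n" using J(2) by (simp add: field_simps)
      then show "J * (m n + k) \<le> n" by (simp only: of_nat_le_iff)
    qed
    moreover have "max_le_prob (m n) (\<epsilon> * a n) ^ J \<le> q ^ J"
      by (intro power_mono calculation(1)) (simp add: max_le_prob_def)
    ultimately show ?case using J(1) k by linarith
  qed
  then show ?thesis using \<epsilon> that by blast
qed

section \<open>Truncated second moments and tightness of the sum of squares\<close>

definition trunc_moment :: "real \<Rightarrow> real" where
  "trunc_moment c = expectation (\<lambda>\<omega>. min ((X 0 \<omega>)\<^sup>2) (c\<^sup>2))"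

lemma trunc_integrable: "integrable M (\<lambda>\<omega>. min ((X t \<omega>)\<^sup>2) (c\<^sup>2))"
  by (rule integrable_bounded[where B = "c\<^sup>2"]) auto

text \<open>Raising the cap from c to 2 c adds at most (2 c)^2 - c^2 = 3 c^2, and only where |X 0| >
  c.\<close>

lemma trunc_moment_double:
  assumes "c > 0" shows "trunc_moment (2 * c) \<le> trunc_moment c + 3 * c\<^sup>2 * tail c"
proof -
  have i: "integrable M (\<lambda>\<omega>. of_bool (\<bar>X 0 \<omega>\<bar> > c) :: real)" by (rule integrable_bounded[where B = 1]) auto
  have "trunc_moment (2 * c) \<le> expectation (\<lambda>\<omega>. min ((X 0 \<omega>)\<^sup>2) (c\<^sup>2) + 3 * c\<^sup>2 * of_bool (\<bar>X 0 \<omega>\<bar> > c))"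
    unfolding trunc_moment_def
  proof (rule integral_mono)
    fix \<omega>
    show "min ((X 0 \<omega>)\<^sup>2) ((2 * c)\<^sup>2) \<le> min ((X 0 \<omega>)\<^sup>2) (c\<^sup>2) + 3 * c\<^sup>2 * of_bool (\<bar>X 0 \<omega>\<bar> > c)"
    proof (cases "\<bar>X 0 \<omega>\<bar> > c")
      case True
      then have "c\<^sup>2 \<le> (X 0 \<omega>)\<^sup>2" using assms abs_le_square_iff[of c "X 0 \<omega>"] by simp
      then show ?thesis using True by (simp add: min_def power_mult_distrib)
    next
      case False
      then have "(X 0 \<omega>)\<^sup>2 \<le> c\<^sup>2" using assms abs_le_square_iff[of "X 0 \<omega>" c] by simp
      then show ?thesis using False by (simp add: min_def)
    qed
  qed (use i trunc_integrable[of 0 c] trunc_integrable[of 0 "2 * c"] in simp_all)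
  also have "\<dots> = trunc_moment c + 3 * c\<^sup>2 * tail c"
    using i trunc_integrable[of 0 c] by (simp add: trunc_moment_def expectation_of_bool tail_def)
  finally show ?thesis .
qed

text \<open>A Karamata-type bound: since 2 powr - \<kappa> > 1/4, doubling c contracts the quotient
  of the truncated moment by c^2 P(|X| > c), up to an additive constant.\<close>
lemma trunc_moment_le:
  obtains C x0 where "C > 0" "\<And>c. c \<ge> x0 \<Longrightarrow> trunc_moment c \<le> C * c\<^sup>2 * tail c"
proof -
  have "(2::real) powr -2 < 2 powr - \<kappa>" using kappa by (intro powr_less_mono) auto
  then have "1/4 < (2::real) powr - \<kappa>" by (simp add: powr_minus)
  then obtain \<theta> where \<theta>: "1/4 < \<theta>" "\<theta> < 2 powr - \<kappa>" using dense by blast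
  have "eventually (\<lambda>x. \<theta> < tail (2 * x) / tail x \<and> x \<ge> 1) at_top"
    using order_tendstoD(1)[OF tail_scale[of 2] \<theta>(2)] eventually_ge_at_top[of 1] by (simp add: eventually_conj_iff)
  then obtain x0 where x0': "\<And>x. x \<ge> x0 \<Longrightarrow> \<theta> < tail (2 * x) / tail x \<and> x \<ge> 1" by (auto simp: eventually_at_top_linorder)
  have x01: "x0 \<ge> 1" using x0'[of x0] by simp
  have x0: "\<theta> * tail x \<le> tail (2 * x)" if "x \<ge> x0" for x
    using x0'[OF that] tail_pos[of x] by (simp add: field_simps)
  \<comment> \<open>With c = 2 d, the quantity d^2 \<open>tail\<close> d is at most s c^2
    \<open>tail\<close> c. The constant must then satisfy (C + 3) s <= C, which explains the first
    entry of \<open>C\<close>. The second entry covers the start interval [x0, 2 x0], where the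
    truncated moment is at most c^2.\<close>
  define s where "s = 1 / (4 * \<theta>)"
  have s: "0 < s" "s < 1" using \<theta> by (auto simp: s_def)
  define C where "C = max (3 * s / (1 - s)) (4 / tail (2 * x0))"
  have C1: "(C + 3) * s \<le> C"
  proof -
    have "3 * s / (1 - s) \<le> C" by (simp add: C_def)
    then have "3 * s \<le> C * (1 - s)" using s by (simp add: pos_divide_le_eq)
    then show ?thesis by (simp add: algebra_simps)
  qed
  have C0: "C > 0" using tail_pos[of "2 * x0"] by (simp add: C_def less_max_iff_disj)
  have main: "\<forall>c\<in>{x0..2 ^ Suc k * x0}. trunc_moment c \<le> C * c\<^sup>2 * tail c" for k
  proof (induction k)
    case 0
    show ?case
    proof
      fix c assume "c \<in> {x0..2 ^ Suc 0 * x0}"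
      then have c: "x0 \<le> c" "c \<le> 2 * x0" by auto
      have "trunc_moment c \<le> expectation (\<lambda>_. c\<^sup>2)" unfolding trunc_moment_def
        by (intro integral_mono trunc_integrable) auto
      then have "trunc_moment c \<le> 1 * c\<^sup>2" by (simp add: prob_space)
      also have "\<dots> \<le> (C * tail c) * c\<^sup>2"
      proof (rule mult_right_mono)
        have "4 / tail (2 * x0) \<le> C" by (simp add: C_def)
        then have "4 \<le> C * tail (2 * x0)" using tail_pos[of "2 * x0"] by (simp add: pos_divide_le_eq)
        also have "\<dots> \<le> C * tail c" using tail_antimono[OF c(2)] C0 by (intro mult_left_mono) auto
        finally show "1 \<le> C * tail c" by simp
      qed simp
      finally show "trunc_moment c \<le> C * c\<^sup>2 * tail c" by (simp add: algebra_simps)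
    qed
  next
    case (Suc k)
    show ?case
    proof
      fix c assume c: "c \<in> {x0..2 ^ Suc (Suc k) * x0}"
      show "trunc_moment c \<le> C * c\<^sup>2 * tail c"
      proof (cases "c \<le> 2 ^ Suc k * x0")
        case True
        then show ?thesis using Suc c by auto
      next
        case False
        define d where "d = c / 2"
        have "2 * x0 \<le> 2 ^ Suc k * x0" using x01 by (intro mult_right_mono) auto
        then have "2 * x0 \<le> c" using False by linarith
        then have d: "d \<in> {x0..2 ^ Suc k * x0}" "c = 2 * d" "d > 0" "d \<ge> x0" using False c x01 by (auto simp: d_def)
        have "trunc_moment c \<le> trunc_moment d + 3 * d\<^sup>2 * tail d" unfolding d(2) by (rule trunc_moment_double[OF d(3)])
        also have "\<dots> \<le> C * d\<^sup>2 * tail d + 3 * d\<^sup>2 * tail d" using Suc d(1) by auto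
        also have "\<dots> = ((C + 3) * d\<^sup>2) * tail d" by (simp add: algebra_simps)
        also have "\<dots> \<le> ((C + 3) * d\<^sup>2) * (tail c / \<theta>)"
          using x0[OF d(4)] \<theta> C0 unfolding d(2) by (intro mult_left_mono) (auto simp: field_simps)
        also have "\<dots> = ((C + 3) * s) * (c\<^sup>2 * tail c)" using \<theta> unfolding d(2) s_def by (simp add: field_simps power2_eq_square)
        also have "\<dots> \<le> C * (c\<^sup>2 * tail c)" using C1 tail_nonneg by (intro mult_right_mono) auto
        finally show ?thesis by simp
      qed
    qed
  qed
  have "trunc_moment c \<le> C * c\<^sup>2 * tail c" if "c \<ge> x0" for c
  proof -
    obtain k where k: "c / x0 < 2 ^ k" using real_arch_pow[of 2 "c / x0"] by auto
    have "(2::real) ^ k \<le> 2 ^ Suc k" by simp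
    then have "c / x0 \<le> 2 ^ Suc k" using k by linarith
    then have "c \<le> 2 ^ Suc k * x0" using x01 by (simp add: field_simps)
    then show ?thesis using main[of k] that by auto
  qed
  then show ?thesis using that C0 by blast
qed

text \<open>The variables are cut at L a n. Some variable exceeds this level with probability at
  most n \<open>tail\<close> (L a n), which is close to L^(-\<kappa>); the truncated sum is handled
  by Markov's inequality and \<open>trunc_moment_le\<close>.\<close>

lemma sum_squares_tight:
  assumes e: "e > 0"
  obtains K where "K > 0" "eventually (\<lambda>n. prob {\<omega>\<in>space M. (\<Sum>t=1..n. (X (int t) \<omega>)\<^sup>2) \<ge> (K * a n)\<^sup>2} < e) sequentially"
proof -
  obtain C x0 where C: "C > 0" "\<And>c. c \<ge> x0 \<Longrightarrow> trunc_moment c \<le> C * c\<^sup>2 * tail c" using trunc_moment_le by blast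
  define L where "L = max 1 ((4 / e) powr (1 / \<kappa>) + 1)"
  have L: "L \<ge> 1" "(4 / e) powr (1 / \<kappa>) < L" by (auto simp: L_def)
  have "L powr - \<kappa> < e / 4"
  proof -
    have "((4 / e) powr (1 / \<kappa>)) powr \<kappa> < L powr \<kappa>" using L kappa by (intro powr_less_mono2) auto
    then have "4 / e < L powr \<kappa>" using e kappa by (simp add: powr_powr)
    then show ?thesis using e L by (simp add: powr_minus field_simps)
  qed
  then have t1: "eventually (\<lambda>n. real n * tail (L * a n) < e / 4) sequentially"
    using n_tail_scaled_a[of L] L by (intro order_tendstoD) auto
  have "eventually (\<lambda>n. x0 \<le> a n) sequentially" using a_at_top by (simp add: filterlim_at_top)
  \<comment> \<open>This K reduces the Markov bound to n \<open>tail\<close> (L a n), the quantity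
    that also bounds the exceedances.\<close>
  define K where "K = L * sqrt C"
  have K: "K > 0" using L C by (simp add: K_def)
  have "eventually (\<lambda>n. prob {\<omega>\<in>space M. (\<Sum>t=1..n. (X (int t) \<omega>)\<^sup>2) \<ge> (K * a n)\<^sup>2} < e) sequentially"
    using t1 \<open>eventually (\<lambda>n. x0 \<le> a n) sequentially\<close> a_pos
  proof eventually_elim
    case (elim n)
    let ?c = "L * a n"
    have c: "?c > 0" using L elim by simp
    have "1 * a n \<le> ?c" using L elim by (intro mult_right_mono) auto
    then have c2: "?c \<ge> x0" using elim by linarith
    let ?A = "{\<omega>\<in>space M. (\<Sum>t=1..n. min ((X (int t) \<omega>)\<^sup>2) (?c\<^sup>2)) \<ge> (K * a n)\<^sup>2}"
    let ?B = "\<Union>t\<in>{1..n}. {\<omega>\<in>space M. \<bar>X (int t) \<omega>\<bar> > ?c}"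
    have "prob {\<omega>\<in>space M. (\<Sum>t=1..n. (X (int t) \<omega>)\<^sup>2) \<ge> (K * a n)\<^sup>2} \<le> prob (?A \<union> ?B)"
    proof (rule finite_measure_mono)
      show "{\<omega>\<in>space M. (\<Sum>t=1..n. (X (int t) \<omega>)\<^sup>2) \<ge> (K * a n)\<^sup>2} \<subseteq> ?A \<union> ?B"
      proof
        fix \<omega> assume \<omega>: "\<omega> \<in> {\<omega>\<in>space M. (\<Sum>t=1..n. (X (int t) \<omega>)\<^sup>2) \<ge> (K * a n)\<^sup>2}"
        show "\<omega> \<in> ?A \<union> ?B"
        proof (cases "\<omega> \<in> ?B")
          case False
          then have "\<bar>X (int t) \<omega>\<bar> \<le> ?c" if "t \<in> {1..n}" for t using that \<omega> by (force simp: not_less)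
          then have "(X (int t) \<omega>)\<^sup>2 \<le> ?c\<^sup>2" if "t \<in> {1..n}" for t using that c abs_le_square_iff[of "X (int t) \<omega>" ?c] by simp
          then have "(\<Sum>t=1..n. min ((X (int t) \<omega>)\<^sup>2) (?c\<^sup>2)) = (\<Sum>t=1..n. (X (int t) \<omega>)\<^sup>2)" by (intro sum.cong refl min_absorb1) auto
          then show ?thesis using \<omega> by simp
        qed simp
      qed
    qed measurable
    also have "\<dots> \<le> prob ?A + prob ?B" by (rule measure_Un_le) measurable
    also have "prob ?B \<le> (\<Sum>t\<in>{1..n}. prob {\<omega>\<in>space M. \<bar>X (int t) \<omega>\<bar> > ?c})"
      by (rule finite_measure_subadditive_finite) auto
    also have "\<dots> = real n * tail ?c" by (simp add: tail_marginal)
    also have "prob ?A \<le> expectation (\<lambda>\<omega>. \<Sum>t=1..n. min ((X (int t) \<omega>)\<^sup>2) (?c\<^sup>2)) / (K * a n)\<^sup>2"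
      using K elim by (intro integral_Markov_inequality_measure[where A = "{}"] Bochner_Integration.integrable_sum trunc_integrable) (auto intro!: sum_nonneg)
    also have "expectation (\<lambda>\<omega>. \<Sum>t=1..n. min ((X (int t) \<omega>)\<^sup>2) (?c\<^sup>2)) = real n * trunc_moment ?c"
    proof -
      have "expectation (\<lambda>\<omega>. min ((X t \<omega>)\<^sup>2) (?c\<^sup>2)) = trunc_moment ?c" for t
        unfolding trunc_moment_def by (rule expectation_marginal) simp
      then show ?thesis using trunc_integrable[of _ ?c] by simp
    qed
    also have "\<dots> / (K * a n)\<^sup>2 \<le> real n * (C * ?c\<^sup>2 * tail ?c) / (K * a n)\<^sup>2"
      using C(2)[OF c2] by (intro divide_right_mono mult_left_mono) auto
    also have "\<dots> = real n * tail ?c" using C(1) L elim by (simp add: K_def power_mult_distrib)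
    finally show ?case using elim(1) e by simp
  qed
  then show ?thesis using K that by blast
qed

text \<open>Proved from a Potter bound for the tail along powers of two, with an exponent p strictly between 1 and \<kappa>.\<close>
lemma a_ratio_subsample:
  assumes b: "filterlim b at_top sequentially" "(\<lambda>n. real (b n) / real n) \<longlonglongrightarrow> 0"
  shows "(\<lambda>n. (a n / real n) / (a (b n) / real (b n))) \<longlonglongrightarrow> 0"
proof -
  define p where "p = (1 + \<kappa>) / 2"
  have p: "1 < p" "p < \<kappa>" using kappa by (auto simp: p_def)
  have "(2::real) powr - \<kappa> < 2 powr - p" using p by (intro powr_less_mono) auto
  then have "eventually (\<lambda>x. tail (2 * x) / tail x < 2 powr - p \<and> x \<ge> 1) at_top"
    using order_tendstoD(2)[OF tail_scale[of 2]] eventually_ge_at_top[of 1] by (simp add: eventually_conj_iff)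
  then obtain x0 where x0': "\<And>x. x \<ge> x0 \<Longrightarrow> tail (2 * x) / tail x < 2 powr - p \<and> x \<ge> 1" by (auto simp: eventually_at_top_linorder)
  have x0: "tail (2 * x) \<le> 2 powr - p * tail x" "x \<ge> 1" if "x \<ge> x0" for x
    using x0'[OF that] tail_pos[of x] by (simp_all add: field_simps)
  have iter: "tail (2 ^ k * x) \<le> (2 powr - p) ^ k * tail x" if x: "x \<ge> x0" for k x
  proof (induction k)
    case (Suc k)
    have "1 * x \<le> 2 ^ k * x" using x0(2)[OF x] by (intro mult_right_mono) auto
    then have "2 ^ k * x \<ge> x0" using x by simp
    then have "tail (2 * (2 ^ k * x)) \<le> 2 powr - p * tail (2 ^ k * x)" by (rule x0)
    also have "\<dots> \<le> 2 powr - p * ((2 powr - p) ^ k * tail x)" using Suc by (intro mult_left_mono) auto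
    finally show ?case by (simp add: mult.assoc)
  qed simp
  have potter: "tail y \<le> (2 * x / y) powr p * tail x" if xy: "x \<ge> x0" "y \<ge> x" for x y
  proof -
    have x1: "x > 0" using x0(2)[OF xy(1)] by simp
    \<comment> \<open>The largest power of two not exceeding y / x; the next one overshoots, which
      produces the factor 2 in the bound.\<close>
    obtain k where k: "2 ^ k \<le> y / x" "y / x < 2 ^ (k + 1)"
    proof -
      have ex: "\<exists>k. y / x < 2 ^ k" using real_arch_pow[of 2 "y / x"] by auto
      define K where "K = (LEAST k. y / x < 2 ^ k)"
      have K: "y / x < 2 ^ K" unfolding K_def using LeastI_ex[OF ex] .
      have "1 \<le> y / x" using xy x1 by simp
      then have "K \<noteq> 0" using K by (cases K) auto
      then obtain k where Kk: "K = Suc k" by (cases K) auto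
      have "\<not> y / x < 2 ^ k" using not_less_Least[of k "\<lambda>k. y / x < 2 ^ k"] Kk unfolding K_def by simp
      then show ?thesis using that[of k] K Kk by simp
    qed
    have "tail y \<le> tail (2 ^ k * x)" using k x1 by (intro tail_antimono) (simp add: field_simps)
    also have "\<dots> \<le> (2 powr - p) ^ k * tail x" by (rule iter[OF xy(1)])
    also have "(2 powr - p) ^ k = (1 / 2 ^ k) powr p"
      by (simp add: powr_minus powr_divide powr_power power_inverse inverse_eq_divide flip: powr_realpow) (simp add: powr_powr mult.commute)
    also have "\<dots> \<le> (2 * x / y) powr p"
    proof (rule powr_mono2)
      show "1 / 2 ^ k \<le> 2 * x / y" using k x1 xy by (simp add: field_simps)
    qed (use p in auto)
    finally show ?thesis using tail_nonneg by (simp add: mult_right_mono)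
  qed
  \<comment> \<open>Arises from solving \<beta> / 4 <= (2 x / y)^p for y / x, where \<beta> = b n /
    n.\<close>
  define D where "D = (4::real) powr (1 / p) * 2"
  have nb: "(\<lambda>n. real (b n) * tail (a (b n))) \<longlonglongrightarrow> 1" by (rule filterlim_compose[OF n_tail_a b(1)])
  have e1: "eventually (\<lambda>n. real n * tail (a n) > 1/2) sequentially" using n_tail_a by (intro order_tendstoD) auto
  have e2: "eventually (\<lambda>n. real (b n) * tail (a (b n)) < 2) sequentially" using nb by (intro order_tendstoD) auto
  have e3: "eventually (\<lambda>n. a (b n) \<ge> x0) sequentially"
    using filterlim_compose[OF a_at_top b(1)] by (simp add: filterlim_at_top)
  have e4: "eventually (\<lambda>n. b n > 0) sequentially" using b(1)[unfolded filterlim_at_top, rule_format, of 1] by (simp add: Suc_le_eq)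
  have e5: "eventually (\<lambda>n. real (b n) / real n < 1) sequentially" using b(2) by (intro order_tendstoD) auto
  have bound: "eventually (\<lambda>n. (a n / real n) / (a (b n) / real (b n)) \<le> D * (real (b n) / real n) powr (1 - 1 / p)) sequentially"
    using e1 e2 e3 e4 e5 eventually_gt_at_top[of 0] a_pos
  proof eventually_elim
    case (elim n)
    let ?x = "a (b n)" and ?y = "a n" and ?\<beta> = "real (b n) / real n"
    have x1: "?x \<ge> 1" using x0(2)[OF elim(3)] .
    have \<beta>: "0 < ?\<beta>" "?\<beta> < 1" using elim by auto
    have D1: "D \<ge> 1" using p ge_one_powr_ge_zero[of 4 "1 / p"] by (simp add: D_def)
    have "?y / ?x \<le> D * ?\<beta> powr (- (1 / p))"
    \<comment> \<open>The Potter bound requires y >= x. As a need not be monotone, the other order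
      can occur, and then y / x <= 1 is enough.\<close>
    proof (cases "?y \<ge> ?x")
      case True
      have "1 / 2 < real n * tail ?y" using elim by simp
      also have "\<dots> \<le> real n * ((2 * ?x / ?y) powr p * tail ?x)" using potter[OF elim(3) True] by (intro mult_left_mono) auto
      also have "\<dots> = (2 * ?x / ?y) powr p * (real (b n) * tail ?x) / ?\<beta>" using elim by simp
      also have "\<dots> \<le> (2 * ?x / ?y) powr p * 2 / ?\<beta>" using elim \<beta> by (intro divide_right_mono mult_left_mono) auto
      finally have "1 / 2 * ?\<beta> < (2 * ?x / ?y) powr p * 2" using pos_less_divide_eq[OF \<beta>(1)] by blast
      moreover have "u / 4 \<le> v" if "1 / 2 * u < v * 2" for u v :: real using that by simp
      ultimately have "?\<beta> / 4 \<le> (2 * ?x / ?y) powr p" by blast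
      then have "(?\<beta> / 4) powr (1 / p) \<le> ((2 * ?x / ?y) powr p) powr (1 / p)" using p \<beta> by (intro powr_mono2) auto
      then have root: "?\<beta> powr (1 / p) / 4 powr (1 / p) \<le> 2 * ?x / ?y" using p elim x1 \<beta> by (simp add: powr_powr powr_divide powr_mult)
      have alg: "y / x \<le> w * 2 / z" if "z / w \<le> 2 * x / y" "z > 0" "w > 0" "x > 0" "y > 0" for x y z w :: real
        using that by (simp add: field_simps)
      have "?y / ?x \<le> 4 powr (1 / p) * 2 / ?\<beta> powr (1 / p)" by (rule alg[OF root]) (use \<beta> x1 elim in auto)
      then show ?thesis unfolding D_def by (simp add: powr_minus divide_inverse)
    next
      case False
      then have "?y / ?x \<le> 1" using x1 by simp
      also have "1 \<le> D * ?\<beta> powr (- (1 / p))"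
      proof -
        have "1 \<le> ?\<beta> powr (- (1 / p))" unfolding powr_minus by (intro one_le_inverse powr_le1) (use \<beta> p elim in auto)
        then show ?thesis using D1 mult_mono[of 1 D 1 "?\<beta> powr (- (1 / p))"] by simp
      qed
      finally show ?thesis .
    qed
    then have "?y / ?x * ?\<beta> \<le> D * ?\<beta> powr (- (1 / p)) * ?\<beta>" using \<beta> by (intro mult_right_mono) auto
    also have "\<dots> = D * ?\<beta> powr (1 - 1 / p)"
    proof -
      have "?\<beta> powr (- (1 / p)) * ?\<beta> = ?\<beta> powr (- (1 / p)) * ?\<beta> powr 1" using \<beta> by simp
      also have "\<dots> = ?\<beta> powr (1 - 1 / p)" by (simp only: powr_add[symmetric]) simp
      finally show ?thesis by (simp only: mult.assoc)
    qed
    finally show ?case by (simp add: field_simps)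
  qed
  \<comment> \<open>Here p > 1 is decisive: it makes the exponent 1 - 1 / p positive.\<close>
  have "(\<lambda>n. D * (real (b n) / real n) powr (1 - 1 / p)) \<longlonglongrightarrow> D * 0 powr (1 - 1 / p)"
    using p by (intro tendsto_intros tendsto_powr' b) (auto intro: always_eventually)
  then have lim: "(\<lambda>n. D * (real (b n) / real n) powr (1 - 1 / p)) \<longlonglongrightarrow> 0" by simp
  show ?thesis
  proof (rule tendsto_sandwich[OF _ bound tendsto_const lim])
    have "eventually (\<lambda>n. a (b n) > 0) sequentially"
      using filterlim_iff[THEN iffD1, OF b(1)] a_pos by blast
    then show "eventually (\<lambda>n. 0 \<le> (a n / real n) / (a (b n) / real (b n))) sequentially"
      using a_pos by eventually_elim auto
  qed
qed

end

section \<open>Nonzero mean\<close>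

lemma tendsto_0_of_eventually_le:
  fixes f :: "nat \<Rightarrow> real"
  assumes "\<And>n. f n \<ge> 0" "\<And>e. e > 0 \<Longrightarrow> eventually (\<lambda>n. f n < e) sequentially"
  shows "f \<longlonglongrightarrow> 0"
  by (rule tendstoI) (use assms in \<open>auto simp: dist_real_def\<close>)

context stationary_process
begin

lemma prob_Un_le: "A \<in> sets M \<Longrightarrow> B \<in> sets M \<Longrightarrow> C \<subseteq> A \<union> B \<Longrightarrow> prob C \<le> prob A + prob B"
  using finite_measure_mono[of C "A \<union> B"] measure_Un_le[of A M B] by (meson order_trans sets.Un)

text \<open>With a nonzero mean both statistics are of order n / d n; by the growth condition on d
  the full-sample one exceeds the subsample ones, and c n is the geometric mean of the two orders.\<close>
theorem noncover_prob_tendsto_1: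
  assumes b: "filterlim b at_top sequentially" "(\<lambda>n. real (b n) / real n) \<longlonglongrightarrow> 0" and \<alpha>: "alpha \<longlonglongrightarrow> 0"
    and \<eta>: "0 < \<eta>" "\<eta> < 1"
    and int: "integrable M (X 0)" and mean: "expectation (X 0) \<noteq> 0"
    and d: "eventually (\<lambda>n. d n > 0) sequentially"
    and up: "\<And>e. e > 0 \<Longrightarrow> \<exists>K>0. eventually (\<lambda>n. prob {\<omega>\<in>space M. (\<Sum>t=1..n. (X (int t) \<omega>)\<^sup>2) \<ge> (K * d n)\<^sup>2} < e) sequentially"
    and low: "\<And>e. e > 0 \<Longrightarrow> \<exists>\<epsilon>>0. eventually (\<lambda>n. prob {\<omega>\<in>space M. (\<Sum>t=1..n. (X (int t) \<omega>)\<^sup>2) \<le> (\<epsilon> * d n)\<^sup>2} < e) sequentially"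
    and ratio: "(\<lambda>n. (d n / real n) / (d (b n) / real (b n))) \<longlonglongrightarrow> 0"
  shows "noncover_prob M X b \<eta> \<longlonglongrightarrow> 1"
proof -
  define \<mu> where "\<mu> = expectation (X 0)"
  \<comment> \<open>Multiplying by the sign treats both directions of the mean in one
    computation.\<close>
  define s where "s = sgn \<mu>"
  define m where "m = \<bar>\<mu>\<bar>"
  have m: "m > 0" using mean by (simp add: m_def \<mu>_def)
  have s: "s * \<mu> = m" "\<bar>s\<bar> = 1" using mean by (auto simp: s_def m_def \<mu>_def sgn_if)
  define \<rho> where "\<rho> n = (d n / real n) / (d (b n) / real (b n))" for n
  define c where "c n = (real (b n) / d (b n)) / sqrt (\<rho> n)" for n
  let ?S = "\<lambda>n \<omega>. \<Sum>t=1..n. X (int t) \<omega>"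
  let ?Q = "\<lambda>n \<omega>. \<Sum>t=1..n. (X (int t) \<omega>)\<^sup>2"
  have db: "eventually (\<lambda>n. d (b n) > 0) sequentially" using filterlim_iff[THEN iffD1, OF b(1)] d by blast
  have bpos: "eventually (\<lambda>n. b n > 0) sequentially" using b(1)[unfolded filterlim_at_top, rule_format, of 1] by (simp add: Suc_le_eq)
  have \<rho>pos: "eventually (\<lambda>n. \<rho> n > 0) sequentially"
    using d db bpos eventually_gt_at_top[of 0] by eventually_elim (simp add: \<rho>_def)
  have \<rho>lim: "(\<lambda>n. sqrt (\<rho> n)) \<longlonglongrightarrow> 0" using tendsto_real_sqrt[OF ratio] by (simp add: \<rho>_def)
  have lln: "(\<lambda>n. prob {\<omega>\<in>space M. \<bar>?S n \<omega> / real n - \<mu>\<bar> \<ge> m / 2}) \<longlonglongrightarrow> 0"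
    using law_of_large_numbers[OF \<alpha>, of "\<lambda>x. x" "m / 2"] int m by (simp add: \<mu>_def)
  have llnb: "(\<lambda>n. prob {\<omega>\<in>space M. \<bar>?S (b n) \<omega> / real (b n) - \<mu>\<bar> \<ge> m / 2}) \<longlonglongrightarrow> 0"
    by (rule filterlim_compose[OF lln b(1)])
  have sub: "(\<lambda>n. prob {\<omega>\<in>space M. s * Tstat X (b n) \<omega> \<ge> c n}) \<longlonglongrightarrow> 0"
  proof (rule tendsto_0_of_eventually_le)
    fix e :: real assume e: "e > 0"
    obtain \<epsilon> where \<epsilon>: "\<epsilon> > 0" and "eventually (\<lambda>n. prob {\<omega>\<in>space M. ?Q n \<omega> \<le> (\<epsilon> * d n)\<^sup>2} < e / 2) sequentially"
      using low[of "e / 2"] e by auto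
    then have q: "eventually (\<lambda>n. prob {\<omega>\<in>space M. ?Q (b n) \<omega> \<le> (\<epsilon> * d (b n))\<^sup>2} < e / 2) sequentially"
      using filterlim_iff[THEN iffD1, OF b(1)] by blast
    have l: "eventually (\<lambda>n. prob {\<omega>\<in>space M. \<bar>?S (b n) \<omega> / real (b n) - \<mu>\<bar> \<ge> m / 2} < e / 2) sequentially"
      using llnb e by (intro order_tendstoD) auto
    have r: "eventually (\<lambda>n. sqrt (\<rho> n) < \<epsilon> / (2 * m)) sequentially" using \<rho>lim m \<epsilon> by (intro order_tendstoD) auto
    show "eventually (\<lambda>n. prob {\<omega>\<in>space M. s * Tstat X (b n) \<omega> \<ge> c n} < e) sequentially"
      using q l r db bpos \<rho>pos
    proof eventually_elim
      case (elim n)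
      let ?d = "d (b n)" and ?b = "real (b n)"
      have cgt: "2 * m / \<epsilon> * (?b / ?d) \<le> c n"
      proof -
        have "2 * m / \<epsilon> \<le> 1 / sqrt (\<rho> n)" using elim m \<epsilon> by (simp add: field_simps)
        then have "2 * m / \<epsilon> * (?b / ?d) \<le> 1 / sqrt (\<rho> n) * (?b / ?d)" using elim by (intro mult_right_mono) auto
        then show ?thesis by (simp add: c_def mult.commute)
      qed
      have "prob {\<omega>\<in>space M. s * Tstat X (b n) \<omega> \<ge> c n} \<le>
        prob {\<omega>\<in>space M. \<bar>?S (b n) \<omega> / ?b - \<mu>\<bar> \<ge> m / 2} + prob {\<omega>\<in>space M. ?Q (b n) \<omega> \<le> (\<epsilon> * ?d)\<^sup>2}"
      proof (rule prob_Un_le)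
        show "{\<omega>\<in>space M. s * Tstat X (b n) \<omega> \<ge> c n} \<subseteq> {\<omega>\<in>space M. \<bar>?S (b n) \<omega> / ?b - \<mu>\<bar> \<ge> m / 2} \<union> {\<omega>\<in>space M. ?Q (b n) \<omega> \<le> (\<epsilon> * ?d)\<^sup>2}"
        proof (rule subsetI, rule ccontr)
          fix \<omega> assume 1: "\<omega> \<in> {\<omega>\<in>space M. s * Tstat X (b n) \<omega> \<ge> c n}"
            and 2: "\<omega> \<notin> {\<omega>\<in>space M. \<bar>?S (b n) \<omega> / ?b - \<mu>\<bar> \<ge> m / 2} \<union> {\<omega>\<in>space M. ?Q (b n) \<omega> \<le> (\<epsilon> * ?d)\<^sup>2}"
          have S: "\<bar>?S (b n) \<omega> / ?b - \<mu>\<bar> < m / 2" and Q: "(\<epsilon> * ?d)\<^sup>2 < ?Q (b n) \<omega>" using 1 2 by auto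
          have V: "\<epsilon> * ?d < sqrt (?Q (b n) \<omega>)" using Q by (rule real_less_rsqrt)
          have Vpos: "0 < sqrt (?Q (b n) \<omega>)" by (rule less_trans[OF mult_pos_pos V]) (use \<epsilon> elim in auto)
          have "\<bar>?S (b n) \<omega> / ?b\<bar> < 3 / 2 * m" using S unfolding m_def by linarith
          then have "\<bar>?S (b n) \<omega>\<bar> < 3 / 2 * m * ?b" using elim by (simp add: abs_divide field_simps)
          then have "s * ?S (b n) \<omega> < 3 / 2 * m * ?b" using s(2) abs_ge_self[of "s * ?S (b n) \<omega>"] by (simp add: abs_mult)
          then have "s * Tstat X (b n) \<omega> < (3 / 2 * m * ?b) / sqrt (?Q (b n) \<omega>)" 
            unfolding Tstat_def times_divide_eq_right using Vpos by (intro divide_strict_right_mono)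
          also have "\<dots> \<le> (3 / 2 * m * ?b) / (\<epsilon> * ?d)" using V Vpos \<epsilon> elim m by (intro divide_left_mono mult_pos_pos) auto
          also have "\<dots> \<le> 2 * m / \<epsilon> * (?b / ?d)" using m \<epsilon> elim by (simp add: field_simps)
          finally show False using 1 cgt by simp
        qed
      qed measurable
      then show ?case using elim by linarith
    qed
  qed simp
  \<comment> \<open>The factor 2 separates the thresholds of the full statistic and of the
    subsamples, as the case of a negative mean requires: there -2 c n < -c n is used.\<close>
  have full: "(\<lambda>n. prob {\<omega>\<in>space M. s * Tstat X n \<omega> \<le> 2 * c n}) \<longlonglongrightarrow> 0"
  proof (rule tendsto_0_of_eventually_le)
    fix e :: real assume e: "e > 0"
    obtain K where K: "K > 0" and q: "eventually (\<lambda>n. prob {\<omega>\<in>space M. ?Q n \<omega> \<ge> (K * d n)\<^sup>2} < e / 2) sequentially"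
      using up[of "e / 2"] e by auto
    have l: "eventually (\<lambda>n. prob {\<omega>\<in>space M. \<bar>?S n \<omega> / real n - \<mu>\<bar> \<ge> m / 2} < e / 2) sequentially"
      using lln e by (intro order_tendstoD) auto
    have r: "eventually (\<lambda>n. sqrt (\<rho> n) < m / (4 * K)) sequentially" using \<rho>lim m K by (intro order_tendstoD) auto
    show "eventually (\<lambda>n. prob {\<omega>\<in>space M. s * Tstat X n \<omega> \<le> 2 * c n} < e) sequentially"
      using q l r db d bpos \<rho>pos eventually_gt_at_top[of 0]
    proof eventually_elim
      case (elim n)
      let ?n = "real n"
      have clt: "2 * c n < (m / 2 * ?n) / (K * d n)"
      proof -
        have cn: "c n = sqrt (\<rho> n) * (?n / d n)"
        proof -
          have nd: "?n / d n = (real (b n) / d (b n)) / \<rho> n" using elim by (simp add: \<rho>_def)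
          have root: "sqrt (\<rho> n) * (u / \<rho> n) = u / sqrt (\<rho> n)" for u
            using elim(7) by (metis less_imp_le real_div_sqrt times_divide_eq_left times_divide_eq_right divide_divide_eq_right mult.commute)
          show ?thesis unfolding c_def nd by (rule root[symmetric])
        qed
        have "sqrt (\<rho> n) * (?n / d n) < m / (4 * K) * (?n / d n)" using elim by (intro mult_strict_right_mono) auto
        then show ?thesis unfolding cn by (simp add: field_simps)
      qed
      have "prob {\<omega>\<in>space M. s * Tstat X n \<omega> \<le> 2 * c n} \<le>
        prob {\<omega>\<in>space M. \<bar>?S n \<omega> / ?n - \<mu>\<bar> \<ge> m / 2} + prob {\<omega>\<in>space M. ?Q n \<omega> \<ge> (K * d n)\<^sup>2}"
      proof (rule prob_Un_le)
        show "{\<omega>\<in>space M. s * Tstat X n \<omega> \<le> 2 * c n} \<subseteq> {\<omega>\<in>space M. \<bar>?S n \<omega> / ?n - \<mu>\<bar> \<ge> m / 2} \<union> {\<omega>\<in>space M. ?Q n \<omega> \<ge> (K * d n)\<^sup>2}"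
        proof (rule subsetI, rule ccontr)
          fix \<omega> assume 1: "\<omega> \<in> {\<omega>\<in>space M. s * Tstat X n \<omega> \<le> 2 * c n}"
            and 2: "\<omega> \<notin> {\<omega>\<in>space M. \<bar>?S n \<omega> / ?n - \<mu>\<bar> \<ge> m / 2} \<union> {\<omega>\<in>space M. ?Q n \<omega> \<ge> (K * d n)\<^sup>2}"
          have S: "\<bar>?S n \<omega> / ?n - \<mu>\<bar> < m / 2" and Q: "?Q n \<omega> < (K * d n)\<^sup>2" using 1 2 by auto
          have V: "sqrt (?Q n \<omega>) < K * d n" using Q K elim by (intro real_less_lsqrt) auto
          have "s * (?S n \<omega> / ?n - \<mu>) \<ge> - \<bar>?S n \<omega> / ?n - \<mu>\<bar>" using s(2) by (metis abs_ge_minus_self abs_mult minus_le_iff mult_1)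
          then have "s * (?S n \<omega> / ?n) > m / 2" using S s(1) unfolding right_diff_distrib by linarith
          then have sS: "s * ?S n \<omega> > m / 2 * ?n" using elim by (simp add: field_simps)
          \<comment> \<open>Division by 0 yields 0, so a vanishing denominator has to be excluded;
            it would force the sum itself to vanish.\<close>
          have Vpos: "sqrt (?Q n \<omega>) > 0"
          proof (rule ccontr)
            assume "\<not> sqrt (?Q n \<omega>) > 0"
            then have "?Q n \<omega> = 0" using sum_nonneg[of "{1..n}" "\<lambda>t. (X (int t) \<omega>)\<^sup>2"] by (simp add: real_sqrt_gt_0_iff)
            then have "\<forall>t\<in>{1..n}. X (int t) \<omega> = 0" by (simp add: sum_nonneg_eq_0_iff)
            then have "?S n \<omega> = 0" by simp
            then have "m * real n < 0" using sS by simp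
            moreover have "m * real n \<ge> 0" using m by simp
            ultimately show False by linarith
          qed
          have "(m / 2 * ?n) / (K * d n) \<le> (m / 2 * ?n) / sqrt (?Q n \<omega>)"
            using V Vpos m K elim by (intro divide_left_mono mult_pos_pos) auto
          also have "\<dots> < s * Tstat X n \<omega>" unfolding Tstat_def times_divide_eq_right using sS Vpos by (intro divide_strict_right_mono) auto
          finally show False using 1 clt by simp
        qed
      qed measurable
      then show ?case using elim by linarith
    qed
  qed simp
  have cpos: "eventually (\<lambda>n. c n > 0) sequentially"
    using \<rho>pos db bpos by eventually_elim (simp add: c_def)
  have compl: "(\<lambda>n. prob {\<omega>\<in>space M. P n \<omega>}) \<longlonglongrightarrow> 1"
    if "(\<lambda>n. prob {\<omega>\<in>space M. R n \<omega>}) \<longlonglongrightarrow> 0" "\<And>n. {\<omega>\<in>space M. R n \<omega>} \<in> sets M" "\<And>n. {\<omega>\<in>space M. P n \<omega>} \<in> sets M"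
      "eventually (\<lambda>n. \<forall>\<omega>\<in>space M. R n \<omega> \<or> P n \<omega>) sequentially" for P R
  proof (rule tendsto_sandwich[OF _ _ _ tendsto_const])
    show "(\<lambda>n. 1 - prob {\<omega>\<in>space M. R n \<omega>}) \<longlonglongrightarrow> 1" using tendsto_diff[OF tendsto_const that(1), of 1] by simp
    show "eventually (\<lambda>n. 1 - prob {\<omega>\<in>space M. R n \<omega>} \<le> prob {\<omega>\<in>space M. P n \<omega>}) sequentially"
      using that(4)
    proof eventually_elim
      case (elim n)
      have "prob (space M) \<le> prob {\<omega>\<in>space M. R n \<omega>} + prob {\<omega>\<in>space M. P n \<omega>}"
        by (rule prob_Un_le) (use that elim in auto)
      then show ?case by (simp add: prob_space)
    qed
  qed auto
  show ?thesis
  proof (cases "\<mu> > 0")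
    case True
    then have s1: "s = 1" by (simp add: s_def)
    have A: "(\<lambda>n. prob {\<omega>\<in>space M. Tstat X (b n) \<omega> \<le> c n}) \<longlonglongrightarrow> 1"
      by (rule compl[OF sub]) (auto simp: s1 linear)
    have B: "(\<lambda>n. prob {\<omega>\<in>space M. Tstat X n \<omega> > c n}) \<longlonglongrightarrow> 1"
      by (rule compl[OF full]) (use cpos in \<open>auto simp: s1 elim!: eventually_mono\<close>)
    show ?thesis by (rule noncover_prob_tendsto_1_pos[OF b(2) \<alpha> \<eta> A B])
  next
    case False
    then have s1: "s = - 1" using mean by (simp add: s_def \<mu>_def sgn_if)
    have A: "(\<lambda>n. prob {\<omega>\<in>space M. Tstat X (b n) \<omega> \<le> - c n}) \<longlonglongrightarrow> 0"
    proof -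
      have "{\<omega>\<in>space M. Tstat X (b n) \<omega> \<le> - c n} = {\<omega>\<in>space M. s * Tstat X (b n) \<omega> \<ge> c n}" for n by (auto simp: s1)
      then show ?thesis using sub by simp
    qed
    have B: "(\<lambda>n. prob {\<omega>\<in>space M. Tstat X n \<omega> \<le> - (2 * c n)}) \<longlonglongrightarrow> 1"
      by (rule compl[OF full]) (auto simp: s1 intro!: always_eventually)
    show ?thesis
      by (rule noncover_prob_tendsto_1_neg[OF b(2) \<alpha> \<eta> A B]) (use cpos in \<open>auto elim!: eventually_mono\<close>)
  qed
qed

lemma sum_squares_lln:
  assumes \<alpha>: "alpha \<longlonglongrightarrow> 0" and int: "integrable M (\<lambda>\<omega>. (X 0 \<omega>)\<^sup>2)" and "e > 0"
  shows "(\<lambda>n. prob {\<omega>\<in>space M. \<bar>(\<Sum>t=1..n. (X (int t) \<omega>)\<^sup>2) / real n - expectation (\<lambda>\<omega>. (X 0 \<omega>)\<^sup>2)\<bar> \<ge> e}) \<longlonglongrightarrow> 0"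
  using law_of_large_numbers[OF \<alpha>, of "\<lambda>x. x\<^sup>2" e] assms by simp

text \<open>The norming is sqrt n: the law of large numbers for the squares bounds the normaliser
  from both sides, with a positive limit because the mean is nonzero, and the growth quotient is
  sqrt (b n / n).\<close>

theorem noncover_prob_tendsto_1_square_integrable:
  assumes b: "filterlim b at_top sequentially" "(\<lambda>n. real (b n) / real n) \<longlonglongrightarrow> 0" and \<alpha>: "alpha \<longlonglongrightarrow> 0"
    and \<eta>: "0 < \<eta>" "\<eta> < 1"
    and int: "integrable M (\<lambda>\<omega>. (X 0 \<omega>)\<^sup>2)" and mean: "expectation (X 0) \<noteq> 0"
  shows "noncover_prob M X b \<eta> \<longlonglongrightarrow> 1"
proof -
  let ?Q = "\<lambda>n \<omega>. \<Sum>t=1..n. (X (int t) \<omega>)\<^sup>2"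
  define v where "v = expectation (\<lambda>\<omega>. (X 0 \<omega>)\<^sup>2)"
  have intX: "integrable M (X 0)" using square_integrable_imp_integrable[OF measurable_X int] .
  have v: "v > 0"
  proof -
    have "\<bar>expectation (X 0)\<bar> \<le> expectation (\<lambda>\<omega>. \<bar>X 0 \<omega>\<bar>)" by simp
    also have "\<dots> \<le> sqrt v" unfolding v_def by (rule abs_expectation_le_sqrt) (use int in auto)
    finally have "\<bar>expectation (X 0)\<bar> \<le> sqrt v" .
    moreover have "\<bar>expectation (X 0)\<bar> > 0" using mean by simp
    ultimately have "sqrt v > 0" by linarith
    then show ?thesis by simp
  qed
  have lln: "(\<lambda>n. prob {\<omega>\<in>space M. \<bar>?Q n \<omega> / real n - v\<bar> \<ge> v / 2}) \<longlonglongrightarrow> 0"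
    unfolding v_def by (rule sum_squares_lln[OF \<alpha> int]) (use v in \<open>simp add: v_def\<close>)
  show ?thesis
  proof (rule noncover_prob_tendsto_1[OF b \<alpha> \<eta> intX mean, where d = "\<lambda>n. sqrt (real n)"])
    show "eventually (\<lambda>n. sqrt (real n) > 0) sequentially" using eventually_gt_at_top[of 0] by eventually_elim simp
    fix e :: real assume e: "e > 0"
    have ev: "eventually (\<lambda>n. prob {\<omega>\<in>space M. \<bar>?Q n \<omega> / real n - v\<bar> \<ge> v / 2} < e) sequentially"
      using lln e by (intro order_tendstoD) auto
    show "\<exists>K>0. eventually (\<lambda>n. prob {\<omega>\<in>space M. ?Q n \<omega> \<ge> (K * sqrt (real n))\<^sup>2} < e) sequentially"
    proof (intro exI[of _ "sqrt (2 * v)"] conjI)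
      show "eventually (\<lambda>n. prob {\<omega>\<in>space M. ?Q n \<omega> \<ge> (sqrt (2 * v) * sqrt (real n))\<^sup>2} < e) sequentially"
        using ev eventually_gt_at_top[of 0]
      proof eventually_elim
        case (elim n)
        have "prob {\<omega>\<in>space M. ?Q n \<omega> \<ge> (sqrt (2 * v) * sqrt (real n))\<^sup>2} \<le> prob {\<omega>\<in>space M. \<bar>?Q n \<omega> / real n - v\<bar> \<ge> v / 2}"
        proof (rule finite_measure_mono)
          have "v / 2 \<le> \<bar>Q / real n - v\<bar>" if "2 * v * real n \<le> Q" for Q
          proof -
            have "2 * v \<le> Q / real n" using that elim by (simp add: field_simps)
            then show ?thesis using v by linarith
          qed
          then show "{\<omega>\<in>space M. ?Q n \<omega> \<ge> (sqrt (2 * v) * sqrt (real n))\<^sup>2} \<subseteq> {\<omega>\<in>space M. \<bar>?Q n \<omega> / real n - v\<bar> \<ge> v / 2}"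
            using v by (simp add: power_mult_distrib subset_iff)
        qed measurable
        then show ?case using elim by linarith
      qed
    qed (use v in simp)
    show "\<exists>\<epsilon>>0. eventually (\<lambda>n. prob {\<omega>\<in>space M. ?Q n \<omega> \<le> (\<epsilon> * sqrt (real n))\<^sup>2} < e) sequentially"
    proof (intro exI[of _ "sqrt (v / 2)"] conjI)
      show "eventually (\<lambda>n. prob {\<omega>\<in>space M. ?Q n \<omega> \<le> (sqrt (v / 2) * sqrt (real n))\<^sup>2} < e) sequentially"
        using ev eventually_gt_at_top[of 0]
      proof eventually_elim
        case (elim n)
        have "prob {\<omega>\<in>space M. ?Q n \<omega> \<le> (sqrt (v / 2) * sqrt (real n))\<^sup>2} \<le> prob {\<omega>\<in>space M. \<bar>?Q n \<omega> / real n - v\<bar> \<ge> v / 2}"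
        proof (rule finite_measure_mono)
          have "v / 2 \<le> \<bar>Q / real n - v\<bar>" if "Q \<le> v * real n / 2" for Q
          proof -
            have "Q / real n \<le> v / 2" using that elim by (simp add: field_simps)
            then show ?thesis using v by linarith
          qed
          then show "{\<omega>\<in>space M. ?Q n \<omega> \<le> (sqrt (v / 2) * sqrt (real n))\<^sup>2} \<subseteq> {\<omega>\<in>space M. \<bar>?Q n \<omega> / real n - v\<bar> \<ge> v / 2}"
            using v by (simp add: power_mult_distrib subset_iff real_sqrt_pow2)
        qed measurable
        then show ?case using elim by linarith
      qed
    qed (use v in simp)
  next
    have "(\<lambda>n. sqrt (real (b n) / real n)) \<longlonglongrightarrow> sqrt 0" by (rule tendsto_real_sqrt[OF b(2)])
    moreover have "(sqrt (real n) / real n) / (sqrt (real (b n)) / real (b n)) = sqrt (real (b n) / real n)" for n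
      using real_div_sqrt[of "real n"] real_div_sqrt[of "real (b n)"]
      by (cases "n = 0"; cases "b n = 0") (simp_all add: real_sqrt_divide field_simps)
    ultimately show "(\<lambda>n. (sqrt (real n) / real n) / (sqrt (real (b n)) / real (b n))) \<longlonglongrightarrow> 0" by simp
  qed
qed

end

context heavy_tailed_process
begin

text \<open>A sum of squares dominates each of its terms, so a small normaliser means a small
  maximum, and \<open>max_le_prob_small\<close> applies.\<close>

lemma sum_squares_lower:
  assumes "e > 0"
  shows "\<exists>\<epsilon>>0. eventually (\<lambda>n. prob {\<omega>\<in>space M. (\<Sum>t=1..n. (X (int t) \<omega>)\<^sup>2) \<le> (\<epsilon> * a n)\<^sup>2} < e) sequentially"
proof -
  obtain \<epsilon> where \<epsilon>: "\<epsilon> > 0" "eventually (\<lambda>n. max_le_prob n (\<epsilon> * a n) < e) sequentially"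
    using max_le_prob_small[OF assms] by blast
  have "eventually (\<lambda>n. prob {\<omega>\<in>space M. (\<Sum>t=1..n. (X (int t) \<omega>)\<^sup>2) \<le> (\<epsilon> * a n)\<^sup>2} < e) sequentially"
    using \<epsilon>(2) a_pos
  proof eventually_elim
    case (elim n)
    have "prob {\<omega>\<in>space M. (\<Sum>t=1..n. (X (int t) \<omega>)\<^sup>2) \<le> (\<epsilon> * a n)\<^sup>2} \<le> max_le_prob n (\<epsilon> * a n)"
      unfolding max_le_prob_def
    proof (rule finite_measure_mono)
      show "{\<omega>\<in>space M. (\<Sum>t=1..n. (X (int t) \<omega>)\<^sup>2) \<le> (\<epsilon> * a n)\<^sup>2} \<subseteq> {\<omega>\<in>space M. \<forall>t\<in>{1..int n}. \<bar>X t \<omega>\<bar> \<le> \<epsilon> * a n}"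
      proof (intro subsetI CollectI conjI ballI)
        fix \<omega> t assume \<omega>: "\<omega> \<in> {\<omega>\<in>space M. (\<Sum>t=1..n. (X (int t) \<omega>)\<^sup>2) \<le> (\<epsilon> * a n)\<^sup>2}" and t: "t \<in> {1..int n}"
        have "(X (int (nat t)) \<omega>)\<^sup>2 \<le> (\<Sum>t=1..n. (X (int t) \<omega>)\<^sup>2)"
          by (rule member_le_sum) (use t in auto)
        then have "(X t \<omega>)\<^sup>2 \<le> (\<epsilon> * a n)\<^sup>2" using \<omega> t by simp
        then show "\<bar>X t \<omega>\<bar> \<le> \<epsilon> * a n" using \<epsilon>(1) elim abs_le_square_iff[of "X t \<omega>" "\<epsilon> * a n"] by simp
      qed simp
    qed measurable
    then show ?case using elim by simp
  qed
  then show ?thesis using \<epsilon>(1) by blast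
qed

theorem noncover_prob_tendsto_1_heavy_tailed:
  assumes b: "filterlim b at_top sequentially" "(\<lambda>n. real (b n) / real n) \<longlonglongrightarrow> 0"
    and \<eta>: "0 < \<eta>" "\<eta> < 1" and mean: "expectation (X 0) \<noteq> 0"
  shows "noncover_prob M X b \<eta> \<longlonglongrightarrow> 1"
proof (rule noncover_prob_tendsto_1[OF b alpha_tendsto_0 \<eta> _ mean a_pos _ sum_squares_lower a_ratio_subsample[OF b]])
  \<comment> \<open>A nonintegrable function has expectation 0, so the nonzero mean already yields
    integrability.\<close>
  show "integrable M (X 0)" using mean not_integrable_integral_eq by blast
  show "\<exists>K>0. eventually (\<lambda>n. prob {\<omega>\<in>space M. (\<Sum>t=1..n. (X (int t) \<omega>)\<^sup>2) \<ge> (K * a n)\<^sup>2} < e) sequentially"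
    if "e > 0" for e using sum_squares_tight[OF that] by blast
qed

end

section \<open>The limit law under heavy tails\<close>

lemma measurable_fst_borel [measurable]: "fst \<in> borel_measurable (borel :: (real \<times> real) measure)"
  and measurable_snd_borel [measurable]: "snd \<in> borel_measurable (borel :: (real \<times> real) measure)"
  by (auto intro!: borel_measurable_continuous_onI continuous_intros)

lemma sum_int_atLeastAtMost: "(\<Sum>t=1..n. f (int t)) = (\<Sum>t\<in>{1..int n}. f t)"
proof -
  have "{1..int n} = int ` {1..n}" by (simp add: image_int_atLeastAtMost)
  then show ?thesis by (simp add: sum.reindex)
qed

lemma filterlim_at_top_of_ratio:
  fixes r :: "nat \<Rightarrow> nat"
  assumes "(\<lambda>n. real (r n) / real n) \<longlonglongrightarrow> l" "l > 0"
  shows "filterlim r at_top sequentially"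
proof (rule filterlim_at_top[THEN iffD2], rule allI)
  fix Z
  have "eventually (\<lambda>n. real (r n) / real n > l / 2) sequentially" using assms by (intro order_tendstoD) auto
  then show "eventually (\<lambda>n. Z \<le> r n) sequentially"
    using eventually_gt_at_top[of "nat \<lceil>real Z * 2 / l\<rceil>"]
  proof eventually_elim
    case (elim n)
    then have "real Z * 2 / l < real n" "n > 0" by linarith+
    then have "real Z < l / 2 * real n" using assms(2) by (simp add: field_simps)
    also have "\<dots> < real (r n)" using elim \<open>n > 0\<close> by (simp add: field_simps)
    finally show ?case by simp
  qed
qed

text \<open>The pair of \<open>scaled_pair\<close> for an arbitrary index set and norming constant,
  so that it can be evaluated on the two parts of a split sample.\<close>

definition pair_path :: "real \<Rightarrow> int set \<Rightarrow> (int \<Rightarrow> real) \<Rightarrow> real \<times> real" where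
  "pair_path c A x = ((\<Sum>t\<in>A. x t) / c, sqrt (\<Sum>t\<in>A. (x t)\<^sup>2) / c)"

lemma scaled_pair_eq_path: "scaled_pair X a n \<omega> = pair_path (a n) {1..int n} (\<lambda>t. X t \<omega>)"
  using sum_int_atLeastAtMost[of "\<lambda>t. X t \<omega>" n] sum_int_atLeastAtMost[of "\<lambda>t. (X t \<omega>)\<^sup>2" n]
  by (simp add: scaled_pair_def pair_path_def)

lemma pair_path_shift: "pair_path c {h + 1..h + int m} x = pair_path c {1..int m} (\<lambda>t. x (t + h))"
proof -
  have "(\<Sum>t\<in>{h + 1..h + int m}. f t) = (\<Sum>t\<in>{1..int m}. f (t + h))" for f :: "int \<Rightarrow> real"
    by (rule sum.reindex_bij_witness[where i = "\<lambda>t. t + h" and j = "\<lambda>t. t - h"]) auto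
  then show ?thesis by (simp add: pair_path_def)
qed

lemma cylinder_pair_path:
  assumes "f \<in> borel_measurable borel"
  shows "cylinder A (\<lambda>x. f (pair_path c A x))"
proof -
  have "cylinder A (\<lambda>x. f ((\<Sum>t\<in>A. x t) / c, sqrt (\<Sum>t\<in>A. (x t)\<^sup>2) / c))"
  proof (rule cylinder_pair[where h = "\<lambda>u v. f (u / c, sqrt v / c)"])
    have "(\<lambda>z::real \<times> real. (fst z / c, sqrt (snd z) / c)) \<in> measurable (borel \<Otimes>\<^sub>M borel) borel"
      unfolding borel_prod divide_inverse by (intro borel_measurable_continuous_onI continuous_intros)
    from measurable_compose[OF this assms]
    show "(\<lambda>(u, v). f (u / c, sqrt v / c)) \<in> borel_measurable (borel \<Otimes>\<^sub>M borel)"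
      by (simp add: case_prod_beta')
  qed (auto intro!: cylinder_sum cylinder_component[where f = "\<lambda>x. x\<^sup>2"] cylinder_component[where f = "\<lambda>x. x"])
  then show ?thesis by (simp add: pair_path_def)
qed

text \<open>Otherwise every point of S has a ball of measure 0, and by Lindelof's theorem countably
  many such balls cover S.\<close>

lemma support_point:
  fixes \<nu> :: "(real \<times> real) measure"
  assumes "prob_space \<nu>" and sets [simp]: "sets \<nu> = sets borel" and "S \<in> sets borel" "measure \<nu> S > 0"
  obtains p where "p \<in> S" "\<And>\<delta>. \<delta> > 0 \<Longrightarrow> measure \<nu> (ball p \<delta>) > 0"
proof -
  interpret prob_space \<nu> by fact
  have "\<exists>p\<in>S. \<forall>\<delta>>0. measure \<nu> (ball p \<delta>) > 0"
  proof (rule ccontr)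
    assume "\<not> ?thesis"
    then have *: "\<exists>\<delta>>0. measure \<nu> (ball p \<delta>) = 0" if "p \<in> S" for p
      using that by (metis measure_nonneg less_eq_real_def)
    then obtain r where r: "\<And>p. p \<in> S \<Longrightarrow> r p > 0" "\<And>p. p \<in> S \<Longrightarrow> measure \<nu> (ball p (r p)) = 0" by metis
    obtain F' where F': "F' \<subseteq> (\<lambda>p. ball p (r p)) ` S" "countable F'" "\<Union>F' = \<Union>((\<lambda>p. ball p (r p)) ` S)"
      using Lindelof[of "(\<lambda>p. ball p (r p)) ` S"] by auto
    have "S \<subseteq> \<Union>F'" unfolding F'(3) using r(1) by force
    moreover have "\<Union>F' \<in> null_sets \<nu>"
    proof -
      have "A \<in> null_sets \<nu>" if "A \<in> F'" for A
      proof -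
        have "A \<in> (\<lambda>p. ball p (r p)) ` S" using that F'(1) by blast
        then obtain p where p: "p \<in> S" "A = ball p (r p)" by blast
        then show ?thesis using r(2)[of p] by (auto simp: null_sets_def emeasure_eq_measure)
      qed
      then have "(\<Union>A\<in>F'. A) \<in> null_sets \<nu>" using F'(2) by (intro null_sets_UN') auto
      then show ?thesis by simp
    qed
    ultimately have "S \<in> null_sets \<nu>" using assms(3) by (auto intro: null_sets_subset)
    then show False using assms(4) by (simp add: null_sets_def measure_def)
  qed
  then show ?thesis using that by blast
qed

text \<open>A tent around p. Convergence in distribution is given through bounded continuous test
  functions, so tents take the place of balls.\<close>

definition bump :: "'a::metric_space \<Rightarrow> real \<Rightarrow> 'a \<Rightarrow> real" where
  "bump p \<delta> z = max 0 (1 - dist z p / \<delta>)"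

lemma continuous_bump: "continuous_on UNIV (bump p \<delta>)"
  unfolding bump_def divide_inverse by (intro continuous_intros)

lemma bump_bounds: "\<delta> > 0 \<Longrightarrow> 0 \<le> bump p \<delta> z" "\<delta> > 0 \<Longrightarrow> bump p \<delta> z \<le> 1" "\<delta> > 0 \<Longrightarrow> dist z p \<ge> \<delta> \<Longrightarrow> bump p \<delta> z = 0"
  by (auto simp: bump_def)

lemma dist_Pair_le: "dist (a, b) (c, d) \<le> dist a c + dist b d"
  unfolding dist_Pair_Pair by (rule sqrt_sum_squares_le_sum) auto

section \<open>Convergence of the self-normalised ratio\<close>

locale heavy_tailed_limit = heavy_tailed_process +
  fixes \<nu> :: "(real \<times> real) measure"
  assumes conv: "conv_distr2 M (scaled_pair X a) \<nu>"
begin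

sublocale nu: prob_space \<nu> using conv by (simp add: conv_distr2_def)

lemma sets_nu [measurable_cong, simp]: "sets \<nu> = sets borel" using conv by (simp add: conv_distr2_def)

lemma space_nu [simp]: "space \<nu> = UNIV" using sets_eq_imp_space_eq[OF sets_nu] by simp

lemma conv_integral:
  fixes f :: "real \<times> real \<Rightarrow> real"
  assumes "continuous_on UNIV f" "\<And>z. \<bar>f z\<bar> \<le> B"
  shows "(\<lambda>n. expectation (\<lambda>\<omega>. f (scaled_pair X a n \<omega>))) \<longlonglongrightarrow> (\<integral>z. f z \<partial>\<nu>)"
proof -
  have "\<exists>B. \<forall>z. \<bar>f z\<bar> \<le> B" using assms(2) by blast
  then show ?thesis using conv assms(1) unfolding conv_distr2_def by blast
qed

lemma measurable_scaled_pair: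
  assumes "f \<in> borel_measurable borel" shows "(\<lambda>\<omega>. f (scaled_pair X a n \<omega>) :: real) \<in> borel_measurable M"
  unfolding scaled_pair_eq_path by (rule measurable_cylinder0[OF cylinder_pair_path[OF assms]])

lemma integrable_nu:
  assumes "f \<in> borel_measurable borel" "\<And>z. \<bar>f z\<bar> \<le> B" shows "integrable \<nu> (f :: real \<times> real \<Rightarrow> real)"
  using assms by (intro nu.integrable_const_bound[where B = B]) auto

text \<open>Transfers the lower bound on the normaliser to the limit law, with one \<epsilon> that
  serves both before the limit and in it.\<close>

lemma snd_small:
  assumes e: "e > 0"
  obtains \<epsilon> where "\<epsilon> > 0" "measure \<nu> {z. snd z \<le> \<epsilon>} \<le> e"
    "eventually (\<lambda>n. prob {\<omega>\<in>space M. snd (scaled_pair X a n \<omega>) \<le> \<epsilon>} < e) sequentially"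
proof -
  obtain \<epsilon> where \<epsilon>: "\<epsilon> > 0" and Q: "eventually (\<lambda>n. prob {\<omega>\<in>space M. (\<Sum>t=1..n. (X (int t) \<omega>)\<^sup>2) \<le> (\<epsilon> * a n)\<^sup>2} < e) sequentially"
    using sum_squares_lower[OF e] by blast
  have ev: "eventually (\<lambda>n. prob {\<omega>\<in>space M. snd (scaled_pair X a n \<omega>) \<le> \<epsilon>} < e) sequentially"
    using Q a_pos
  proof eventually_elim
    case (elim n)
    have "(snd (scaled_pair X a n \<omega>) \<le> \<epsilon>) \<longleftrightarrow> (\<Sum>t=1..n. (X (int t) \<omega>)\<^sup>2) \<le> (\<epsilon> * a n)\<^sup>2" for \<omega>
    proof -
      have "(snd (scaled_pair X a n \<omega>) \<le> \<epsilon>) \<longleftrightarrow> sqrt (\<Sum>t=1..n. (X (int t) \<omega>)\<^sup>2) \<le> \<epsilon> * a n"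
        using elim by (simp add: scaled_pair_def pos_divide_le_eq)
      also have "\<dots> \<longleftrightarrow> (\<Sum>t=1..n. (X (int t) \<omega>)\<^sup>2) \<le> (\<epsilon> * a n)\<^sup>2"
        using \<epsilon> elim by (auto intro: real_le_lsqrt sqrt_le_D)
      finally show ?thesis .
    qed
    then show ?case using elim by simp
  qed
  \<comment> \<open>A continuous function between the indicators of snd <= \<epsilon> / 2 and of snd
    <= \<epsilon>; the result is therefore obtained with \<epsilon> / 2.\<close>
  define g where "g z = max 0 (min 1 (2 - 2 * snd z / \<epsilon>))" for z :: "real \<times> real"
  have gc: "continuous_on UNIV g" unfolding g_def divide_inverse by (intro continuous_intros)
  have gm [measurable]: "g \<in> borel_measurable borel" using gc by (rule borel_measurable_continuous_onI)
  have gb: "0 \<le> g z" "g z \<le> 1" "\<bar>g z\<bar> \<le> 1" for z by (auto simp: g_def)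
  have "measure \<nu> {z. snd z \<le> \<epsilon> / 2} = (\<integral>z. indicator {z. snd z \<le> \<epsilon> / 2} z \<partial>\<nu>)" by simp
  also have "\<dots> \<le> (\<integral>z. g z \<partial>\<nu>)"
  proof (rule integral_mono)
    show "indicator {z. snd z \<le> \<epsilon> / 2} z \<le> g z" for z
      using \<epsilon> by (auto simp: g_def indicator_def field_simps)
    show "integrable \<nu> g" by (rule integrable_nu[OF gm gb(3)])
    show "integrable \<nu> (indicator {z. snd z \<le> \<epsilon> / 2} :: real \<times> real \<Rightarrow> real)"
      by (rule integrable_nu[where B = 1]) (auto simp: indicator_def)
  qed
  also have "\<dots> \<le> e"
  proof (rule tendsto_upperbound[OF conv_integral[OF gc gb(3)]])
    show "eventually (\<lambda>n. expectation (\<lambda>\<omega>. g (scaled_pair X a n \<omega>)) \<le> e) sequentially"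
      using ev
    proof eventually_elim
      case (elim n)
      have m: "{\<omega>\<in>space M. snd (scaled_pair X a n \<omega>) \<le> \<epsilon>} \<in> sets M"
        using measurable_scaled_pair[OF measurable_snd_borel, of n] by measurable
      have "expectation (\<lambda>\<omega>. g (scaled_pair X a n \<omega>)) \<le> expectation (\<lambda>\<omega>. of_bool (snd (scaled_pair X a n \<omega>) \<le> \<epsilon>))"
      proof (rule integral_mono)
        show "integrable M (\<lambda>\<omega>. g (scaled_pair X a n \<omega>))"
          by (rule integrable_bounded[OF measurable_scaled_pair[OF gm] gb(3)])
        show "integrable M (\<lambda>\<omega>. of_bool (snd (scaled_pair X a n \<omega>) \<le> \<epsilon>) :: real)"
          using measurable_scaled_pair[OF measurable_snd_borel, of n] by (intro integrable_bounded[where B = 1]) auto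
        show "g (scaled_pair X a n \<omega>) \<le> of_bool (snd (scaled_pair X a n \<omega>) \<le> \<epsilon>)" for \<omega>
          using \<epsilon> by (auto simp: g_def field_simps)
      qed
      then show ?case using elim by (simp add: expectation_of_bool)
    qed
  qed simp
  finally have 1: "measure \<nu> {z. snd z \<le> \<epsilon> / 2} \<le> e" .
  have 2: "eventually (\<lambda>n. prob {\<omega>\<in>space M. snd (scaled_pair X a n \<omega>) \<le> \<epsilon> / 2} < e) sequentially"
    using ev
  proof eventually_elim
    case (elim n)
    have "prob {\<omega>\<in>space M. snd (scaled_pair X a n \<omega>) \<le> \<epsilon> / 2} \<le> prob {\<omega>\<in>space M. snd (scaled_pair X a n \<omega>) \<le> \<epsilon>}"
      using measurable_scaled_pair[OF measurable_snd_borel, of n] \<epsilon> by (intro finite_measure_mono) auto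
    then show ?case using elim by simp
  qed
  show ?thesis by (rule that[OF _ 1 2]) (use \<epsilon> in simp)
qed

lemma measure_snd_nonpos: "measure \<nu> {z. snd z \<le> 0} = 0"
proof (rule ccontr)
  assume "measure \<nu> {z. snd z \<le> 0} \<noteq> 0"
  then have pos: "measure \<nu> {z. snd z \<le> 0} > 0" using measure_nonneg[of \<nu> "{z. snd z \<le> 0}"] by linarith
  obtain \<epsilon> where \<epsilon>: "\<epsilon> > 0" "measure \<nu> {z. snd z \<le> \<epsilon>} \<le> measure \<nu> {z. snd z \<le> 0} / 2"
    using snd_small[of "measure \<nu> {z. snd z \<le> 0} / 2"] pos by auto
  have "measure \<nu> {z. snd z \<le> 0} \<le> measure \<nu> {z. snd z \<le> \<epsilon>}"
    using \<epsilon> by (intro nu.finite_measure_mono) auto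
  then show False using \<epsilon> pos by linarith
qed

lemma Tstat_eq_ratio:
  assumes "a n > 0" shows "Tstat X n \<omega> = fst (scaled_pair X a n \<omega>) / snd (scaled_pair X a n \<omega>)"
  using assms by (simp add: Tstat_def scaled_pair_def)

text \<open>The quotient is discontinuous where the second coordinate vanishes. Replacing the
  denominator by its maximum with \<epsilon> gives a continuous function, and the change only
  matters where the second coordinate is at most \<epsilon>, an event controlled by
  \<open>snd_small\<close> on both sides.\<close>

lemma Tstat_conv_integral:
  assumes h: "continuous_on UNIV h" "\<And>y::real. 0 \<le> h y" "\<And>y. h y \<le> (1::real)"
  shows "(\<lambda>n. expectation (\<lambda>\<omega>. h (Tstat X n \<omega>))) \<longlonglongrightarrow> (\<integral>z. h (fst z / snd z) \<partial>\<nu>)"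
proof (rule tendstoI)
  fix e :: real assume e: "e > 0"
  have hm [measurable]: "h \<in> borel_measurable borel" using h(1) by (rule borel_measurable_continuous_onI)
  obtain \<epsilon> where \<epsilon>: "\<epsilon> > 0" "measure \<nu> {z. snd z \<le> \<epsilon>} \<le> e / 4"
    "eventually (\<lambda>n. prob {\<omega>\<in>space M. snd (scaled_pair X a n \<omega>) \<le> \<epsilon>} < e / 4) sequentially"
    using snd_small[of "e / 4"] e by auto
  define f where "f z = h (fst z / max (snd z) \<epsilon>)" for z
  have fc: "continuous_on UNIV f" unfolding f_def
  proof (rule continuous_on_compose2[OF h(1)])
    have "max (snd z) \<epsilon> \<noteq> 0" for z :: "real \<times> real" using \<epsilon>(1) by (simp add: max_def)
    then show "continuous_on UNIV (\<lambda>z. fst z / max (snd z) \<epsilon>)" by (intro continuous_intros) blast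
  qed simp
  have fm: "f \<in> borel_measurable borel" using fc by (rule borel_measurable_continuous_onI)
  have fb: "\<bar>f z\<bar> \<le> 1" for z using h(2,3) by (simp add: f_def abs_le_iff add_increasing2)
  have pt: "\<bar>h (fst z / snd z) - f z\<bar> \<le> of_bool (snd z \<le> \<epsilon>)" for z
  proof (cases "snd z \<le> \<epsilon>")
    case True
    have "\<bar>h u - h v\<bar> \<le> 1" for u v using h(2)[of u] h(2)[of v] h(3)[of u] h(3)[of v] by linarith
    then show ?thesis using True by (simp add: f_def)
  next
    case False
    then show ?thesis by (simp add: f_def)
  qed
  have nu_diff: "\<bar>(\<integral>z. h (fst z / snd z) \<partial>\<nu>) - (\<integral>z. f z \<partial>\<nu>)\<bar> \<le> e / 4"
  proof -
    have i1: "integrable \<nu> (\<lambda>z. h (fst z / snd z))" by (rule integrable_nu[where B = 1]) (use h(2,3) in \<open>auto simp: abs_le_iff add_increasing2\<close>)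
    have i2: "integrable \<nu> f" by (rule integrable_nu[OF fm fb])
    have i3: "integrable \<nu> (\<lambda>z. of_bool (snd z \<le> \<epsilon>) :: real)" by (rule integrable_nu[where B = 1]) auto
    have "\<bar>(\<integral>z. h (fst z / snd z) \<partial>\<nu>) - (\<integral>z. f z \<partial>\<nu>)\<bar> = \<bar>\<integral>z. h (fst z / snd z) - f z \<partial>\<nu>\<bar>" using i1 i2 by simp
    also have "\<dots> \<le> (\<integral>z. \<bar>h (fst z / snd z) - f z\<bar> \<partial>\<nu>)" by simp
    also have "\<dots> \<le> (\<integral>z. of_bool (snd z \<le> \<epsilon>) \<partial>\<nu>)" using i1 i2 i3 pt by (intro integral_mono) auto
    also have "\<dots> = (\<integral>z. indicator {z. snd z \<le> \<epsilon>} z \<partial>\<nu>)" by (intro Bochner_Integration.integral_cong) (auto simp: indicator_def)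
    also have "\<dots> = measure \<nu> {z. snd z \<le> \<epsilon>}" by simp
    finally show ?thesis using \<epsilon> by simp
  qed
  have ev: "eventually (\<lambda>n. \<bar>expectation (\<lambda>\<omega>. f (scaled_pair X a n \<omega>)) - (\<integral>z. f z \<partial>\<nu>)\<bar> < e / 4) sequentially"
    using tendstoD[OF conv_integral[OF fc fb], of "e / 4"] e by (simp add: dist_real_def)
  show "eventually (\<lambda>n. dist (expectation (\<lambda>\<omega>. h (Tstat X n \<omega>))) (\<integral>z. h (fst z / snd z) \<partial>\<nu>) < e) sequentially"
    using ev \<epsilon>(3) a_pos
  proof eventually_elim
    case (elim n)
    have i1: "integrable M (\<lambda>\<omega>. h (Tstat X n \<omega>))" by (rule integrable_bounded[where B = 1]) (use h(2,3) in \<open>auto simp: abs_le_iff add_increasing2\<close>)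
    have i2: "integrable M (\<lambda>\<omega>. f (scaled_pair X a n \<omega>))" by (rule integrable_bounded[OF measurable_scaled_pair[OF fm] fb])
    have i3: "integrable M (\<lambda>\<omega>. of_bool (snd (scaled_pair X a n \<omega>) \<le> \<epsilon>) :: real)"
      using measurable_scaled_pair[OF measurable_snd_borel, of n] by (intro integrable_bounded[where B = 1]) auto
    have "\<bar>expectation (\<lambda>\<omega>. h (Tstat X n \<omega>)) - expectation (\<lambda>\<omega>. f (scaled_pair X a n \<omega>))\<bar>
        = \<bar>expectation (\<lambda>\<omega>. h (Tstat X n \<omega>) - f (scaled_pair X a n \<omega>))\<bar>" using i1 i2 by simp
    also have "\<dots> \<le> expectation (\<lambda>\<omega>. \<bar>h (Tstat X n \<omega>) - f (scaled_pair X a n \<omega>)\<bar>)" by simp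
    also have "\<dots> \<le> expectation (\<lambda>\<omega>. of_bool (snd (scaled_pair X a n \<omega>) \<le> \<epsilon>))"
      using i1 i2 i3 pt by (intro integral_mono) (auto simp: Tstat_eq_ratio[OF elim(3)])
    also have "\<dots> = prob {\<omega>\<in>space M. snd (scaled_pair X a n \<omega>) \<le> \<epsilon>}" by (simp add: expectation_of_bool)
    finally show ?case using elim nu_diff unfolding dist_real_def by linarith
  qed
qed

definition ratio_law :: "real measure" where "ratio_law = distr \<nu> borel (\<lambda>z. fst z / snd z)"

lemma real_distribution_ratio_law: "real_distribution ratio_law"
  unfolding ratio_law_def by (rule nu.real_distribution_distr) measurable

lemma cdf_ratio_law: "cdf ratio_law = ratio_cdf \<nu>"
  unfolding ratio_law_def cdf_def ratio_cdf_def fun_eq_iff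
  by (auto simp: measure_distr intro!: arg_cong[where f = "measure \<nu>"])

lemma Tstat_conv_cdf:
  assumes "isCont (ratio_cdf \<nu>) x"
  shows "(\<lambda>n. prob {\<omega>\<in>space M. Tstat X n \<omega> \<le> x}) \<longlonglongrightarrow> ratio_cdf \<nu> x"
proof -
  interpret R: real_distribution ratio_law by (rule real_distribution_ratio_law)
  have "weak_conv_m (\<lambda>n. distr M borel (Tstat X n)) ratio_law"
  proof (rule integral_cts_step_conv_imp_weak_conv)
    show "real_distribution (distr M borel (Tstat X n))" for n by (rule real_distribution_distr) measurable
    show "real_distribution ratio_law" by (rule real_distribution_ratio_law)
    fix u v :: real assume uv: "u < v"
    have c: "continuous_on UNIV (cts_step u v)" using cts_step_uniformly_continuous[OF uv] by (rule uniformly_continuous_imp_continuous)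
    have m: "cts_step u v \<in> borel_measurable borel" using c by (rule borel_measurable_continuous_onI)
    have "(\<lambda>n. expectation (\<lambda>\<omega>. cts_step u v (Tstat X n \<omega>))) \<longlonglongrightarrow> (\<integral>z. cts_step u v (fst z / snd z) \<partial>\<nu>)"
      by (rule Tstat_conv_integral[OF c]) (use uv in \<open>auto simp: cts_step_def\<close>)
    then show "(\<lambda>n. integral\<^sup>L (distr M borel (Tstat X n)) (cts_step u v)) \<longlonglongrightarrow> integral\<^sup>L ratio_law (cts_step u v)"
      unfolding ratio_law_def using m by (simp add: integral_distr)
  qed
  then have "(\<lambda>n. cdf (distr M borel (Tstat X n)) x) \<longlonglongrightarrow> ratio_cdf \<nu> x"
    using assms unfolding weak_conv_m_def weak_conv_def cdf_ratio_law by blast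
  moreover have "cdf (distr M borel (Tstat X n)) x = prob {\<omega>\<in>space M. Tstat X n \<omega> \<le> x}" for n
    by (auto simp: cdf_def measure_distr intro!: arg_cong[where f = prob])
  ultimately show ?thesis by simp
qed

end

section \<open>Support of the limiting ratio and its quantiles\<close>

context heavy_tailed_limit
begin

text \<open>A union bound over k fixed positions: each exceeds \<theta> a n with probability of
  order 1 / n.\<close>

lemma small_gap:
  assumes "\<theta> > 0"
  shows "(\<lambda>n. prob {\<omega>\<in>space M. \<exists>t\<in>{int (m n) + 1..int (m n) + int k}. \<bar>X t \<omega>\<bar> > \<theta> * a n}) \<longlonglongrightarrow> 0"
proof -
  have "(\<lambda>n. (real n * tail (\<theta> * a n)) * (real k / real n)) \<longlonglongrightarrow> \<theta> powr - \<kappa> * 0"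
    by (intro tendsto_mult n_tail_scaled_a assms lim_const_over_n)
  then have lim: "(\<lambda>n. (real n * tail (\<theta> * a n)) * (real k / real n)) \<longlonglongrightarrow> 0" by simp
  show ?thesis
  proof (rule tendsto_sandwich[OF _ _ tendsto_const lim])
    show "eventually (\<lambda>n. prob {\<omega>\<in>space M. \<exists>t\<in>{int (m n) + 1..int (m n) + int k}. \<bar>X t \<omega>\<bar> > \<theta> * a n}
       \<le> (real n * tail (\<theta> * a n)) * (real k / real n)) sequentially"
      using eventually_gt_at_top[of 0]
    proof eventually_elim
      case (elim n)
      have "{\<omega>\<in>space M. \<exists>t\<in>{int (m n) + 1..int (m n) + int k}. \<bar>X t \<omega>\<bar> > \<theta> * a n} =
        (\<Union>t\<in>{int (m n) + 1..int (m n) + int k}. {\<omega>\<in>space M. \<bar>X t \<omega>\<bar> > \<theta> * a n})" by auto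
      also have "prob \<dots> \<le> (\<Sum>t\<in>{int (m n) + 1..int (m n) + int k}. prob {\<omega>\<in>space M. \<bar>X t \<omega>\<bar> > \<theta> * a n})"
        by (rule finite_measure_subadditive_finite) auto
      also have "\<dots> = real k * tail (\<theta> * a n)" by (simp add: tail_marginal)
      finally show ?case using elim by (simp add: mult.commute)
    qed
  qed (auto intro!: always_eventually)
qed

text \<open>Splitting the sample at \<rho> n turns two points p, q of the support of the limit into the point
  (\<rho> powr (1/\<kappa>)) p + ((1 - \<rho>) powr (1/\<kappa>)) q (with Euclidean addition of the second components).
  Its ratio moves continuously from that of q to that of p as \<rho> runs through [0,1], so the law of the
  ratio has no gap in its support.\<close>
lemma ratio_law_no_gap:
  assumes x12: "x1 < x2"
    and m1: "measure \<nu> {z. fst z / snd z \<le> x1} > 0" and m2: "measure \<nu> {z. fst z / snd z \<ge> x2} > 0"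
  shows "measure \<nu> {z. x1 < fst z / snd z \<and> fst z / snd z < x2} > 0"
proof -
  \<comment> \<open>Support points are sought where the second coordinate is positive; the remaining
    mass is 0 by \<open>measure_snd_nonpos\<close>.\<close>
  have pick: "\<exists>p\<in>S. snd p > 0 \<and> (\<forall>\<delta>>0. measure \<nu> (ball p \<delta>) > 0)" if S: "S \<in> sets borel" "measure \<nu> S > 0" for S
  proof -
    have "measure \<nu> S \<le> measure \<nu> (S \<inter> {z. snd z > 0} \<union> {z. snd z \<le> 0})"
      using S by (intro nu.finite_measure_mono) auto
    also have "\<dots> \<le> measure \<nu> (S \<inter> {z. snd z > 0}) + measure \<nu> {z. snd z \<le> 0}"
      using S by (intro measure_Un_le) auto
    finally have "measure \<nu> (S \<inter> {z. snd z > 0}) > 0" using S(2) measure_snd_nonpos by simp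
    then obtain p where "p \<in> S \<inter> {z. snd z > 0}" "\<And>\<delta>. \<delta> > 0 \<Longrightarrow> measure \<nu> (ball p \<delta>) > 0"
      using support_point[OF nu.prob_space_axioms sets_nu, of "S \<inter> {z. snd z > 0}"] S(1) by auto
    then show ?thesis by auto
  qed
  obtain p where p: "fst p / snd p \<le> x1" "snd p > 0" "\<And>\<delta>. \<delta> > 0 \<Longrightarrow> measure \<nu> (ball p \<delta>) > 0"
    using pick[OF _ m1] by auto
  obtain q where q: "fst q / snd q \<ge> x2" "snd q > 0" "\<And>\<delta>. \<delta> > 0 \<Longrightarrow> measure \<nu> (ball q \<delta>) > 0"
    using pick[OF _ m2] by auto
  define mid where "mid = (x1 + x2) / 2"
  define D where "D = (x2 - x1) / 2"
  have D: "D > 0" using x12 by (simp add: D_def)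
  \<comment> \<open>The statistic of a split sample: c and c' are quotients of norming constants, w
    and w' the scaled pairs of the two parts, u and v the scaled sum and sum of squares over the
    gap.\<close>
  define \<Phi> :: "real \<times> real \<times> (real \<times> real) \<times> (real \<times> real) \<times> real \<times> real \<Rightarrow> real" where
    "\<Phi> = (\<lambda>(c, c', w, w', u, v). (c * fst w + c' * fst w' + u) / sqrt ((c * snd w)\<^sup>2 + (c' * snd w')\<^sup>2 + v))"
  define g where "g \<rho> = \<Phi> (\<rho> powr (1/\<kappa>), (1 - \<rho>) powr (1/\<kappa>), p, q, 0, 0)" for \<rho>
  have denom: "0 < (c * snd p)\<^sup>2 + (c' * snd q)\<^sup>2" if "c \<noteq> 0 \<or> c' \<noteq> 0" for c c'
    using that p(2) q(2) by (auto simp: sum_power2_gt_zero_iff)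
  have nonzero: "\<forall>x\<in>{0..1}. sqrt ((x powr (1 / \<kappa>) * snd p)\<^sup>2 + ((1 - x) powr (1 / \<kappa>) * snd q)\<^sup>2) \<noteq> 0"
  proof
    fix x :: real assume "x \<in> {0..1}"
    then have "x powr (1/\<kappa>) \<noteq> 0 \<or> (1 - x) powr (1/\<kappa>) \<noteq> 0" by auto
    from denom[OF this] show "sqrt ((x powr (1 / \<kappa>) * snd p)\<^sup>2 + ((1 - x) powr (1 / \<kappa>) * snd q)\<^sup>2) \<noteq> 0"
      unfolding real_sqrt_eq_zero_cancel_iff by linarith
  qed
  have powr_cont: "continuous_on {0..1} (\<lambda>x. x powr (1/\<kappa>))" "continuous_on {0..1} (\<lambda>x. (1 - x) powr (1/\<kappa>))"
    by (intro continuous_on_powr' continuous_intros; use kappa in force)+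
  have "continuous_on {0..1} g"
    unfolding g_def \<Phi>_def prod.case add_0_right
    by (intro continuous_on_divide continuous_on_add continuous_on_mult continuous_on_real_sqrt continuous_on_power
        continuous_on_const powr_cont nonzero)
  moreover have g1: "g 1 \<le> x1" using p kappa by (simp add: g_def \<Phi>_def)
  moreover have g0: "x2 \<le> g 0" using q kappa by (simp add: g_def \<Phi>_def)
  \<comment> \<open>Intermediate value theorem at the midpoint: for \<rho> = 1 only p contributes,
    for \<rho> = 0 only q.\<close>
  ultimately obtain \<rho> where \<rho>: "0 \<le> \<rho>" "\<rho> \<le> 1" "g \<rho> = mid"
    using IVT2'[of g 1 mid 0] x12 by (auto simp: mid_def)
  have \<rho>01: "0 < \<rho>" "\<rho> < 1" using \<rho> g0 g1 x12 by (auto simp: mid_def less_le)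
  define C1 where "C1 = \<rho> powr (1/\<kappa>)"
  define C2 where "C2 = (1 - \<rho>) powr (1/\<kappa>)"
  have C: "C1 > 0" "C2 > 0" using \<rho>01 by (auto simp: C1_def C2_def)
  define z0 where "z0 = (C1, C2, p, q, 0::real, 0::real)"
  have \<Phi>z0: "\<Phi> z0 = mid" using \<rho>(3) by (simp add: g_def z0_def C1_def C2_def)
  have "isCont \<Phi> z0"
  proof -
    have "isCont (\<lambda>z. (fst z * fst (fst (snd (snd z))) + fst (snd z) * fst (fst (snd (snd (snd z)))) + fst (snd (snd (snd (snd z))))) /
       sqrt ((fst z * snd (fst (snd (snd z))))\<^sup>2 + (fst (snd z) * snd (fst (snd (snd (snd z)))))\<^sup>2 + snd (snd (snd (snd (snd z)))))) z0"
      using denom[of C1 C2] C by (intro continuous_intros) (auto simp: z0_def)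
    then show ?thesis unfolding \<Phi>_def case_prod_beta' .
  qed
  then obtain \<delta> where \<delta>: "\<delta> > 0" "\<And>z. dist z z0 < \<delta> \<Longrightarrow> \<bar>\<Phi> z - mid\<bar> < D / 2"
    using D \<Phi>z0 unfolding continuous_at_eps_delta dist_real_def by (metis half_gt_zero)
  \<comment> \<open>The distance to \<open>z0\<close> is at most the sum of six coordinate
    distances.\<close>
  define \<delta>' where "\<delta>' = \<delta> / 6"
  have \<delta>': "\<delta>' > 0" using \<delta> by (simp add: \<delta>'_def)
  have close: "\<bar>\<Phi> (c, c', w, w', u, v) - mid\<bar> < D / 2"
    if "\<bar>c - C1\<bar> < \<delta>'" "\<bar>c' - C2\<bar> < \<delta>'" "dist w p < \<delta>'" "dist w' q < \<delta>'" "\<bar>u\<bar> < \<delta>'" "\<bar>v\<bar> < \<delta>'" for c c' w w' u v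
  proof (rule \<delta>(2))
    have "dist (c, c', w, w', u, v) z0 \<le> dist c C1 + (dist c' C2 + (dist w p + (dist w' q + (dist u 0 + dist v 0))))"
      unfolding z0_def by (intro order_trans[OF dist_Pair_le] add_left_mono order_refl)
    also have "\<dots> < \<delta>" using that by (simp add: dist_real_def \<delta>'_def)
    finally show "dist (c, c', w, w', u, v) z0 < \<delta>" .
  qed
  define I1 where "I1 = (\<integral>z. bump p \<delta>' z \<partial>\<nu>)"
  define I2 where "I2 = (\<integral>z. bump q \<delta>' z \<partial>\<nu>)"
  have bump_m [measurable]: "bump r \<delta>' \<in> borel_measurable borel" for r :: "real \<times> real"
    using continuous_bump by (rule borel_measurable_continuous_onI)
  have bump_abs: "\<bar>bump r \<delta>' z\<bar> \<le> 1" for r z :: "real \<times> real" using bump_bounds(1,2)[OF \<delta>', of r z] by simp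
  have Ipos: "(\<integral>z. bump r \<delta>' z \<partial>\<nu>) > 0" if "\<And>\<delta>. \<delta> > 0 \<Longrightarrow> measure \<nu> (ball r \<delta>) > 0" for r
  proof -
    have "0 < 1/2 * measure \<nu> (ball r (\<delta>' / 2))" using that \<delta>' by simp
    also have "\<dots> = (\<integral>z. 1/2 * indicator (ball r (\<delta>' / 2)) z \<partial>\<nu>)" by simp
    also have "\<dots> \<le> (\<integral>z. bump r \<delta>' z \<partial>\<nu>)"
    proof (rule integral_mono)
      show "integrable \<nu> (\<lambda>z. 1/2 * indicator (ball r (\<delta>' / 2)) z :: real)"
        by (rule integrable_nu[where B = 1]) (auto simp: indicator_def)
      show "integrable \<nu> (bump r \<delta>')" by (rule integrable_nu[OF bump_m bump_abs])
      show "1/2 * indicator (ball r (\<delta>' / 2)) z \<le> bump r \<delta>' z" for z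
        using \<delta>' by (auto simp: indicator_def bump_def dist_commute field_simps max_def)
    qed
    finally show ?thesis .
  qed
  have I: "I1 > 0" "I2 > 0" unfolding I1_def I2_def using Ipos p(3) q(3) by auto
  \<comment> \<open>The two parts lie near p and q with asymptotic weights I1 and I2; a mixing error
    below half their product preserves a positive joint weight.\<close>
  have "eventually (\<lambda>k. alpha k < I1 * I2 / 2) sequentially" using alpha_tendsto_0 I by (intro order_tendstoD) auto
  then obtain k where k: "alpha k < I1 * I2 / 2" by (auto simp: eventually_sequentially)
  define m where "m n = nat \<lfloor>\<rho> * real n\<rfloor>" for n
  define m' where "m' n = n - m n - k" for n
  have mr: "(\<lambda>n. real (m n) / real n) \<longlonglongrightarrow> \<rho>" unfolding m_def using tendsto_floor_scaled[of \<rho> 0] \<rho> by simp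
  have "(\<lambda>n. 1 - real (m n) / real n - real k / real n) \<longlonglongrightarrow> 1 - \<rho> - 0"
    by (intro tendsto_intros mr lim_const_over_n)
  then have mk: "(\<lambda>n. 1 - real (m n) / real n - real k / real n) \<longlonglongrightarrow> 1 - \<rho>" by simp
  have fit: "eventually (\<lambda>n. m n + k + m' n = n) sequentially"
  proof -
    have "0 < 1 - \<rho>" using \<rho>01 by simp
    from order_tendstoD(1)[OF mk this] eventually_gt_at_top[of 0] show ?thesis
    proof eventually_elim
      case (elim n)
      have "(real (m n) + real k) / real n < 1" using elim by (simp add: add_divide_distrib)
      then have "real (m n) + real k < real n" using elim by (simp add: pos_divide_less_eq)
      then show "m n + k + m' n = n" unfolding m'_def by linarith
    qed
  qed
  have m'r: "(\<lambda>n. real (m' n) / real n) \<longlonglongrightarrow> 1 - \<rho>"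
  proof (rule Lim_transform_eventually[OF mk])
    show "eventually (\<lambda>n. 1 - real (m n) / real n - real k / real n = real (m' n) / real n) sequentially"
      using fit eventually_gt_at_top[of 0]
    proof eventually_elim
      case (elim n)
      have "real (m' n) = real n - real (m n) - real k" using arg_cong[OF elim(1), of real] by simp
      then show ?case using elim(2) by (simp add: diff_divide_distrib)
    qed
  qed
  have mt: "filterlim m at_top sequentially" by (rule filterlim_at_top_of_ratio[OF mr]) (use \<rho>01 in simp)
  have m't: "filterlim m' at_top sequentially" by (rule filterlim_at_top_of_ratio[OF m'r]) (use \<rho>01 in simp)
  have c1: "(\<lambda>n. a (m n) / a n) \<longlonglongrightarrow> C1" unfolding C1_def by (rule a_ratio[OF mt mr]) (use \<rho>01 in simp)
  have c2: "(\<lambda>n. a (m' n) / a n) \<longlonglongrightarrow> C2" unfolding C2_def by (rule a_ratio[OF m't m'r]) (use \<rho>01 in simp)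
  \<comment> \<open>The bound on the observations in the gap must make both their sum and their sum
    of squares smaller than \<delta>'; \<theta> <= 1 allows \<theta>^2 <= \<theta> for the
    squares.\<close>
  define \<theta> where "\<theta> = min 1 \<delta>' / (2 * (real k + 1))"
  have \<theta>: "\<theta> > 0" "real k * \<theta> < \<delta>'" "\<theta> \<le> 1"
  proof -
    show "\<theta> > 0" using \<delta>' by (simp add: \<theta>_def)
    have "real k * min 1 \<delta>' \<le> real k * \<delta>'" by (intro mult_left_mono) auto
    also have "\<dots> < \<delta>' * (2 * (real k + 1))" using \<delta>' by (simp add: algebra_simps add_nonneg_pos)
    finally show "real k * \<theta> < \<delta>'" by (simp add: \<theta>_def field_simps)
    show "\<theta> \<le> 1" by (simp add: \<theta>_def divide_le_eq_1)
  qed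
  define Gap where "Gap n = {\<omega>\<in>space M. \<exists>t\<in>{int (m n) + 1..int (m n) + int k}. \<bar>X t \<omega>\<bar> > \<theta> * a n}" for n
  have gap0: "(\<lambda>n. prob (Gap n)) \<longlonglongrightarrow> 0" unfolding Gap_def by (rule small_gap[OF \<theta>(1)])
  have Gap_m [measurable]: "Gap n \<in> sets M" for n unfolding Gap_def by measurable
  \<comment> \<open>A plateau at the midpoint: 1 within D / 2 of it, 0 outside the open interval
    from x1 to x2.\<close>
  define h where "h y = max 0 (min 1 (2 - 2 * \<bar>y - mid\<bar> / D))" for y
  have hc: "continuous_on UNIV h" unfolding h_def divide_inverse by (intro continuous_intros)
  have hm [measurable]: "h \<in> borel_measurable borel" using hc by (rule borel_measurable_continuous_onI)
  have hb: "0 \<le> h y" "h y \<le> 1" for y by (auto simp: h_def)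
  have habs: "\<bar>h y\<bar> \<le> 1" for y using hb[of y] by simp
  have h1: "h y = 1" if "\<bar>y - mid\<bar> < D / 2" for y using that D by (simp add: h_def field_simps)
  define w where "w n \<omega> = pair_path (a (m n)) {1..int (m n)} (\<lambda>t. X t \<omega>)" for n \<omega>
  define w' where "w' n \<omega> = pair_path (a (m' n)) {int (m n + k) + 1..int (m n + k) + int (m' n)} (\<lambda>t. X t \<omega>)" for n \<omega>
  have Ew: "(\<lambda>n. expectation (\<lambda>\<omega>. bump p \<delta>' (w n \<omega>))) \<longlonglongrightarrow> I1"
    using filterlim_compose[OF conv_integral[OF continuous_bump bump_abs] mt, of p]
    by (simp add: w_def I1_def scaled_pair_eq_path)
  have Ew': "(\<lambda>n. expectation (\<lambda>\<omega>. bump q \<delta>' (w' n \<omega>))) \<longlonglongrightarrow> I2"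
  proof -
    have "expectation (\<lambda>\<omega>. bump q \<delta>' (w' n \<omega>)) = expectation (\<lambda>\<omega>. bump q \<delta>' (scaled_pair X a (m' n) \<omega>))" for n
      unfolding w'_def pair_path_shift scaled_pair_eq_path
      by (rule expectation_shift[where I = "{1..int (m' n)}" and g = "\<lambda>x. bump q \<delta>' (pair_path (a (m' n)) {1..int (m' n)} x)"])
         (auto intro!: cylinder_pair_path)
    then show ?thesis
      using filterlim_compose[OF conv_integral[OF continuous_bump bump_abs] m't, of q] by (simp add: I2_def)
  qed
  have wm: "(\<lambda>\<omega>. bump p \<delta>' (w n \<omega>)) \<in> borel_measurable M" for n
    unfolding w_def by (rule measurable_cylinder0[OF cylinder_pair_path]) simp
  have w'm: "(\<lambda>\<omega>. bump q \<delta>' (w' n \<omega>)) \<in> borel_measurable M" for n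
    unfolding w'_def by (rule measurable_cylinder0[OF cylinder_pair_path]) simp
  have low: "eventually (\<lambda>n. expectation (\<lambda>\<omega>. bump p \<delta>' (w n \<omega>)) * expectation (\<lambda>\<omega>. bump q \<delta>' (w' n \<omega>)) - alpha k - prob (Gap n)
     \<le> expectation (\<lambda>\<omega>. h (Tstat X n \<omega>))) sequentially"
    using fit a_pos tendstoD[OF c1 \<delta>'] tendstoD[OF c2 \<delta>'] filterlim_iff[THEN iffD1, OF mt, rule_format, OF a_pos]
      filterlim_iff[THEN iffD1, OF m't, rule_format, OF a_pos]
  proof eventually_elim
    case (elim n)
    have mix: "\<bar>cov M (\<lambda>\<omega>. bump p \<delta>' (w n \<omega>)) (\<lambda>\<omega>. bump q \<delta>' (w' n \<omega>))\<bar> \<le> alpha k"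
      unfolding w_def w'_def
      by (rule abs_cov_cylinder_le1[where s = "int (m n)" and I = "{1..int (m n)}" and J = "{int (m n + k) + 1..int (m n + k) + int (m' n)}"
            and f = "\<lambda>x. bump p \<delta>' (pair_path (a (m n)) {1..int (m n)} x)"
            and g = "\<lambda>x. bump q \<delta>' (pair_path (a (m' n)) {int (m n + k) + 1..int (m n + k) + int (m' n)} x)"])
         (use bump_abs in \<open>auto intro!: cylinder_pair_path\<close>)
    \<comment> \<open>The product of tents vanishes unless both parts are close to p and q. If they
      are and the gap contains no large value, \<open>close\<close> puts the statistic within D / 2
      of the midpoint, where h is 1.\<close>
    have pt: "bump p \<delta>' (w n \<omega>) * bump q \<delta>' (w' n \<omega>) - indicator (Gap n) \<omega> \<le> h (Tstat X n \<omega>)" if \<omega>: "\<omega> \<in> space M" for \<omega>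
    proof (cases "\<omega> \<in> Gap n \<or> dist (w n \<omega>) p \<ge> \<delta>' \<or> dist (w' n \<omega>) q \<ge> \<delta>'")
      case True
      have "bump p \<delta>' (w n \<omega>) * bump q \<delta>' (w' n \<omega>) \<le> indicator (Gap n) \<omega>"
        using True by (auto simp: bump_bounds(3)[OF \<delta>'] intro!: mult_le_one bump_bounds(1,2)[OF \<delta>'])
      then show ?thesis using hb(1)[of "Tstat X n \<omega>"] by linarith
    next
      case False
      define u where "u = (\<Sum>t\<in>{int (m n) + 1..int (m n) + int k}. X t \<omega>) / a n"
      define v where "v = (\<Sum>t\<in>{int (m n) + 1..int (m n) + int k}. (X t \<omega>)\<^sup>2) / (a n)\<^sup>2"
      have Xs: "\<bar>X t \<omega>\<bar> / a n \<le> \<theta>" if "t \<in> {int (m n) + 1..int (m n) + int k}" for t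
      proof -
        have "\<bar>X t \<omega>\<bar> \<le> \<theta> * a n" using False \<omega> that by (auto simp: Gap_def not_less)
        then show ?thesis using elim by (simp add: pos_divide_le_eq)
      qed
      have "\<bar>u\<bar> \<le> (\<Sum>t\<in>{int (m n) + 1..int (m n) + int k}. \<bar>X t \<omega>\<bar> / a n)"
        using elim by (simp add: u_def abs_divide sum_divide_distrib[symmetric] divide_right_mono)
      also have "\<dots> \<le> (\<Sum>t\<in>{int (m n) + 1..int (m n) + int k}. \<theta>)" by (intro sum_mono Xs)
      also have "\<dots> < \<delta>'" using \<theta> by simp
      finally have u: "\<bar>u\<bar> < \<delta>'" .
      have "v = (\<Sum>t\<in>{int (m n) + 1..int (m n) + int k}. (\<bar>X t \<omega>\<bar> / a n)\<^sup>2)"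
        by (simp add: v_def sum_divide_distrib power_divide)
      also have "\<dots> \<le> (\<Sum>t\<in>{int (m n) + 1..int (m n) + int k}. \<theta>)"
      proof (intro sum_mono)
        fix t assume "t \<in> {int (m n) + 1..int (m n) + int k}"
        then have "(\<bar>X t \<omega>\<bar> / a n)\<^sup>2 \<le> \<theta>\<^sup>2" using Xs elim by (intro power_mono) auto
        also have "\<dots> \<le> \<theta>" using \<theta> by (simp add: power2_eq_square mult_left_le)
        finally show "(\<bar>X t \<omega>\<bar> / a n)\<^sup>2 \<le> \<theta>" .
      qed
      also have "\<dots> < \<delta>'" using \<theta> by simp
      finally have v: "\<bar>v\<bar> < \<delta>'" using elim by (simp add: v_def sum_nonneg)
      let ?B1 = "{1..int (m n)}" and ?G = "{int (m n) + 1..int (m n) + int k}" and ?B2 = "{int (m n + k) + 1..int (m n + k) + int (m' n)}"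
      have split: "(\<Sum>t=1..n. f (int t)) = (\<Sum>t\<in>?B1. f t) + (\<Sum>t\<in>?G. f t) + (\<Sum>t\<in>?B2. f t)" for f :: "int \<Rightarrow> real"
      proof -
        have n: "int n = int (m n + k) + int (m' n)" using elim(1) by linarith
        have "{1..int n} = (?B1 \<union> ?G) \<union> ?B2" unfolding n by auto
        moreover have "(\<Sum>t\<in>(?B1 \<union> ?G) \<union> ?B2. f t) = (\<Sum>t\<in>?B1. f t) + (\<Sum>t\<in>?G. f t) + (\<Sum>t\<in>?B2. f t)"
          by (subst sum.union_disjoint, force, force, force, subst sum.union_disjoint) auto
        ultimately show ?thesis unfolding sum_int_atLeastAtMost by simp
      qed
      let ?c = "a (m n) / a n" and ?c' = "a (m' n) / a n"
      have T: "Tstat X n \<omega> = \<Phi> (?c, ?c', w n \<omega>, w' n \<omega>, u, v)"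
      proof -
        let ?S = "\<lambda>A. \<Sum>t\<in>A. X t \<omega>" and ?Q = "\<lambda>A. \<Sum>t\<in>A. (X t \<omega>)\<^sup>2"
        have Q0: "?Q A \<ge> 0" for A by (simp add: sum_nonneg)
        have num: "?c * fst (w n \<omega>) + ?c' * fst (w' n \<omega>) + u = (?S ?B1 + ?S ?G + ?S ?B2) / a n"
          using elim by (simp add: w_def w'_def pair_path_def u_def add_divide_distrib)
        have den: "(?c * snd (w n \<omega>))\<^sup>2 + (?c' * snd (w' n \<omega>))\<^sup>2 + v = (?Q ?B1 + ?Q ?G + ?Q ?B2) / (a n)\<^sup>2"
          using elim Q0 by (simp add: w_def w'_def pair_path_def v_def add_divide_distrib power_divide power_mult_distrib)
        show ?thesis
          unfolding Tstat_def split[of "\<lambda>t. X t \<omega>"] split[of "\<lambda>t. (X t \<omega>)\<^sup>2"] \<Phi>_def prod.case num den using elim by (simp add: real_sqrt_divide)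
      qed
      have "\<bar>Tstat X n \<omega> - mid\<bar> < D / 2" unfolding T
        by (rule close) (use elim False u v in \<open>auto simp: dist_real_def not_le\<close>)
      then have "h (Tstat X n \<omega>) = 1" by (rule h1)
      moreover have "bump p \<delta>' (w n \<omega>) * bump q \<delta>' (w' n \<omega>) \<le> 1"
        by (intro mult_le_one bump_bounds(1,2)[OF \<delta>'])
      ultimately show ?thesis by (simp add: indicator_def)
    qed
    have iB: "integrable M (\<lambda>\<omega>. bump p \<delta>' (w n \<omega>) * bump q \<delta>' (w' n \<omega>))"
      using wm w'm by (intro integrable_bounded[where B = 1]) (auto simp: abs_mult intro!: mult_le_one bump_abs)
    have iG: "integrable M (indicator (Gap n) :: 'a \<Rightarrow> real)"
      by (rule integrable_bounded[where B = 1]) (auto simp: indicator_def)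
    have ih: "integrable M (\<lambda>\<omega>. h (Tstat X n \<omega>))" by (rule integrable_bounded[where B = 1]) (use habs in auto)
    have "expectation (\<lambda>\<omega>. bump p \<delta>' (w n \<omega>) * bump q \<delta>' (w' n \<omega>)) - prob (Gap n)
      = expectation (\<lambda>\<omega>. bump p \<delta>' (w n \<omega>) * bump q \<delta>' (w' n \<omega>) - indicator (Gap n) \<omega>)"
      using iB iG sets.sets_into_space[OF Gap_m[of n]] by (simp add: Int_absorb2)
    also have "\<dots> \<le> expectation (\<lambda>\<omega>. h (Tstat X n \<omega>))"
      using iB iG ih pt by (intro integral_mono) auto
    finally show ?case using mix unfolding cov_def by linarith
  qed
  have "(\<lambda>n. expectation (\<lambda>\<omega>. bump p \<delta>' (w n \<omega>)) * expectation (\<lambda>\<omega>. bump q \<delta>' (w' n \<omega>)) - alpha k - prob (Gap n)) \<longlonglongrightarrow> I1 * I2 - alpha k - 0"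
    by (intro tendsto_intros Ew Ew' gap0)
  from tendsto_le[OF _ Tstat_conv_integral[OF hc hb] this low]
  have "I1 * I2 - alpha k - 0 \<le> (\<integral>z. h (fst z / snd z) \<partial>\<nu>)" by simp
  then have "0 < (\<integral>z. h (fst z / snd z) \<partial>\<nu>)" using k mult_pos_pos[OF I] by linarith
  also have "\<dots> \<le> (\<integral>z. indicator {z. x1 < fst z / snd z \<and> fst z / snd z < x2} z \<partial>\<nu>)"
  proof (rule integral_mono)
    show "integrable \<nu> (\<lambda>z. h (fst z / snd z))" by (rule integrable_nu[where B = 1]) (use habs in auto)
    show "integrable \<nu> (indicator {z. x1 < fst z / snd z \<and> fst z / snd z < x2} :: real \<times> real \<Rightarrow> real)"
      by (rule integrable_nu[where B = 1]) (auto simp: indicator_def)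
    fix z :: "real \<times> real"
    have "h y = 0" if "y \<le> x1 \<or> y \<ge> x2" for y
    proof -
      have "D \<le> \<bar>y - mid\<bar>" using that x12 by (auto simp: D_def mid_def abs_if field_simps)
      then show ?thesis using D by (simp add: h_def field_simps)
    qed
    then show "h (fst z / snd z) \<le> indicator {z. x1 < fst z / snd z \<and> fst z / snd z < x2} z"
      using hb by (auto simp: indicator_def not_less)
  qed
  also have "\<dots> = measure \<nu> {z. x1 < fst z / snd z \<and> fst z / snd z < x2}" by simp
  finally show ?thesis .
qed

text \<open>Left of the quantile the inequality is the infimum property. To the right, F x = y would
  mean that the ratio puts no mass between the quantile and x, against
  \<open>ratio_law_no_gap\<close>.\<close>

lemma ratio_quantile_properties:
  assumes y: "0 < y" "y < 1" and cont: "isCont (ratio_cdf \<nu>) (ratio_quantile \<nu> y)"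
  shows "x < ratio_quantile \<nu> y \<Longrightarrow> ratio_cdf \<nu> x < y" and "ratio_quantile \<nu> y < x \<Longrightarrow> y < ratio_cdf \<nu> x"
proof -
  interpret R: real_distribution ratio_law by (rule real_distribution_ratio_law)
  let ?F = "ratio_cdf \<nu>" and ?c = "ratio_quantile \<nu> y"
  have mono: "?F u \<le> ?F v" if "u \<le> v" for u v using R.cdf_nondecreasing[OF that] by (simp add: cdf_ratio_law)
  have "eventually (\<lambda>x. ?F x > y) at_top"
    using R.cdf_lim_at_top_prob y by (intro order_tendstoD) (auto simp: cdf_ratio_law)
  then obtain u where u: "?F u > y" by (auto simp: eventually_at_top_linorder)
  have "eventually (\<lambda>x. ?F x < y) at_bot"
    using R.cdf_lim_at_bot y by (intro order_tendstoD) (auto simp: cdf_ratio_law)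
  then obtain l where l: "\<And>x. x \<le> l \<Longrightarrow> ?F x < y" by (auto simp: eventually_at_bot_linorder)
  have bdd: "bdd_below {x. y \<le> ?F x}" 
  proof (rule bdd_belowI[of _ l])
    fix x assume "x \<in> {x. y \<le> ?F x}"
    then show "l \<le> x" using l[of x] by (cases "l \<le> x") auto
  qed
  have ne: "{x. y \<le> ?F x} \<noteq> {}" using u by (auto intro: less_imp_le)
  have below: "?F x < y" if "x < ?c" for x
  proof (rule ccontr)
    assume "\<not> ?F x < y"
    then have "?c \<le> x" unfolding ratio_quantile_def by (intro cInf_lower bdd) auto
    then show False using that by simp
  qed
  have above: "y \<le> ?F x" if cx: "?c < x" for x
  proof -
    obtain z where "y \<le> ?F z" "z < x"
      using cx unfolding ratio_quantile_def by (auto dest!: cInf_lessD[OF ne])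
    then show ?thesis using mono[of z x] by simp
  qed
  have left: "(?F \<longlongrightarrow> ?F ?c) (at_left ?c)" and right: "(?F \<longlongrightarrow> ?F ?c) (at_right ?c)"
    using cont by (auto simp: isCont_def filterlim_at_split)
  have "?F ?c \<le> y" by (rule tendsto_upperbound[OF left]) (auto simp: eventually_at_filter intro!: always_eventually less_imp_le below)
  moreover have "y \<le> ?F ?c" by (rule tendsto_lowerbound[OF right]) (auto simp: eventually_at_filter intro!: always_eventually above)
  ultimately have Fc: "?F ?c = y" by simp
  show "x < ?c \<Longrightarrow> ?F x < y" by (rule below)
  show "y < ?F x" if cx: "?c < x"
  proof (rule ccontr)
    assume "\<not> y < ?F x"
    then have Fx: "?F x = y" using above[OF cx] by simp
    have [measurable]: "(\<lambda>z::real \<times> real. fst z / snd z) \<in> borel_measurable borel" by measurable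
    have "measure \<nu> {z. fst z / snd z \<ge> x} > 0"
    proof -
      have "{z. fst z / snd z > x} = space \<nu> - {z. fst z / snd z \<le> x}" by auto
      then have "measure \<nu> {z. fst z / snd z > x} = 1 - y" using nu.prob_compl[of "{z. fst z / snd z \<le> x}"] Fx by (simp add: ratio_cdf_def)
      moreover have "measure \<nu> {z. fst z / snd z > x} \<le> measure \<nu> {z. fst z / snd z \<ge> x}"
        by (intro nu.finite_measure_mono) auto
      ultimately show ?thesis using y by linarith
    qed
    moreover have "measure \<nu> {z. fst z / snd z \<le> ?c} > 0" using Fc y by (simp add: ratio_cdf_def)
    ultimately have pos: "measure \<nu> {z. ?c < fst z / snd z \<and> fst z / snd z < x} > 0" by (intro ratio_law_no_gap cx)
    have "?F ?c + measure \<nu> {z. ?c < fst z / snd z \<and> fst z / snd z < x}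
       = measure \<nu> ({z. fst z / snd z \<le> ?c} \<union> {z. ?c < fst z / snd z \<and> fst z / snd z < x})"
      unfolding ratio_cdf_def by (subst nu.finite_measure_Union) auto
    also have "\<dots> \<le> ?F x" unfolding ratio_cdf_def using cx by (intro nu.finite_measure_mono) auto
    finally show False using pos Fc Fx by simp
  qed
qed

theorem noncover_prob_tendsto_heavy_tailed:
  assumes b: "filterlim b at_top sequentially" "(\<lambda>n. real (b n) / real n) \<longlonglongrightarrow> 0"
    and \<eta>: "0 < \<eta>" "\<eta> < 1"
    and c1: "\<exists>\<delta>>0. \<forall>x\<in>ball (ratio_quantile \<nu> (\<eta>/2)) \<delta>. isCont (ratio_cdf \<nu>) x"
    and c2: "\<exists>\<delta>>0. \<forall>x\<in>ball (ratio_quantile \<nu> (1 - \<eta>/2)) \<delta>. isCont (ratio_cdf \<nu>) x"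
  shows "noncover_prob M X b \<eta> \<longlonglongrightarrow> \<eta>"
proof (rule noncover_prob_tendsto[OF b alpha_tendsto_0 \<eta> Tstat_conv_cdf c1 _ _ c2])
  have "isCont (ratio_cdf \<nu>) (ratio_quantile \<nu> (\<eta>/2))" "isCont (ratio_cdf \<nu>) (ratio_quantile \<nu> (1 - \<eta>/2))"
    using c1 c2 by auto
  note ratio_quantile_properties[OF _ _ this(1)] ratio_quantile_properties[OF _ _ this(2)]
  then show "x < ratio_quantile \<nu> (\<eta>/2) \<Longrightarrow> ratio_cdf \<nu> x < \<eta>/2" "ratio_quantile \<nu> (\<eta>/2) < x \<Longrightarrow> \<eta>/2 < ratio_cdf \<nu> x"
    "x < ratio_quantile \<nu> (1 - \<eta>/2) \<Longrightarrow> ratio_cdf \<nu> x < 1 - \<eta>/2" "ratio_quantile \<nu> (1 - \<eta>/2) < x \<Longrightarrow> 1 - \<eta>/2 < ratio_cdf \<nu> x" for x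
    using \<eta> by auto
qed

end

section \<open>The central limit theorem under fast mixing\<close>

definition clip :: "real \<Rightarrow> real \<Rightarrow> real" where "clip c x = max (- c) (min c x)"

lemma measurable_clip [measurable]: "clip c \<in> borel_measurable borel"
  unfolding clip_def by measurable

lemma abs_clip_le: "c \<ge> 0 \<Longrightarrow> \<bar>clip c x\<bar> \<le> c" by (auto simp: clip_def max_def min_def)

lemma abs_clip_le_abs: "c \<ge> 0 \<Longrightarrow> \<bar>clip c x\<bar> \<le> \<bar>x\<bar>" by (auto simp: clip_def max_def min_def)

lemma abs_diff_clip_le_abs: "c \<ge> 0 \<Longrightarrow> \<bar>x - clip c x\<bar> \<le> \<bar>x\<bar>" by (auto simp: clip_def max_def min_def)

text \<open>The remainder is nonzero only for |x| > c, and there |x|^(r - s) >= c^(r - s), as in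
  Markov's inequality.\<close>

lemma diff_clip_tail:
  assumes c: "c > 0" and s: "s \<ge> 0" "s \<le> r"
  shows "\<bar>x - clip c x\<bar> powr s \<le> \<bar>x\<bar> powr r / c powr (r - s)"
proof (cases "\<bar>x\<bar> \<le> c")
  case True
  then have "x - clip c x = 0" by (auto simp: clip_def)
  then show ?thesis by simp
next
  case False
  have "\<bar>x - clip c x\<bar> powr s \<le> \<bar>x\<bar> powr s"
    using c s abs_diff_clip_le_abs[of c x] by (intro powr_mono2) auto
  moreover have "\<bar>x\<bar> powr s * c powr (r - s) \<le> \<bar>x\<bar> powr s * \<bar>x\<bar> powr (r - s)"
    using c s False by (intro mult_left_mono powr_mono2) auto
  ultimately have "\<bar>x - clip c x\<bar> powr s * c powr (r - s) \<le> \<bar>x\<bar> powr r"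
    using mult_right_mono[of "\<bar>x - clip c x\<bar> powr s" "\<bar>x\<bar> powr s" "c powr (r - s)"] by (simp flip: powr_add)
  then show ?thesis using c by (simp add: pos_le_divide_eq)
qed

lemma (in prob_space) cov_add_left:
  assumes "integrable M (\<lambda>\<omega>. U \<omega> * V \<omega>)" "integrable M (\<lambda>\<omega>. U' \<omega> * V \<omega>)" "integrable M U" "integrable M U'"
  shows "cov M (\<lambda>\<omega>. U \<omega> + U' \<omega>) V = cov M U V + cov M U' V"
  using assms by (simp add: cov_def algebra_simps)

lemma cov_commute: "cov M U V = cov M V U"
  by (simp add: cov_def mult.commute)

lemma (in prob_space) square_product_integrable:
  assumes [measurable]: "U \<in> borel_measurable M" "V \<in> borel_measurable M"
    and "integrable M (\<lambda>\<omega>. (U \<omega>)\<^sup>2)" "integrable M (\<lambda>\<omega>. (V \<omega>)\<^sup>2)"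
  shows "integrable M (\<lambda>\<omega>. U \<omega> * V \<omega> :: real)"
proof (rule Bochner_Integration.integrable_bound[where f = "\<lambda>\<omega>. (U \<omega>)\<^sup>2 + (V \<omega>)\<^sup>2"])
  show "AE \<omega> in M. norm (U \<omega> * V \<omega>) \<le> norm ((U \<omega>)\<^sup>2 + (V \<omega>)\<^sup>2)"
  proof (rule AE_I2)
    fix \<omega>
    have "0 \<le> (\<bar>U \<omega>\<bar> - \<bar>V \<omega>\<bar>)\<^sup>2" by simp
    then have "2 * (\<bar>U \<omega>\<bar> * \<bar>V \<omega>\<bar>) \<le> (U \<omega>)\<^sup>2 + (V \<omega>)\<^sup>2" by (simp add: power2_diff)
    moreover have "0 \<le> \<bar>U \<omega>\<bar> * \<bar>V \<omega>\<bar>" by simp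
    ultimately have "\<bar>U \<omega>\<bar> * \<bar>V \<omega>\<bar> \<le> (U \<omega>)\<^sup>2 + (V \<omega>)\<^sup>2" by linarith
    then show "norm (U \<omega> * V \<omega>) \<le> norm ((U \<omega>)\<^sup>2 + (V \<omega>)\<^sup>2)" by (simp add: abs_mult)
  qed
qed (use assms in auto)

lemma (in prob_space) square_expectation_le:
  fixes U :: "'a \<Rightarrow> real"
  assumes [measurable]: "U \<in> borel_measurable M" and "integrable M (\<lambda>\<omega>. (U \<omega>)\<^sup>2)"
  shows "(expectation U)\<^sup>2 \<le> expectation (\<lambda>\<omega>. (U \<omega>)\<^sup>2)"
  by (rule jensens_inequality[where I = UNIV and q = "\<lambda>x. x\<^sup>2"])
     (use square_integrable_imp_integrable[OF assms] assms in \<open>auto intro!: convex_power2\<close>)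

lemma (in prob_space) abs_cov_le_squares:
  assumes [measurable]: "U \<in> borel_measurable M" "V \<in> borel_measurable M"
    and sq: "integrable M (\<lambda>\<omega>. (U \<omega>)\<^sup>2)" "integrable M (\<lambda>\<omega>. (V \<omega>)\<^sup>2)"
  shows "\<bar>cov M U V\<bar> \<le> expectation (\<lambda>\<omega>. (U \<omega>)\<^sup>2) + expectation (\<lambda>\<omega>. (V \<omega>)\<^sup>2)"
proof -
  have am: "\<bar>x * y\<bar> \<le> (x\<^sup>2 + y\<^sup>2) / 2" for x y :: real
  proof -
    have "0 \<le> (\<bar>x\<bar> - \<bar>y\<bar>)\<^sup>2" by simp
    then show ?thesis by (simp add: power2_diff abs_mult)
  qed
  have i: "integrable M (\<lambda>\<omega>. U \<omega> * V \<omega>)" by (rule square_product_integrable) (use sq in auto)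
  have "\<bar>expectation (\<lambda>\<omega>. U \<omega> * V \<omega>)\<bar> \<le> expectation (\<lambda>\<omega>. \<bar>U \<omega> * V \<omega>\<bar>)" by simp
  also have "\<dots> \<le> expectation (\<lambda>\<omega>. ((U \<omega>)\<^sup>2 + (V \<omega>)\<^sup>2) / 2)"
    using i sq am by (intro integral_mono) auto
  also have "\<dots> = (expectation (\<lambda>\<omega>. (U \<omega>)\<^sup>2) + expectation (\<lambda>\<omega>. (V \<omega>)\<^sup>2)) / 2" using sq by simp
  finally have 1: "\<bar>expectation (\<lambda>\<omega>. U \<omega> * V \<omega>)\<bar> \<le> (expectation (\<lambda>\<omega>. (U \<omega>)\<^sup>2) + expectation (\<lambda>\<omega>. (V \<omega>)\<^sup>2)) / 2" .
  have "\<bar>expectation U * expectation V\<bar> \<le> ((expectation U)\<^sup>2 + (expectation V)\<^sup>2) / 2" by (rule am)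
  also have "\<dots> \<le> (expectation (\<lambda>\<omega>. (U \<omega>)\<^sup>2) + expectation (\<lambda>\<omega>. (V \<omega>)\<^sup>2)) / 2"
    using square_expectation_le[OF assms(1) sq(1)] square_expectation_le[OF assms(2) sq(2)]
    by (intro divide_right_mono add_mono) auto
  finally have 2: "\<bar>expectation U * expectation V\<bar> \<le> (expectation (\<lambda>\<omega>. (U \<omega>)\<^sup>2) + expectation (\<lambda>\<omega>. (V \<omega>)\<^sup>2)) / 2" .
  show ?thesis unfolding cov_def
    by (rule order_trans[OF abs_triangle_ineq4], rule order_trans[OF add_mono[OF 1 2]]) simp
qed

text \<open>Olivier's theorem: the terms from n / 2 to n are all at least f n, and their sum is a
  Cauchy remainder.\<close>

lemma decseq_summable_imp_n_times:
  fixes f :: "nat \<Rightarrow> real"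
  assumes anti: "\<And>m n. m \<le> n \<Longrightarrow> f n \<le> f m" and nonneg: "\<And>n. 0 \<le> f n" and "summable f"
  shows "(\<lambda>n. real n * f n) \<longlonglongrightarrow> 0"
proof (rule tendstoI)
  fix e :: real assume e: "e > 0"
  obtain N where N: "\<And>m n. m \<ge> N \<Longrightarrow> \<bar>sum f {m..<n}\<bar> < e / 2"
    using \<open>summable f\<close>[unfolded summable_Cauchy real_norm_def] e by (meson half_gt_zero)
  show "eventually (\<lambda>n. dist (real n * f n) 0 < e) sequentially"
    using eventually_ge_at_top[of "2 * N"]
  proof eventually_elim
    case (elim n)
    have "real n / 2 * f n \<le> real (n - n div 2) * f n" by (intro mult_right_mono nonneg) linarith
    also have "\<dots> = (\<Sum>j\<in>{n div 2..<n}. f n)" by simp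
    also have "\<dots> \<le> (\<Sum>j\<in>{n div 2..<n}. f j)" by (intro sum_mono anti) auto
    also have "\<dots> < e / 2" using N[of "n div 2" n] elim by linarith
    finally show ?case using nonneg[of n] by (simp add: dist_real_def)
  qed
qed

lemma Cesaro_mean_tendsto:
  fixes w :: "nat \<Rightarrow> real"
  assumes "w \<longlonglongrightarrow> l"
  shows "(\<lambda>n. (\<Sum>j<n. w j) / real n) \<longlonglongrightarrow> l"
proof (rule tendstoI)
  fix e :: real assume e: "e > 0"
  obtain N where N: "\<And>j. j \<ge> N \<Longrightarrow> \<bar>w j - l\<bar> < e / 2"
    using tendstoD[OF assms, of "e / 2"] e by (auto simp: eventually_sequentially dist_real_def)
  define C where "C = (\<Sum>j<N. \<bar>w j - l\<bar>)"
  have "eventually (\<lambda>n. C / real n < e / 2) sequentially"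
    using e by (intro order_tendstoD(2)[OF lim_const_over_n]) auto
  then show "eventually (\<lambda>n. dist ((\<Sum>j<n. w j) / real n) l < e) sequentially"
    using eventually_gt_at_top[of 0] eventually_ge_at_top[of N]
  proof eventually_elim
    case (elim n)
    have "(\<Sum>j<n. w j) / real n - l = (\<Sum>j<n. w j - l) / real n" using elim by (simp add: sum_subtractf field_simps)
    also have "\<bar>\<dots>\<bar> \<le> (\<Sum>j<n. \<bar>w j - l\<bar>) / real n" by (auto simp: abs_divide intro!: divide_right_mono)
    also have "(\<Sum>j<n. \<bar>w j - l\<bar>) = C + (\<Sum>j\<in>{N..<n}. \<bar>w j - l\<bar>)"
      unfolding C_def using elim(3) by (subst sum.union_disjoint[symmetric]) (auto simp: ivl_disj_un)
    also have "\<dots> \<le> C + (\<Sum>j\<in>{N..<n}. e / 2)" by (rule add_left_mono, rule sum_mono, rule less_imp_le, rule N) auto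
    also have "\<dots> \<le> C + real n * (e / 2)" using e by simp
    finally have "\<bar>(\<Sum>j<n. w j) / real n - l\<bar> \<le> (C + real n * (e / 2)) / real n" by (simp add: divide_right_mono)
    also have "\<dots> = C / real n + e / 2" using elim by (simp add: add_divide_distrib)
    finally show ?case unfolding dist_real_def using elim(1) by linarith
  qed
qed

section \<open>Covariance inequalities under a moment of order above 2\<close>

locale fast_mixing_process = stationary_process +
  fixes \<epsilon> :: real
  assumes eps: "\<epsilon> > 0"
    and moment: "integrable M (\<lambda>\<omega>. \<bar>X 0 \<omega>\<bar> powr (2 + \<epsilon>))"
    and summable_beta: "summable (\<lambda>k. alpha k powr (\<epsilon> / (2 + \<epsilon>)))"
begin

definition beta :: "nat \<Rightarrow> real" where "beta k = alpha k powr (\<epsilon> / (2 + \<epsilon>))"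
definition moment_bound :: real where "moment_bound = expectation (\<lambda>\<omega>. \<bar>X 0 \<omega>\<bar> powr (2 + \<epsilon>))"

lemma moment_bound_nonneg: "moment_bound \<ge> 0" by (simp add: moment_bound_def)
lemma beta_nonneg: "beta k \<ge> 0" by (simp add: beta_def)
lemma summable_beta': "summable beta" using summable_beta by (simp add: beta_def[abs_def])
lemma exponent: "0 < \<epsilon> / (2 + \<epsilon>)" "\<epsilon> / (2 + \<epsilon>) < 1" using eps by auto

lemma alpha_tendsto_0: "alpha \<longlonglongrightarrow> 0"
proof -
  have "(\<lambda>k. beta k powr ((2 + \<epsilon>) / \<epsilon>)) \<longlonglongrightarrow> 0 powr ((2 + \<epsilon>) / \<epsilon>)"
    using summable_LIMSEQ_zero[OF summable_beta'] eps
    by (intro tendsto_powr') (auto intro: always_eventually beta_nonneg)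
  then show ?thesis using eps alpha_nonneg by (simp add: beta_def powr_powr)
qed

text \<open>The exponent of \<open>beta\<close> is below 1, so \<open>alpha\<close> k <=
  \<open>beta\<close> k once \<open>alpha\<close> k < 1, and k \<open>beta\<close> k tends to 0
  because \<open>beta\<close> is monotone and summable. The result bounds the decoupling error of
  the Bernstein blocks.\<close>

lemma n_alpha_tendsto_0: "(\<lambda>k. real k * alpha k) \<longlonglongrightarrow> 0"
proof (rule tendsto_sandwich[OF _ _ tendsto_const])
  show "(\<lambda>k. real k * beta k) \<longlonglongrightarrow> 0"
    using exponent by (intro decseq_summable_imp_n_times summable_beta' beta_nonneg)
      (auto simp: beta_def intro!: powr_mono2 alpha_antimono alpha_nonneg)
  have "eventually (\<lambda>k. alpha k < 1) sequentially" using alpha_tendsto_0 by (intro order_tendstoD) auto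
  then show "eventually (\<lambda>k. real k * alpha k \<le> real k * beta k) sequentially"
  proof eventually_elim
    case (elim k)
    have "alpha k powr 1 \<le> beta k" unfolding beta_def
      using elim alpha_nonneg[of k] exponent by (intro powr_mono') auto
    then show ?case using alpha_nonneg[of k] by (intro mult_left_mono) auto
  qed
qed (auto intro!: always_eventually mult_nonneg_nonneg alpha_nonneg)

lemma moment_t: "integrable M (\<lambda>\<omega>. \<bar>X t \<omega>\<bar> powr (2 + \<epsilon>))"
  "expectation (\<lambda>\<omega>. \<bar>X t \<omega>\<bar> powr (2 + \<epsilon>)) = moment_bound"
  using moment integrable_marginal[of "\<lambda>x. \<bar>x\<bar> powr (2 + \<epsilon>)" t] expectation_marginal[of "\<lambda>x. \<bar>x\<bar> powr (2 + \<epsilon>)" t]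
  by (auto simp: moment_bound_def)

text \<open>The functions dominated by |x| include the identity, the truncation and its remainder,
  so one set of lemmas serves all three.\<close>

lemma square_integrable:
  assumes [measurable]: "f \<in> borel_measurable borel" and f: "\<And>x. \<bar>f x\<bar> \<le> \<bar>x\<bar>"
  shows "integrable M (\<lambda>\<omega>. (f (X t \<omega>))\<^sup>2)"
proof (rule Bochner_Integration.integrable_bound[where f = "\<lambda>\<omega>. 1 + \<bar>X t \<omega>\<bar> powr (2 + \<epsilon>)"])
  show "AE \<omega> in M. norm ((f (X t \<omega>))\<^sup>2) \<le> norm (1 + \<bar>X t \<omega>\<bar> powr (2 + \<epsilon>))"
  proof (rule AE_I2)
    fix \<omega>
    let ?x = "X t \<omega>"
    have "(f ?x)\<^sup>2 \<le> ?x\<^sup>2" using f[of ?x] by (simp add: abs_le_square_iff)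
    also have "\<dots> \<le> 1 + \<bar>?x\<bar> powr (2 + \<epsilon>)"
    proof (cases "\<bar>?x\<bar> \<le> 1")
      case True
      then have "?x\<^sup>2 \<le> 1" by (simp add: abs_square_le_1)
      then show ?thesis by (simp add: add_increasing2)
    next
      case False
      then have "\<bar>?x\<bar> powr 2 \<le> \<bar>?x\<bar> powr (2 + \<epsilon>)" using eps by (intro powr_mono) auto
      then show ?thesis using False by (simp add: powr_numeral)
    qed
    finally show "norm ((f ?x)\<^sup>2) \<le> norm (1 + \<bar>?x\<bar> powr (2 + \<epsilon>))" by simp
  qed
qed (use moment_t in auto)

lemma integrable_dominated:
  assumes [measurable]: "f \<in> borel_measurable borel" and f: "\<And>x. \<bar>f x\<bar> \<le> \<bar>x\<bar>"
  shows "integrable M (\<lambda>\<omega>. f (X t \<omega>))"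
  by (rule square_integrable_imp_integrable[OF _ square_integrable[OF assms]]) measurable

text \<open>Davydov's covariance inequality for equally distributed variables, before optimising over the truncation level c.\<close>
lemma cov_truncated_le:
  assumes fm [measurable]: "f \<in> borel_measurable borel" and f: "\<And>x. \<bar>f x\<bar> \<le> \<bar>x\<bar>" and st: "s + int k \<le> t" and c: "c > 0"
  shows "\<bar>cov M (\<lambda>\<omega>. f (X s \<omega>)) (\<lambda>\<omega>. f (X t \<omega>))\<bar> \<le> c\<^sup>2 * alpha k + 6 * moment_bound / c powr \<epsilon>"
proof -
  define f1 where "f1 x = clip c (f x)" for x
  define f2 where "f2 x = f x - clip c (f x)" for x
  have m [measurable]: "f1 \<in> borel_measurable borel" "f2 \<in> borel_measurable borel" unfolding f1_def f2_def by measurable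
  have b1: "\<bar>f1 x\<bar> \<le> c" "\<bar>f1 x\<bar> \<le> \<bar>x\<bar>" for x
    using abs_clip_le[of c "f x"] abs_clip_le_abs[of c "f x"] f[of x] c unfolding f1_def by linarith+
  have b2: "\<bar>f2 x\<bar> \<le> \<bar>x\<bar>" for x using abs_diff_clip_le_abs[of c "f x"] f[of x] c unfolding f2_def by linarith
  have f12: "f x = f1 x + f2 x" for x by (simp add: f1_def f2_def)
  have sq: "integrable M (\<lambda>\<omega>. (f1 (X t \<omega>))\<^sup>2)" "integrable M (\<lambda>\<omega>. (f2 (X t \<omega>))\<^sup>2)" "integrable M (\<lambda>\<omega>. (f (X t \<omega>))\<^sup>2)" for t
    using square_integrable m fm b1(2) b2 f by auto
  have int: "integrable M (\<lambda>\<omega>. f1 (X t \<omega>))" "integrable M (\<lambda>\<omega>. f2 (X t \<omega>))" "integrable M (\<lambda>\<omega>. f (X t \<omega>))" for t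
    using integrable_dominated m fm b1(2) b2 f by auto
  have pr: "integrable M (\<lambda>\<omega>. u (X s \<omega>) * v (X t \<omega>))" if "u \<in> {f1, f2, f}" "v \<in> {f1, f2, f}" for u v s t
    by (rule square_product_integrable) (use that sq in auto)
  let ?c = "\<lambda>u v. cov M (\<lambda>\<omega>. u (X s \<omega>)) (\<lambda>\<omega>. v (X t \<omega>))"
  have "?c f f = ?c f1 f + ?c f2 f"
    unfolding f12 using cov_add_left[of "\<lambda>\<omega>. f1 (X s \<omega>)" "\<lambda>\<omega>. f1 (X t \<omega>) + f2 (X t \<omega>)" "\<lambda>\<omega>. f2 (X s \<omega>)"]
      pr[of f1 f s t] pr[of f2 f s t] int by (simp add: f12)
  also have "?c f1 f = ?c f1 f1 + ?c f1 f2"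
    unfolding f12 cov_commute[of M "\<lambda>\<omega>. f1 (X s \<omega>)"] using pr int by (intro cov_add_left) auto
  also have "?c f2 f = ?c f2 f1 + ?c f2 f2"
    unfolding f12 cov_commute[of M "\<lambda>\<omega>. f2 (X s \<omega>)"] using pr int by (intro cov_add_left) auto
  finally have split: "?c f f = ?c f1 f1 + ?c f1 f2 + (?c f2 f1 + ?c f2 f2)" .
  have tail1: "expectation (\<lambda>\<omega>. \<bar>f2 (X t \<omega>)\<bar>) \<le> moment_bound / c powr (1 + \<epsilon>)" for t
  proof -
    have "expectation (\<lambda>\<omega>. \<bar>f2 (X t \<omega>)\<bar>) \<le> expectation (\<lambda>\<omega>. \<bar>X t \<omega>\<bar> powr (2 + \<epsilon>) / c powr (1 + \<epsilon>))"
    proof (rule integral_mono)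
      fix \<omega>
      have "\<bar>f2 (X t \<omega>)\<bar> \<le> \<bar>f (X t \<omega>)\<bar> powr (2 + \<epsilon>) / c powr (1 + \<epsilon>)"
        using diff_clip_tail[OF c, of 1 "2 + \<epsilon>" "f (X t \<omega>)"] eps by (simp add: f2_def algebra_simps)
      also have "\<dots> \<le> \<bar>X t \<omega>\<bar> powr (2 + \<epsilon>) / c powr (1 + \<epsilon>)" using f eps by (intro divide_right_mono powr_mono2) auto
      finally show "\<bar>f2 (X t \<omega>)\<bar> \<le> \<bar>X t \<omega>\<bar> powr (2 + \<epsilon>) / c powr (1 + \<epsilon>)" .
    qed (use int moment_t in auto)
    then show ?thesis using moment_t by simp
  qed
  have tail2: "expectation (\<lambda>\<omega>. (f2 (X t \<omega>))\<^sup>2) \<le> moment_bound / c powr \<epsilon>" for t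
  proof -
    have "expectation (\<lambda>\<omega>. (f2 (X t \<omega>))\<^sup>2) \<le> expectation (\<lambda>\<omega>. \<bar>X t \<omega>\<bar> powr (2 + \<epsilon>) / c powr \<epsilon>)"
    proof (rule integral_mono)
      fix \<omega>
      have "(f2 (X t \<omega>))\<^sup>2 \<le> \<bar>f (X t \<omega>)\<bar> powr (2 + \<epsilon>) / c powr \<epsilon>"
        using diff_clip_tail[OF c, of 2 "2 + \<epsilon>" "f (X t \<omega>)"] eps by (simp add: f2_def powr_numeral)
      also have "\<dots> \<le> \<bar>X t \<omega>\<bar> powr (2 + \<epsilon>) / c powr \<epsilon>" using f eps by (intro divide_right_mono powr_mono2) auto
      finally show "(f2 (X t \<omega>))\<^sup>2 \<le> \<bar>X t \<omega>\<bar> powr (2 + \<epsilon>) / c powr \<epsilon>" .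
    qed (use sq moment_t in auto)
    then show ?thesis using moment_t by simp
  qed
  have c11: "\<bar>?c f1 f1\<bar> \<le> c\<^sup>2 * alpha k"
    using cov_pair_marginal_le[OF m(1) b1(1) c m(1) b1(1) c st] by (simp add: power2_eq_square)
  \<comment> \<open>Each of the two terms of the covariance is at most c times the L1 norm of the
    remainder, hence the factor 2. Three of the four covariances involve a remainder, which makes up
    the constant 6.\<close>
  have mixed: "\<bar>cov M (\<lambda>\<omega>. f1 (X s \<omega>)) (\<lambda>\<omega>. f2 (X t \<omega>))\<bar> \<le> 2 * (moment_bound / c powr \<epsilon>)" for s t
  proof -
    have "\<bar>expectation (\<lambda>\<omega>. f1 (X s \<omega>) * f2 (X t \<omega>))\<bar> \<le> expectation (\<lambda>\<omega>. \<bar>f1 (X s \<omega>) * f2 (X t \<omega>)\<bar>)" by simp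
    also have "\<dots> \<le> expectation (\<lambda>\<omega>. c * \<bar>f2 (X t \<omega>)\<bar>)"
    proof (rule integral_mono)
      have "integrable M (\<lambda>\<omega>. f1 (X s \<omega>) * f2 (X t \<omega>))" by (rule pr) auto
      then show "integrable M (\<lambda>\<omega>. \<bar>f1 (X s \<omega>) * f2 (X t \<omega>)\<bar>)" by (rule integrable_abs)
    qed (use int b1(1) in \<open>auto simp: abs_mult intro!: mult_right_mono\<close>)
    also have "\<dots> = c * expectation (\<lambda>\<omega>. \<bar>f2 (X t \<omega>)\<bar>)" by simp
    finally have 1: "\<bar>expectation (\<lambda>\<omega>. f1 (X s \<omega>) * f2 (X t \<omega>))\<bar> \<le> c * expectation (\<lambda>\<omega>. \<bar>f2 (X t \<omega>)\<bar>)" .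
    have "\<bar>expectation (\<lambda>\<omega>. f1 (X s \<omega>))\<bar> \<le> expectation (\<lambda>\<omega>. \<bar>f1 (X s \<omega>)\<bar>)" by simp
    also have "\<dots> \<le> expectation (\<lambda>\<omega>. c)" using int b1(1) by (intro integral_mono) auto
    finally have "\<bar>expectation (\<lambda>\<omega>. f1 (X s \<omega>))\<bar> \<le> c" by (simp add: prob_space)
    then have 2: "\<bar>expectation (\<lambda>\<omega>. f1 (X s \<omega>)) * expectation (\<lambda>\<omega>. f2 (X t \<omega>))\<bar> \<le> c * expectation (\<lambda>\<omega>. \<bar>f2 (X t \<omega>)\<bar>)"
      unfolding abs_mult using c by (intro mult_mono) auto
    have "c * expectation (\<lambda>\<omega>. \<bar>f2 (X t \<omega>)\<bar>) \<le> c * (moment_bound / c powr (1 + \<epsilon>))" using tail1 c by (intro mult_left_mono) auto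
    also have "\<dots> = moment_bound / c powr \<epsilon>" using c by (simp add: powr_add)
    finally show ?thesis using 1 2 unfolding cov_def by linarith
  qed
  have c22: "\<bar>?c f2 f2\<bar> \<le> 2 * (moment_bound / c powr \<epsilon>)"
    using abs_cov_le_squares[of "\<lambda>\<omega>. f2 (X s \<omega>)" "\<lambda>\<omega>. f2 (X t \<omega>)"] sq tail2[of s] tail2[of t] by simp
  have "\<bar>?c f2 f1\<bar> \<le> 2 * (moment_bound / c powr \<epsilon>)" using mixed[of t s] cov_commute[of M "\<lambda>\<omega>. f2 (X s \<omega>)"] by simp
  then have "\<bar>?c f f\<bar> \<le> c\<^sup>2 * alpha k + 6 * (moment_bound / c powr \<epsilon>)"
    unfolding split using c11 c22 mixed[of s t] by linarith
  then show ?thesis by simp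
qed

text \<open>The level c = (\<open>alpha\<close> k)^(-1 / (2 + \<epsilon>)) balances the terms: c^2
  \<open>alpha\<close> k and c^(-\<epsilon>) both equal \<open>beta\<close> k.\<close>

lemma cov_le_beta:
  assumes f: "f \<in> borel_measurable borel" "\<And>x. \<bar>f x\<bar> \<le> \<bar>x\<bar>" and st: "s + int k \<le> t"
  shows "\<bar>cov M (\<lambda>\<omega>. f (X s \<omega>)) (\<lambda>\<omega>. f (X t \<omega>))\<bar> \<le> (1 + 6 * moment_bound) * beta k"
proof (cases "alpha k = 0")
  \<comment> \<open>No finite level is optimal when the coefficient is 0; c tends to infinity
    instead.\<close>
  case True
  have "((\<lambda>c. 6 * moment_bound * c powr (- \<epsilon>)) \<longlongrightarrow> 6 * moment_bound * 0) at_top"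
    by (intro tendsto_mult tendsto_const tendsto_neg_powr filterlim_ident) (use eps in auto)
  then have "((\<lambda>c. 6 * moment_bound * c powr (- \<epsilon>)) \<longlongrightarrow> 0) at_top" by simp
  then have "\<bar>cov M (\<lambda>\<omega>. f (X s \<omega>)) (\<lambda>\<omega>. f (X t \<omega>))\<bar> \<le> 0"
  proof (rule tendsto_lowerbound)
    show "eventually (\<lambda>c. \<bar>cov M (\<lambda>\<omega>. f (X s \<omega>)) (\<lambda>\<omega>. f (X t \<omega>))\<bar> \<le> 6 * moment_bound * c powr (- \<epsilon>)) at_top"
      using eventually_gt_at_top[of 0]
    proof eventually_elim
      case (elim c)
      show ?case using cov_truncated_le[OF f st elim] True by (simp add: powr_minus divide_inverse)
    qed
  qed simp
  then show ?thesis using True by (simp add: beta_def)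
next
  case False
  then have a: "alpha k > 0" using alpha_nonneg[of k] by simp
  define c where "c = alpha k powr (- (1 / (2 + \<epsilon>)))"
  have c: "c > 0" using a by (simp add: c_def)
  have "c\<^sup>2 * alpha k = alpha k powr (- (2 / (2 + \<epsilon>))) * alpha k powr 1"
    using a by (simp add: c_def powr_power)
  also have "\<dots> = alpha k powr (- (2 / (2 + \<epsilon>)) + 1)" by (simp only: powr_add)
  also have "- (2 / (2 + \<epsilon>)) + 1 = \<epsilon> / (2 + \<epsilon>)" using eps by (simp add: field_simps)
  finally have 1: "c\<^sup>2 * alpha k = beta k" by (simp add: beta_def)
  have "c powr \<epsilon> = alpha k powr (- (\<epsilon> / (2 + \<epsilon>)))"
    unfolding c_def powr_powr by simp
  then have "1 / c powr \<epsilon> = beta k" by (simp add: beta_def powr_minus_divide)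
  then have 2: "6 * moment_bound / c powr \<epsilon> = 6 * moment_bound * beta k" by (metis mult.right_neutral times_divide_eq_right)
  show ?thesis using cov_truncated_le[OF f st c] unfolding 1 2 by (simp add: algebra_simps)
qed

end

context fast_mixing_process
begin

lemma centered_product:
  assumes f: "f \<in> borel_measurable borel" "\<And>x. \<bar>f x\<bar> \<le> \<bar>x\<bar>"
  defines "m \<equiv> expectation (\<lambda>\<omega>. f (X 0 \<omega>))"
  shows "integrable M (\<lambda>\<omega>. (f (X s \<omega>) - m) * (f (X t \<omega>) - m))"
    and "expectation (\<lambda>\<omega>. (f (X s \<omega>) - m) * (f (X t \<omega>) - m)) = cov M (\<lambda>\<omega>. f (X s \<omega>)) (\<lambda>\<omega>. f (X t \<omega>))"
proof -
  note [measurable] = f(1)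
  have p: "integrable M (\<lambda>\<omega>. f (X s \<omega>) * f (X t \<omega>))"
    by (rule square_product_integrable) (use square_integrable[OF f] in auto)
  have i: "integrable M (\<lambda>\<omega>. f (X t \<omega>))" for t by (rule integrable_dominated[OF f])
  have e: "expectation (\<lambda>\<omega>. f (X t \<omega>)) = m" for t unfolding m_def by (rule expectation_marginal[OF f(1)])
  have eq: "(f (X s \<omega>) - m) * (f (X t \<omega>) - m) = f (X s \<omega>) * f (X t \<omega>) - m * f (X s \<omega>) - m * f (X t \<omega>) + m * m" for \<omega>
    by (simp add: algebra_simps)
  show "integrable M (\<lambda>\<omega>. (f (X s \<omega>) - m) * (f (X t \<omega>) - m))" unfolding eq using p i by auto
  show "expectation (\<lambda>\<omega>. (f (X s \<omega>) - m) * (f (X t \<omega>) - m)) = cov M (\<lambda>\<omega>. f (X s \<omega>)) (\<lambda>\<omega>. f (X t \<omega>))"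
    unfolding eq cov_def using p i e by (simp add: prob_space)
qed

lemma centered_sum_square:
  assumes f: "f \<in> borel_measurable borel" "\<And>x. \<bar>f x\<bar> \<le> \<bar>x\<bar>"
  defines "m \<equiv> expectation (\<lambda>\<omega>. f (X 0 \<omega>))"
  shows "integrable M (\<lambda>\<omega>. (\<Sum>t\<in>A. f (X t \<omega>) - m)\<^sup>2)"
    and "expectation (\<lambda>\<omega>. (\<Sum>t\<in>A. f (X t \<omega>) - m)\<^sup>2) = (\<Sum>s\<in>A. \<Sum>t\<in>A. cov M (\<lambda>\<omega>. f (X s \<omega>)) (\<lambda>\<omega>. f (X t \<omega>)))"
proof -
  have eq: "(\<Sum>t\<in>A. f (X t \<omega>) - m)\<^sup>2 = (\<Sum>s\<in>A. \<Sum>t\<in>A. (f (X s \<omega>) - m) * (f (X t \<omega>) - m))" for \<omega>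
    by (simp add: power2_eq_square sum_product)
  show "integrable M (\<lambda>\<omega>. (\<Sum>t\<in>A. f (X t \<omega>) - m)\<^sup>2)"
    unfolding eq unfolding m_def by (intro Bochner_Integration.integrable_sum centered_product[OF f])
  show "expectation (\<lambda>\<omega>. (\<Sum>t\<in>A. f (X t \<omega>) - m)\<^sup>2) = (\<Sum>s\<in>A. \<Sum>t\<in>A. cov M (\<lambda>\<omega>. f (X s \<omega>)) (\<lambda>\<omega>. f (X t \<omega>)))"
    unfolding eq unfolding m_def
    by (simp add: Bochner_Integration.integral_sum Bochner_Integration.integrable_sum centered_product[OF f])
qed

text \<open>Each row of covariances runs over lags to the left and to the right, and each side is
  dominated by the series of c. The set A may have holes, as the set of deleted gaps does.\<close>

lemma centered_sum_second_moment_le: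
  assumes f: "f \<in> borel_measurable borel" "\<And>x. \<bar>f x\<bar> \<le> \<bar>x\<bar>" and A: "finite A"
    and c: "\<And>s t k. t = s + int k \<Longrightarrow> \<bar>cov M (\<lambda>\<omega>. f (X s \<omega>)) (\<lambda>\<omega>. f (X t \<omega>))\<bar> \<le> c k"
    and c0: "\<And>k. c k \<ge> 0" and sc: "summable c"
  shows "expectation (\<lambda>\<omega>. (\<Sum>t\<in>A. f (X t \<omega>) - expectation (\<lambda>\<omega>. f (X 0 \<omega>)))\<^sup>2) \<le> 2 * suminf c * real (card A)"
proof -
  let ?c = "\<lambda>s t. cov M (\<lambda>\<omega>. f (X s \<omega>)) (\<lambda>\<omega>. f (X t \<omega>))"
  have row: "(\<Sum>t\<in>A. ?c s t) \<le> 2 * suminf c" for s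
  proof -
    have "(\<Sum>t\<in>A. ?c s t) = (\<Sum>t\<in>{t\<in>A. s \<le> t}. ?c s t) + (\<Sum>t\<in>{t\<in>A. \<not> s \<le> t}. ?c s t)"
      using A by (subst sum.union_disjoint[symmetric]) (auto intro!: sum.cong)
    also have "(\<Sum>t\<in>{t\<in>A. s \<le> t}. ?c s t) \<le> (\<Sum>t\<in>{t\<in>A. s \<le> t}. c (nat (t - s)))"
    proof (rule sum_mono)
      fix t assume "t \<in> {t\<in>A. s \<le> t}"
      then show "?c s t \<le> c (nat (t - s))" using c[of t s "nat (t - s)"] by simp
    qed
    also have "\<dots> = sum c ((\<lambda>t. nat (t - s)) ` {t\<in>A. s \<le> t})" by (subst sum.reindex) (auto simp: inj_on_def)
    also have "\<dots> \<le> suminf c" using A c0 by (intro sum_le_suminf sc) auto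
    also have "(\<Sum>t\<in>{t\<in>A. \<not> s \<le> t}. ?c s t) \<le> (\<Sum>t\<in>{t\<in>A. \<not> s \<le> t}. c (nat (s - t)))"
    proof (rule sum_mono)
      fix t assume "t \<in> {t\<in>A. \<not> s \<le> t}"
      then show "?c s t \<le> c (nat (s - t))" using c[of s t "nat (s - t)"] cov_commute[of M "\<lambda>\<omega>. f (X s \<omega>)"] by simp
    qed
    also have "\<dots> = sum c ((\<lambda>t. nat (s - t)) ` {t\<in>A. \<not> s \<le> t})" by (subst sum.reindex) (auto simp: inj_on_def)
    also have "\<dots> \<le> suminf c" using A c0 by (intro sum_le_suminf sc) auto
    finally show ?thesis by simp
  qed
  have "(\<Sum>s\<in>A. \<Sum>t\<in>A. ?c s t) \<le> (\<Sum>s\<in>A. 2 * suminf c)" by (intro sum_mono row)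
  then show ?thesis unfolding centered_sum_square(2)[OF f] by (simp add: mult.commute)
qed

definition var_const :: real where "var_const = 2 * suminf (\<lambda>k. (1 + 6 * moment_bound) * beta k)"

lemma summable_scaled_beta: "summable (\<lambda>k. (1 + 6 * moment_bound) * beta k)"
  by (intro summable_mult summable_beta')

lemma scaled_beta_nonneg: "0 \<le> (1 + 6 * moment_bound) * beta k"
  using moment_bound_nonneg beta_nonneg by (intro mult_nonneg_nonneg) auto

lemma centered_sum_var_const:
  assumes f: "f \<in> borel_measurable borel" "\<And>x. \<bar>f x\<bar> \<le> \<bar>x\<bar>" and A: "finite A"
  shows "expectation (\<lambda>\<omega>. (\<Sum>t\<in>A. f (X t \<omega>) - expectation (\<lambda>\<omega>. f (X 0 \<omega>)))\<^sup>2) \<le> var_const * real (card A)"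
  unfolding var_const_def
  by (rule centered_sum_second_moment_le[OF f A _ scaled_beta_nonneg summable_scaled_beta]) (rule cov_le_beta[OF f], simp)

text \<open>Small lags are controlled by the second moment of the truncation error, large lags by the mixing rate.\<close>
lemma truncation_error_small:
  assumes e: "e > 0"
  obtains K where "K > 0"
    "\<And>A. finite A \<Longrightarrow> expectation (\<lambda>\<omega>. (\<Sum>t\<in>A. (X t \<omega> - clip K (X t \<omega>)) - expectation (\<lambda>\<omega>. X 0 \<omega> - clip K (X 0 \<omega>)))\<^sup>2) \<le> e * real (card A)"
proof -
  let ?b = "\<lambda>k. (1 + 6 * moment_bound) * beta k"
  \<comment> \<open>The number m of short lags is fixed through the tail of the series before K,
    which then makes their total contribution small; 2 (e / 4 + e / 4) = e.\<close>
  obtain m where m: "norm (\<Sum>i. ?b (i + m)) < e / 4"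
    using suminf_exist_split[OF _ summable_scaled_beta, of "e / 4"] e by auto
  have lim: "((\<lambda>K. real m * (2 * moment_bound) * real K powr (- \<epsilon>)) \<longlonglongrightarrow> real m * (2 * moment_bound) * 0)"
    by (intro tendsto_mult tendsto_const tendsto_neg_powr filterlim_real_sequentially) (use eps in auto)
  then have "eventually (\<lambda>K. real m * (2 * moment_bound) * real K powr (- \<epsilon>) < e / 4 \<and> K > 0) sequentially"
    by (intro eventually_conj order_tendstoD(2)[OF lim] eventually_gt_at_top) (use e in simp)
  then obtain K0 :: nat where K0: "real m * (2 * moment_bound) * real K0 powr (- \<epsilon>) < e / 4" "K0 > 0" using eventually_happens by force
  define K where "K = real K0"
  have K: "K > 0" using K0 by (simp add: K_def)
  define v where "v = 2 * (moment_bound / K powr \<epsilon>)"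
  have v: "v \<ge> 0" "real m * v < e / 4"
  proof -
    show "v \<ge> 0" using moment_bound_nonneg by (simp add: v_def)
    have "real m * v = real m * (2 * moment_bound) * real K0 powr (- \<epsilon>)"
      by (simp add: v_def K_def powr_minus divide_inverse)
    then show "real m * v < e / 4" using K0(1) by linarith
  qed
  let ?f = "\<lambda>x. x - clip K x"
  have f: "?f \<in> borel_measurable borel" "\<And>x. \<bar>?f x\<bar> \<le> \<bar>x\<bar>"
    using abs_diff_clip_le_abs[of K] K by (auto simp del: abs_diff_le_iff)
  have sq: "expectation (\<lambda>\<omega>. (?f (X t \<omega>))\<^sup>2) \<le> moment_bound / K powr \<epsilon>" for t
  proof -
    have "expectation (\<lambda>\<omega>. (?f (X t \<omega>))\<^sup>2) \<le> expectation (\<lambda>\<omega>. \<bar>X t \<omega>\<bar> powr (2 + \<epsilon>) / K powr \<epsilon>)"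
    proof (rule integral_mono)
      show "(?f (X t \<omega>))\<^sup>2 \<le> \<bar>X t \<omega>\<bar> powr (2 + \<epsilon>) / K powr \<epsilon>" for \<omega>
        using diff_clip_tail[OF K, of 2 "2 + \<epsilon>" "X t \<omega>"] eps by (simp add: powr_numeral)
    qed (use square_integrable[OF f] moment_t in auto)
    then show ?thesis using moment_t by simp
  qed
  define c where "c k = (if k < m then v else ?b k)" for k
  have c0: "c k \<ge> 0" for k using v scaled_beta_nonneg by (simp add: c_def)
  have c_shift: "(\<lambda>i. c (i + m)) = (\<lambda>i. ?b (i + m))" by (simp add: c_def)
  have sc: "summable c"
    using summable_ignore_initial_segment[OF summable_scaled_beta, of m] unfolding c_shift[symmetric] by (simp only: summable_iff_shift)
  have "suminf c = (\<Sum>i. c (i + m)) + (\<Sum>i<m. c i)" by (rule suminf_split_initial_segment[OF sc])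
  also have "(\<Sum>i<m. c i) = real m * v" by (simp add: c_def)
  finally have "2 * suminf c \<le> e" using m v unfolding c_shift by (simp add: abs_less_iff)
  have cov_c: "\<bar>cov M (\<lambda>\<omega>. ?f (X s \<omega>)) (\<lambda>\<omega>. ?f (X t \<omega>))\<bar> \<le> c k" if "t = s + int k" for s t k
  proof (cases "k < m")
    case True
    have "\<bar>cov M (\<lambda>\<omega>. ?f (X s \<omega>)) (\<lambda>\<omega>. ?f (X t \<omega>))\<bar> \<le> expectation (\<lambda>\<omega>. (?f (X s \<omega>))\<^sup>2) + expectation (\<lambda>\<omega>. (?f (X t \<omega>))\<^sup>2)"
      by (rule abs_cov_le_squares) (use square_integrable[OF f] in auto)
    also have "\<dots> \<le> v" unfolding v_def using sq[of s] sq[of t] by linarith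
    finally show ?thesis using True by (simp add: c_def)
  next
    case False
    then show ?thesis using cov_le_beta[OF f, of s k t] that by (simp add: c_def)
  qed
  show ?thesis
  proof (rule that[OF K])
    fix A :: "int set" assume A: "finite A"
    have "expectation (\<lambda>\<omega>. (\<Sum>t\<in>A. ?f (X t \<omega>) - expectation (\<lambda>\<omega>. ?f (X 0 \<omega>)))\<^sup>2) \<le> 2 * suminf c * real (card A)"
      by (rule centered_sum_second_moment_le[OF f A cov_c c0 sc])
    also have "\<dots> \<le> e * real (card A)" using \<open>2 * suminf c \<le> e\<close> by (intro mult_right_mono) auto
    finally show "expectation (\<lambda>\<omega>. (\<Sum>t\<in>A. ?f (X t \<omega>) - expectation (\<lambda>\<omega>. ?f (X 0 \<omega>)))\<^sup>2) \<le> e * real (card A)" .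
  qed
qed

definition gamma :: "nat \<Rightarrow> real" where "gamma d = cov M (X 0) (X (int d))"

lemma cov_eq_gamma: "cov M (X s) (X (s + int d)) = gamma d"
proof -
  have "cov M (\<lambda>\<omega>. X (0 + s) \<omega>) (\<lambda>\<omega>. X (int d + s) \<omega>) = cov M (\<lambda>\<omega>. X 0 \<omega>) (\<lambda>\<omega>. X (int d) \<omega>)"
    by (rule cov_cylinder_shift[of "{0}" "{int d}" "\<lambda>x. x 0" "\<lambda>x. x (int d)"])
       (auto intro!: cylinder_component[where f = "\<lambda>x. x"])
  then show ?thesis by (simp add: gamma_def add.commute)
qed

lemma summable_gamma: "summable (\<lambda>d. gamma (Suc d))"
proof (rule summable_comparison_test')
  show "summable (\<lambda>d. (1 + 6 * moment_bound) * beta (Suc d))"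
    using summable_scaled_beta by (subst summable_Suc_iff)
  show "norm (gamma (Suc d)) \<le> (1 + 6 * moment_bound) * beta (Suc d)" if "0 \<le> d" for d
    using cov_le_beta[of "\<lambda>x. x" 0 "Suc d" "int (Suc d)"] by (simp add: gamma_def)
qed

text \<open>Appending one variable to a sum of j variables increases the variance by
  \<open>w\<close> j, that is, \<open>gamma\<close> 0 plus twice the first j autocovariances. The
  quotient is thus a Cesaro mean of a convergent sequence.\<close>

lemma block_variance_tendsto:
  assumes mean: "expectation (X 0) = 0"
  shows "(\<lambda>p. expectation (\<lambda>\<omega>. (\<Sum>t\<in>{1..int p}. X t \<omega>)\<^sup>2) / real p) \<longlonglongrightarrow> long_run_var M X"
proof -
  define w where "w j = gamma 0 + 2 * (\<Sum>d<j. gamma (Suc d))" for j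
  have "w \<longlonglongrightarrow> gamma 0 + 2 * (\<Sum>d. gamma (Suc d))"
    unfolding w_def by (intro tendsto_intros summable_LIMSEQ summable_gamma)
  then have w: "w \<longlonglongrightarrow> long_run_var M X" by (simp add: long_run_var_def gamma_def)
  have "expectation (\<lambda>\<omega>. (\<Sum>t\<in>{1..int p}. X t \<omega>)\<^sup>2) = (\<Sum>j<p. w j)" for p
  proof -
    have "expectation (\<lambda>\<omega>. (\<Sum>t\<in>{1..int p}. X t \<omega>)\<^sup>2) = (\<Sum>s\<in>{1..int p}. \<Sum>t\<in>{1..int p}. cov M (X s) (X t))"
      using centered_sum_square(2)[of "\<lambda>x. x" "{1..int p}"] mean by simp
    also have "\<dots> = (\<Sum>j<p. w j)"
    proof (induction p)
      case (Suc p)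
      let ?I = "{1..int p}" and ?q = "int p + 1"
      have I: "{1..int (Suc p)} = insert ?q ?I" by auto
      have nI: "?q \<notin> ?I" by simp
      have lag: "(\<Sum>s\<in>?I. cov M (X s) (X ?q)) = (\<Sum>d<p. gamma (Suc d))"
      proof (rule sum.reindex_bij_witness[where i = "\<lambda>d. int p - int d" and j = "\<lambda>s. nat (int p - s)"])
        fix s assume s: "s \<in> ?I"
        have q: "?q = s + int (Suc (nat (int p - s)))" using s by simp
        show "gamma (Suc (nat (int p - s))) = cov M (X s) (X ?q)" by (simp only: q cov_eq_gamma)
      qed auto
      have "(\<Sum>s\<in>insert ?q ?I. \<Sum>t\<in>insert ?q ?I. cov M (X s) (X t))
        = cov M (X ?q) (X ?q) + (\<Sum>t\<in>?I. cov M (X ?q) (X t)) + ((\<Sum>s\<in>?I. cov M (X s) (X ?q)) + (\<Sum>s\<in>?I. \<Sum>t\<in>?I. cov M (X s) (X t)))"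
        using nI by (simp add: sum.distrib)
      also have "(\<Sum>t\<in>?I. cov M (X ?q) (X t)) = (\<Sum>s\<in>?I. cov M (X s) (X ?q))" by (intro sum.cong refl cov_commute)
      also have "cov M (X ?q) (X ?q) = gamma 0" using cov_eq_gamma[of ?q 0] by simp
      finally show ?case unfolding I lag Suc.IH by (simp add: w_def)
    qed simp
    finally show ?thesis .
  qed
  then show ?thesis using Cesaro_mean_tendsto[OF w] by simp
qed

end

section \<open>Characteristic functions of sums and Taylor estimates\<close>

lemma iexp_lipschitz: "cmod (iexp x - iexp y) \<le> \<bar>x - y\<bar>"
proof -
  have "iexp x - iexp y = iexp y * (iexp (x - y) - 1)"
    by (simp add: algebra_simps flip: exp_add)
  then have "cmod (iexp x - iexp y) = cmod (iexp (x - y) - 1)" by (simp add: norm_mult)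
  also have "\<dots> \<le> \<bar>x - y\<bar>" using iexp_approx1[of "x - y" 0] by simp
  finally show ?thesis .
qed

text \<open>The quadratic bound serves variables with small second moment, the cubic one bounded
  variables.\<close>

lemma iexp_second_order:
  shows "cmod (iexp x - (1 + \<i> * x - of_real (x\<^sup>2 / 2))) \<le> x\<^sup>2"
    and "cmod (iexp x - (1 + \<i> * x - of_real (x\<^sup>2 / 2))) \<le> \<bar>x\<bar> ^ 3 / 6"
proof -
  have s: "(\<Sum>k\<le>2. (\<i> * complex_of_real x)^k / fact k) = 1 + \<i> * x - of_real (x\<^sup>2 / 2)"
  proof -
    have "(\<Sum>k\<le>2. (\<i> * complex_of_real x)^k / fact k) = 1 + \<i> * x + (\<i> * complex_of_real x)\<^sup>2 / 2"
      by (simp add: numeral_2_eq_2)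
    also have "(\<i> * complex_of_real x)\<^sup>2 = - of_real (x\<^sup>2)" by (simp add: power_mult_distrib)
    finally show ?thesis by simp
  qed
  show "cmod (iexp x - (1 + \<i> * x - of_real (x\<^sup>2 / 2))) \<le> x\<^sup>2"
    using iexp_approx2[of x 2] unfolding s by (simp add: numeral_2_eq_2)
  show "cmod (iexp x - (1 + \<i> * x - of_real (x\<^sup>2 / 2))) \<le> \<bar>x\<bar> ^ 3 / 6"
    using iexp_approx1[of x 2] unfolding s by (simp add: numeral_eq_Suc)
qed

text \<open>Here y stands for the truncated sum and z for the remainder, and the larger of the two
  decides. If it is y, the cubic bound with |y + z| <= 2 |y| gives 8 / 6 = 4 / 3; if it is z, the
  quadratic bound gives 2^2 = 4.\<close>

lemma iexp_second_order_split:
  "cmod (iexp (\<theta> * (y + z)) - (1 + \<i> * (\<theta> * (y + z)) - of_real ((\<theta> * (y + z))\<^sup>2 / 2)))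
     \<le> 4 * \<theta>\<^sup>2 * z\<^sup>2 + 4 / 3 * \<bar>\<theta>\<bar> ^ 3 * \<bar>y\<bar> ^ 3"
proof (cases "\<bar>z\<bar> \<le> \<bar>y\<bar>")
  case True
  have "\<bar>\<theta> * (y + z)\<bar> \<le> \<bar>\<theta>\<bar> * (2 * \<bar>y\<bar>)" unfolding abs_mult using True by (intro mult_left_mono) auto
  then have "\<bar>\<theta> * (y + z)\<bar> ^ 3 \<le> (\<bar>\<theta>\<bar> * (2 * \<bar>y\<bar>)) ^ 3" by (intro power_mono) auto
  then have "\<bar>\<theta> * (y + z)\<bar> ^ 3 / 6 \<le> 4 / 3 * \<bar>\<theta>\<bar> ^ 3 * \<bar>y\<bar> ^ 3" by (simp add: power_mult_distrib)
  moreover have "0 \<le> 4 * \<theta>\<^sup>2 * z\<^sup>2" by simp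
  ultimately show ?thesis using iexp_second_order(2)[of "\<theta> * (y + z)"] by linarith
next
  case False
  have "\<bar>y + z\<bar> \<le> \<bar>2 * z\<bar>" using False by linarith
  then have "(y + z)\<^sup>2 \<le> (2 * z)\<^sup>2" by (simp only: abs_le_square_iff)
  then have "\<theta>\<^sup>2 * (y + z)\<^sup>2 \<le> \<theta>\<^sup>2 * (2 * z)\<^sup>2" by (intro mult_left_mono) auto
  then have "(\<theta> * (y + z))\<^sup>2 \<le> 4 * \<theta>\<^sup>2 * z\<^sup>2" by (simp add: power_mult_distrib)
  moreover have "0 \<le> 4 / 3 * \<bar>\<theta>\<bar> ^ 3 * \<bar>y\<bar> ^ 3" by simp
  ultimately show ?thesis using iexp_second_order(1)[of "\<theta> * (y + z)"] by linarith
qed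

lemma exp_minus_second_order:
  assumes "x \<ge> (0::real)" shows "\<bar>1 - x - exp (- x)\<bar> \<le> x\<^sup>2 / 2"
proof -
  have 1: "1 - x \<le> exp (- x)" using exp_ge_add_one_self[of "- x"] by simp
  have "exp (- x) \<le> 1 - x + x\<^sup>2 / 2"
  proof -
    define g where "g = (\<lambda>x. 1 - x + x\<^sup>2 / 2 - exp (- x) :: real)"
    have "g 0 \<le> g x"
    proof (rule DERIV_nonneg_imp_nondecreasing[OF assms])
      fix y :: real assume "0 \<le> y"
      have "(g has_real_derivative (- 1 + y + exp (- y))) (at y)"
        unfolding g_def by (auto intro!: derivative_eq_intros)
      moreover have "0 \<le> - 1 + y + exp (- y)" using exp_ge_add_one_self[of "- y"] by simp
      ultimately show "\<exists>d. (g has_real_derivative d) (at y) \<and> 0 \<le> d" by blast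
    qed
    then show ?thesis by (simp add: g_def)
  qed
  then show ?thesis using 1 by linarith
qed

context stationary_process
begin

definition char_sum :: "int set \<Rightarrow> real \<Rightarrow> complex" where
  "char_sum A \<theta> = expectation (\<lambda>\<omega>. iexp (\<theta> * (\<Sum>t\<in>A. X t \<omega>)))"

lemma integrable_iexp: "U \<in> borel_measurable M \<Longrightarrow> integrable M (\<lambda>\<omega>. iexp (U \<omega>))"
  by (rule integrable_const_bound[where B = 1]) auto

lemma char_sum_norm: "cmod (char_sum A \<theta>) \<le> 1"
proof -
  have "cmod (char_sum A \<theta>) \<le> expectation (\<lambda>\<omega>. cmod (iexp (\<theta> * (\<Sum>t\<in>A. X t \<omega>))))"
    unfolding char_sum_def by (rule integral_norm_bound)
  then show ?thesis by (simp add: prob_space)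
qed

text \<open>Strong mixing is formulated with real functions, so cosine and sine are treated
  separately.\<close>

lemma char_sum_re_im:
  "char_sum A \<theta> = of_real (expectation (\<lambda>\<omega>. cos (\<theta> * (\<Sum>t\<in>A. X t \<omega>)))) + \<i> * of_real (expectation (\<lambda>\<omega>. sin (\<theta> * (\<Sum>t\<in>A. X t \<omega>))))"
proof -
  have i: "integrable M (\<lambda>\<omega>. cos (\<theta> * (\<Sum>t\<in>A. X t \<omega>)))" "integrable M (\<lambda>\<omega>. sin (\<theta> * (\<Sum>t\<in>A. X t \<omega>)))"
    by (auto intro!: integrable_bounded[where B = 1])
  have "iexp x = of_real (cos x) + \<i> * of_real (sin x)" for x :: real
    by (simp add: exp_Euler cos_of_real sin_of_real)
  then have "char_sum A \<theta> = expectation (\<lambda>\<omega>. of_real (cos (\<theta> * (\<Sum>t\<in>A. X t \<omega>))) + \<i> * complex_of_real (sin (\<theta> * (\<Sum>t\<in>A. X t \<omega>))))"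
    unfolding char_sum_def by presburger
  also have "\<dots> = expectation (\<lambda>\<omega>. of_real (cos (\<theta> * (\<Sum>t\<in>A. X t \<omega>)))) + \<i> * expectation (\<lambda>\<omega>. complex_of_real (sin (\<theta> * (\<Sum>t\<in>A. X t \<omega>))))"
    using i by (subst Bochner_Integration.integral_add) auto
  finally show ?thesis by simp
qed

text \<open>By the addition theorems the error consists of four covariances of sines and cosines,
  each at most \<open>alpha\<close> k.\<close>

lemma char_sum_mixing:
  assumes A: "finite A" "A \<subseteq> {..s}" and B: "finite B" "B \<subseteq> {s + int k..}" and "A \<inter> B = {}"
  shows "cmod (char_sum (A \<union> B) \<theta> - char_sum A \<theta> * char_sum B \<theta>) \<le> 4 * alpha k"
proof -
  let ?S = "\<lambda>A \<omega>. \<theta> * (\<Sum>t\<in>A. X t \<omega>)"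
  have mix: "\<bar>cov M (\<lambda>\<omega>. f (?S A \<omega>)) (\<lambda>\<omega>. g (?S B \<omega>))\<bar> \<le> alpha k"
    if "f \<in> {sin, cos}" "g \<in> {sin, cos}" for f g :: "real \<Rightarrow> real"
  proof (rule abs_cov_cylinder_le1[OF A(1) B(1) A(2) B(2), of "\<lambda>x. f (\<theta> * (\<Sum>t\<in>A. x t))" "\<lambda>x. g (\<theta> * (\<Sum>t\<in>B. x t))"])
    have m: "h \<in> borel_measurable borel" if "h \<in> {sin, cos}" for h :: "real \<Rightarrow> real" using that by auto
    have c: "cylinder C (\<lambda>x. h (\<theta> * (\<Sum>t\<in>C. x t)))" if "h \<in> {sin, cos}" for C and h :: "real \<Rightarrow> real"
      by (rule cylinder_compose[where h = "\<lambda>y. h (\<theta> * y)"], rule cylinder_sum, rule cylinder_component[where f = "\<lambda>x. x"])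
         (use that m in \<open>auto intro: measurable_compose[of _ _ borel]\<close>)
    show "cylinder A (\<lambda>x. f (\<theta> * (\<Sum>t\<in>A. x t)))" "cylinder B (\<lambda>x. g (\<theta> * (\<Sum>t\<in>B. x t)))" using c that by auto
  qed (use that in auto)
  have i: "integrable M (\<lambda>\<omega>. f (?S A \<omega>) * g (?S B \<omega>))" if "f \<in> {sin, cos}" "g \<in> {sin, cos}" for f g :: "real \<Rightarrow> real"
    using that by (intro integrable_bounded[where B = 1]) (auto simp: abs_mult intro!: mult_le_one)
  have S: "?S (A \<union> B) \<omega> = ?S A \<omega> + ?S B \<omega>" for \<omega>
    using assms by (simp add: sum.union_disjoint distrib_left)
  let ?cc = "cov M (\<lambda>\<omega>. cos (?S A \<omega>)) (\<lambda>\<omega>. cos (?S B \<omega>))" and ?ss = "cov M (\<lambda>\<omega>. sin (?S A \<omega>)) (\<lambda>\<omega>. sin (?S B \<omega>))"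
    and ?cs = "cov M (\<lambda>\<omega>. cos (?S A \<omega>)) (\<lambda>\<omega>. sin (?S B \<omega>))" and ?sc = "cov M (\<lambda>\<omega>. sin (?S A \<omega>)) (\<lambda>\<omega>. cos (?S B \<omega>))"
  have eq: "char_sum (A \<union> B) \<theta> - char_sum A \<theta> * char_sum B \<theta> = Complex (?cc - ?ss) (?cs + ?sc)"
    unfolding char_sum_re_im S cos_add sin_add
    using i by (simp add: complex_eq_iff cov_def)
  have bound: "cmod (Complex (a - b) (c + d)) \<le> 4 * r" if "\<bar>a\<bar> \<le> r" "\<bar>b\<bar> \<le> r" "\<bar>c\<bar> \<le> r" "\<bar>d\<bar> \<le> r" for a b c d r :: real
  proof -
    have "cmod (Complex (a - b) (c + d)) \<le> \<bar>a - b\<bar> + \<bar>c + d\<bar>" using cmod_le[of "Complex (a - b) (c + d)"] by simp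
    moreover have "\<bar>a - b\<bar> \<le> r + r" by (rule order_trans[OF abs_triangle_ineq4 add_mono[OF that(1,2)]])
    moreover have "\<bar>c + d\<bar> \<le> r + r" by (rule order_trans[OF abs_triangle_ineq add_mono[OF that(3,4)]])
    ultimately show ?thesis by simp
  qed
  show ?thesis unfolding eq
    by (rule bound[OF mix[of cos cos] mix[of sin sin] mix[of cos sin] mix[of sin cos]]) auto
qed

lemma char_sum_shift: "finite A \<Longrightarrow> char_sum ((\<lambda>t. t + h) ` A) \<theta> = char_sum A \<theta>"
proof -
  assume A: "finite A"
  have s: "(\<Sum>t\<in>(\<lambda>t. t + h) ` A. X t \<omega>) = (\<Sum>t\<in>A. X (t + h) \<omega>)" for \<omega> by (subst sum.reindex) auto
  have c: "cylinder A (\<lambda>x. f (\<theta> * (\<Sum>t\<in>A. x t)))" if "f \<in> {sin, cos}" for f :: "real \<Rightarrow> real"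
    by (rule cylinder_compose[where h = "\<lambda>y. f (\<theta> * y)"], rule cylinder_sum, rule cylinder_component[where f = "\<lambda>x. x"])
       (use that in \<open>auto intro: measurable_compose[of _ _ borel]\<close>)
  show ?thesis unfolding char_sum_re_im s
    using expectation_shift[OF A c[of cos], of h] expectation_shift[OF A c[of sin], of h] by simp
qed

section \<open>Bernstein blocks and the central limit theorem\<close>

definition block :: "nat \<Rightarrow> nat \<Rightarrow> nat \<Rightarrow> int set" where
  "block p q j = {int (j * (p + q)) + 1..int (j * (p + q)) + int p}"

definition blocks :: "nat \<Rightarrow> nat \<Rightarrow> nat \<Rightarrow> int set" where "blocks p q N = (\<Union>j<N. block p q j)"

lemma finite_blocks: "finite (blocks p q N)" by (simp add: blocks_def block_def)

lemma blocks_Suc: "blocks p q (Suc N) = blocks p q N \<union> block p q N" by (auto simp: blocks_def less_Suc_eq)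

lemma blocks_subset: "blocks p q N \<subseteq> {1..int (N * (p + q)) - int q}"
proof
  fix t assume "t \<in> blocks p q N"
  then obtain j where j: "j < N" "t \<in> block p q j" by (auto simp: blocks_def)
  have "(j + 1) * (p + q) \<le> N * (p + q)" using j(1) by (intro mult_right_mono) auto
  then have "j * (p + q) + (p + q) \<le> N * (p + q)" by simp
  then have "int (j * (p + q)) + int (p + q) \<le> int (N * (p + q))" by linarith
  then show "t \<in> {1..int (N * (p + q)) - int q}"
    using j(2) of_nat_0_le_iff[of "j * (p + q)", where 'a = int] unfolding block_def atLeastAtMost_iff by linarith
qed

lemma block_disjoint: "blocks p q N \<inter> block p q N = {}"
  using blocks_subset[of p q N] by (force simp: block_def)

lemma card_blocks: "card (blocks p q N) = N * p"
proof (induction N)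
  case (Suc N)
  have "card (block p q N) = p" by (simp add: block_def)
  then show ?case unfolding blocks_Suc using Suc block_disjoint[of p q N] finite_blocks[of p q N]
    by (subst card_Un_disjoint) (auto simp: block_def)
qed (simp add: blocks_def)

text \<open>Each split costs 4 \<open>alpha\<close> q, and earlier errors do not grow since
  characteristic functions have modulus at most 1.\<close>

lemma char_sum_blocks: "cmod (char_sum (blocks p q N) \<theta> - char_sum {1..int p} \<theta> ^ N) \<le> 4 * real N * alpha q"
proof (induction N)
  case 0
  then show ?case by (simp add: blocks_def char_sum_def prob_space)
next
  case (Suc N)
  let ?\<psi> = "char_sum {1..int p} \<theta>" and ?A = "blocks p q N" and ?B = "block p q N"
  have Bs: "?B = (\<lambda>t. t + int (N * (p + q))) ` {1..int p}" by (simp add: block_def add.commute)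
  have \<psi>: "char_sum ?B \<theta> = ?\<psi>" unfolding Bs by (rule char_sum_shift) simp
  have 1: "cmod (char_sum (?A \<union> ?B) \<theta> - char_sum ?A \<theta> * ?\<psi>) \<le> 4 * alpha q"
    unfolding \<psi>[symmetric]
    by (rule char_sum_mixing[where s = "int (N * (p + q)) - int q"])
       (use blocks_subset[of p q N] block_disjoint[of p q N] finite_blocks[of p q N] in \<open>auto simp: block_def\<close>)
  have "cmod ((char_sum ?A \<theta> - ?\<psi> ^ N) * ?\<psi>) \<le> (4 * real N * alpha q) * 1"
    unfolding norm_mult using Suc char_sum_norm alpha_nonneg by (intro mult_mono) auto
  then have 2: "cmod (char_sum ?A \<theta> * ?\<psi> - ?\<psi> ^ Suc N) \<le> 4 * real N * alpha q" by (simp add: algebra_simps)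
  have "cmod (char_sum (?A \<union> ?B) \<theta> - ?\<psi> ^ Suc N) \<le> 4 * alpha q + 4 * real N * alpha q"
    using norm_triangle_ineq[of "char_sum (?A \<union> ?B) \<theta> - char_sum ?A \<theta> * ?\<psi>" "char_sum ?A \<theta> * ?\<psi> - ?\<psi> ^ Suc N"] 1 2
    by simp
  then show ?case unfolding blocks_Suc by (simp add: algebra_simps)
qed

end

context fast_mixing_process
begin

lemma X_square_integrable: "integrable M (\<lambda>\<omega>. (X t \<omega>)\<^sup>2)"
  using square_integrable[of "\<lambda>x. x"] by simp

lemma X_integrable: "integrable M (X t)"
  using integrable_dominated[of "\<lambda>x. x"] by simp

definition block_var :: "nat \<Rightarrow> real" where
  "block_var p = expectation (\<lambda>\<omega>. (\<Sum>t\<in>{1..int p}. X t \<omega>)\<^sup>2)"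

lemma sum_square_integrable:
  assumes "expectation (X 0) = 0"
  shows "integrable M (\<lambda>\<omega>. (\<Sum>t\<in>A. X t \<omega>)\<^sup>2)"
  using centered_sum_square(1)[of "\<lambda>x. x" A] assms by simp

text \<open>Lipschitz continuity and Jensen's inequality reduce the deletion to the second moment of
  the deleted sum, which is linear in the number of deleted indices.\<close>

lemma char_sum_remove_gap:
  assumes mean: "expectation (X 0) = 0" and A: "finite A" "B \<subseteq> A"
  shows "cmod (char_sum A \<theta> - char_sum B \<theta>) \<le> \<bar>\<theta>\<bar> * sqrt (var_const * real (card A - card B))"
proof -
  let ?S = "\<lambda>A \<omega>. \<Sum>t\<in>A. X t \<omega>"
  have fin: "finite (A - B)" using A by simp
  have G: "?S A \<omega> - ?S B \<omega> = ?S (A - B) \<omega>" for \<omega> using A by (simp add: sum_diff)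
  have i: "integrable M (\<lambda>\<omega>. ?S (A - B) \<omega>)" using X_integrable by simp
  have "cmod (char_sum A \<theta> - char_sum B \<theta>) = cmod (expectation (\<lambda>\<omega>. iexp (\<theta> * ?S A \<omega>) - iexp (\<theta> * ?S B \<omega>)))"
    unfolding char_sum_def
    using integrable_iexp[of "\<lambda>\<omega>. \<theta> * ?S A \<omega>"] integrable_iexp[of "\<lambda>\<omega>. \<theta> * ?S B \<omega>"]
    by (subst Bochner_Integration.integral_diff) auto
  also have "\<dots> \<le> expectation (\<lambda>\<omega>. cmod (iexp (\<theta> * ?S A \<omega>) - iexp (\<theta> * ?S B \<omega>)))" by (rule integral_norm_bound)
  also have "\<dots> \<le> expectation (\<lambda>\<omega>. \<bar>\<theta>\<bar> * \<bar>?S (A - B) \<omega>\<bar>)"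
  proof (rule integral_mono)
    show "integrable M (\<lambda>\<omega>. cmod (iexp (\<theta> * ?S A \<omega>) - iexp (\<theta> * ?S B \<omega>)))"
      by (intro integrable_norm Bochner_Integration.integrable_diff integrable_iexp) auto
    show "cmod (iexp (\<theta> * ?S A \<omega>) - iexp (\<theta> * ?S B \<omega>)) \<le> \<bar>\<theta>\<bar> * \<bar>?S (A - B) \<omega>\<bar>" for \<omega>
      using iexp_lipschitz[of "\<theta> * ?S A \<omega>" "\<theta> * ?S B \<omega>"] by (simp add: G[symmetric] abs_mult flip: right_diff_distrib)
  qed (use i in auto)
  also have "\<dots> = \<bar>\<theta>\<bar> * expectation (\<lambda>\<omega>. \<bar>?S (A - B) \<omega>\<bar>)" by simp
  also have "\<dots> \<le> \<bar>\<theta>\<bar> * sqrt (var_const * real (card A - card B))"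
  proof (rule mult_left_mono)
    have "expectation (\<lambda>\<omega>. \<bar>?S (A - B) \<omega>\<bar>) \<le> sqrt (expectation (\<lambda>\<omega>. (?S (A - B) \<omega>)\<^sup>2))"
      by (rule abs_expectation_le_sqrt) (use sum_square_integrable[OF mean] in auto)
    also have "expectation (\<lambda>\<omega>. (?S (A - B) \<omega>)\<^sup>2) \<le> var_const * real (card (A - B))"
      using centered_sum_var_const[of "\<lambda>x. x" "A - B"] fin mean by simp
    also have "card (A - B) = card A - card B" using A by (intro card_Diff_subset) (auto intro: finite_subset)
    finally show "expectation (\<lambda>\<omega>. \<bar>?S (A - B) \<omega>\<bar>) \<le> sqrt (var_const * real (card A - card B))" by simp
  qed simp
  finally show ?thesis .
qed

text \<open>The remainder Z has second moment at most e p. The truncated part Y is bounded by 2 K p,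
  so its third absolute moment is at most 2 K p times a second moment of order p. For blocks of
  length u sqrt n and \<theta> of order 1 / sqrt n, the cubic errors of all blocks add up to order
  u.\<close>

lemma char_sum_block_expansion:
  assumes mean: "expectation (X 0) = 0" and K: "K > 0"
    and trunc: "\<And>A. finite A \<Longrightarrow> expectation (\<lambda>\<omega>. (\<Sum>t\<in>A. (X t \<omega> - clip K (X t \<omega>)) - expectation (\<lambda>\<omega>. X 0 \<omega> - clip K (X 0 \<omega>)))\<^sup>2) \<le> e * real (card A)"
  shows "cmod (char_sum {1..int p} \<theta> - of_real (1 - \<theta>\<^sup>2 * block_var p / 2))
      \<le> 4 * \<theta>\<^sup>2 * e * real p + 8 / 3 * \<bar>\<theta>\<bar> ^ 3 * K * var_const * (real p)\<^sup>2"
proof -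
  let ?A = "{1..int p}"
  define S where "S \<omega> = (\<Sum>t\<in>?A. X t \<omega>)" for \<omega>
  define m where "m = expectation (\<lambda>\<omega>. clip K (X 0 \<omega>))"
  define Y where "Y \<omega> = (\<Sum>t\<in>?A. clip K (X t \<omega>) - m)" for \<omega>
  define Z where "Z \<omega> = (\<Sum>t\<in>?A. (X t \<omega> - clip K (X t \<omega>)) - expectation (\<lambda>\<omega>. X 0 \<omega> - clip K (X 0 \<omega>)))" for \<omega>
  have f1: "clip K \<in> borel_measurable borel" "\<And>x. \<bar>clip K x\<bar> \<le> \<bar>x\<bar>" using abs_clip_le_abs[of K] K by auto
  have f2: "(\<lambda>x. x - clip K x) \<in> borel_measurable borel" "\<And>x. \<bar>x - clip K x\<bar> \<le> \<bar>x\<bar>" using abs_diff_clip_le_abs[of K] K by (auto simp del: abs_diff_le_iff)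
  have [measurable]: "S \<in> borel_measurable M" "Y \<in> borel_measurable M" "Z \<in> borel_measurable M"
    unfolding S_def Y_def Z_def by measurable
  have ic: "integrable M (\<lambda>\<omega>. clip K (X 0 \<omega>))" using integrable_dominated[OF f1] .
  \<comment> \<open>As X 0 has mean 0, the centrings of Y and Z cancel and Y + Z is the sum
    itself.\<close>
  have m2: "expectation (\<lambda>\<omega>. X 0 \<omega> - clip K (X 0 \<omega>)) = - m" using ic X_integrable[of 0] mean by (simp add: m_def)
  have SYZ: "S \<omega> = Y \<omega> + Z \<omega>" for \<omega> unfolding S_def Y_def Z_def m2 by (simp flip: sum.distrib)
  have Y2: "integrable M (\<lambda>\<omega>. (Y \<omega>)\<^sup>2)" unfolding Y_def m_def by (rule centered_sum_square(1)[OF f1])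
  have Z2: "integrable M (\<lambda>\<omega>. (Z \<omega>)\<^sup>2)" unfolding Z_def by (rule centered_sum_square(1)[OF f2])
  have S2: "integrable M (\<lambda>\<omega>. (S \<omega>)\<^sup>2)" unfolding S_def by (rule sum_square_integrable[OF mean])
  have S1: "integrable M S" unfolding S_def using X_integrable by simp
  have ES: "expectation S = 0"
    unfolding S_def using X_integrable expectation_marginal[of "\<lambda>x. x"] mean by simp
  have EY: "expectation (\<lambda>\<omega>. (Y \<omega>)\<^sup>2) \<le> var_const * real p"
    using centered_sum_var_const[OF f1, of ?A] unfolding Y_def m_def by simp
  have EZ: "expectation (\<lambda>\<omega>. (Z \<omega>)\<^sup>2) \<le> e * real p" using trunc[of ?A] unfolding Z_def by simp
  have mK: "\<bar>m\<bar> \<le> K"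
  proof -
    have "\<bar>m\<bar> \<le> expectation (\<lambda>\<omega>. \<bar>clip K (X 0 \<omega>)\<bar>)" unfolding m_def by simp
    also have "\<dots> \<le> expectation (\<lambda>\<omega>. K)" using ic K abs_clip_le[of K] by (intro integral_mono) auto
    finally show ?thesis by (simp add: prob_space)
  qed
  have Yb: "\<bar>Y \<omega>\<bar> \<le> 2 * K * real p" for \<omega>
  proof -
    have "\<bar>Y \<omega>\<bar> \<le> (\<Sum>t\<in>?A. \<bar>clip K (X t \<omega>) - m\<bar>)" unfolding Y_def by (rule sum_abs)
    also have "\<dots> \<le> (\<Sum>t\<in>?A. 2 * K)"
    proof (rule sum_mono)
      fix t show "\<bar>clip K (X t \<omega>) - m\<bar> \<le> 2 * K" using abs_clip_le[of K "X t \<omega>"] K mK by linarith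
    qed
    finally show ?thesis by (simp add: mult_ac)
  qed
  have Y3: "\<bar>Y \<omega>\<bar> ^ 3 \<le> 2 * K * real p * (Y \<omega>)\<^sup>2" for \<omega>
  proof -
    have "\<bar>Y \<omega>\<bar> ^ 3 = \<bar>Y \<omega>\<bar> * (Y \<omega>)\<^sup>2" by (simp add: numeral_eq_Suc abs_mult_self_eq mult.assoc)
    then show ?thesis using Yb[of \<omega>] by (simp add: mult_right_mono)
  qed
  let ?T = "\<lambda>\<omega>. iexp (\<theta> * S \<omega>) - (1 + \<i> * (\<theta> * S \<omega>) - of_real ((\<theta> * S \<omega>)\<^sup>2 / 2))"
  have icS: "integrable M (\<lambda>\<omega>. complex_of_real (S \<omega>))" "integrable M (\<lambda>\<omega>. complex_of_real ((S \<omega>)\<^sup>2))"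
    by (intro integrable_of_real S1 S2)+
  have Tint: "integrable M ?T"
  proof -
    have "?T = (\<lambda>\<omega>. iexp (\<theta> * S \<omega>) - (1 + (\<i> * \<theta>) * complex_of_real (S \<omega>) - of_real (\<theta>\<^sup>2 / 2) * complex_of_real ((S \<omega>)\<^sup>2)))"
      by (simp add: fun_eq_iff power_mult_distrib)
    then show ?thesis using icS integrable_iexp[of "\<lambda>\<omega>. \<theta> * S \<omega>"] by simp
  qed
  have "char_sum ?A \<theta> - of_real (1 - \<theta>\<^sup>2 * block_var p / 2) = expectation ?T"
  proof -
    have "expectation ?T = expectation (\<lambda>\<omega>. iexp (\<theta> * S \<omega>) - (1 + (\<i> * \<theta>) * complex_of_real (S \<omega>) - of_real (\<theta>\<^sup>2 / 2) * complex_of_real ((S \<omega>)\<^sup>2)))"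
      by (simp add: power_mult_distrib mult.assoc)
    also have "\<dots> = expectation (\<lambda>\<omega>. iexp (\<theta> * S \<omega>)) - (1 + (\<i> * \<theta>) * of_real (expectation S) - of_real (\<theta>\<^sup>2 / 2) * of_real (expectation (\<lambda>\<omega>. (S \<omega>)\<^sup>2)))"
      using icS integrable_iexp[of "\<lambda>\<omega>. \<theta> * S \<omega>"] by (simp add: prob_space del: of_real_power)
    finally show ?thesis unfolding ES by (simp add: char_sum_def S_def block_var_def)
  qed
  also have "cmod \<dots> \<le> expectation (\<lambda>\<omega>. cmod (?T \<omega>))" by (rule integral_norm_bound)
  also have "\<dots> \<le> expectation (\<lambda>\<omega>. 4 * \<theta>\<^sup>2 * (Z \<omega>)\<^sup>2 + 4 / 3 * \<bar>\<theta>\<bar> ^ 3 * (2 * K * real p * (Y \<omega>)\<^sup>2))"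
  proof (rule integral_mono)
    show "integrable M (\<lambda>\<omega>. cmod (?T \<omega>))" using Tint by (rule integrable_norm)
    fix \<omega>
    have "cmod (?T \<omega>) \<le> 4 * \<theta>\<^sup>2 * (Z \<omega>)\<^sup>2 + 4 / 3 * \<bar>\<theta>\<bar> ^ 3 * \<bar>Y \<omega>\<bar> ^ 3"
      unfolding SYZ by (rule iexp_second_order_split)
    also have "\<dots> \<le> 4 * \<theta>\<^sup>2 * (Z \<omega>)\<^sup>2 + 4 / 3 * \<bar>\<theta>\<bar> ^ 3 * (2 * K * real p * (Y \<omega>)\<^sup>2)"
      by (intro add_left_mono mult_left_mono Y3) auto
    finally show "cmod (?T \<omega>) \<le> 4 * \<theta>\<^sup>2 * (Z \<omega>)\<^sup>2 + 4 / 3 * \<bar>\<theta>\<bar> ^ 3 * (2 * K * real p * (Y \<omega>)\<^sup>2)" .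
  qed (use Y2 Z2 in auto)
  also have "\<dots> = 4 * \<theta>\<^sup>2 * expectation (\<lambda>\<omega>. (Z \<omega>)\<^sup>2) + 4 / 3 * \<bar>\<theta>\<bar> ^ 3 * (2 * K * real p * expectation (\<lambda>\<omega>. (Y \<omega>)\<^sup>2))"
    using Y2 Z2 by simp
  also have "\<dots> \<le> 4 * \<theta>\<^sup>2 * (e * real p) + 4 / 3 * \<bar>\<theta>\<bar> ^ 3 * (2 * K * real p * (var_const * real p))"
    using EY EZ K by (intro add_mono mult_left_mono) auto
  also have "\<dots> = 4 * \<theta>\<^sup>2 * e * real p + 8 / 3 * \<bar>\<theta>\<bar> ^ 3 * K * var_const * (real p)\<^sup>2"
    by (simp add: power2_eq_square)
  finally show ?thesis .
qed

end

lemma tendsto_floor_sqrt: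
  assumes "c \<ge> 0"
  shows "(\<lambda>n. real (nat \<lfloor>c * sqrt (real n)\<rfloor>) / sqrt (real n)) \<longlonglongrightarrow> c"
proof (rule tendsto_sandwich[OF _ _ _ tendsto_const])
  have "(\<lambda>n. c - 1 / sqrt (real n)) \<longlonglongrightarrow> c - 0"
    by (intro tendsto_intros tendsto_divide_0[OF tendsto_const] filterlim_at_top_imp_at_infinity
        filterlim_compose[OF sqrt_at_top filterlim_real_sequentially])
  then show "(\<lambda>n. c - 1 / sqrt (real n)) \<longlonglongrightarrow> c" by simp
  have fl: "real (nat \<lfloor>c * sqrt (real n)\<rfloor>) = of_int \<lfloor>c * sqrt (real n)\<rfloor>" for n using assms by simp
  show "eventually (\<lambda>n. real (nat \<lfloor>c * sqrt (real n)\<rfloor>) / sqrt (real n) \<le> c) sequentially"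
    using eventually_gt_at_top[of 0] by eventually_elim (simp only: fl, simp add: pos_divide_le_eq)
  show "eventually (\<lambda>n. c - 1 / sqrt (real n) \<le> real (nat \<lfloor>c * sqrt (real n)\<rfloor>) / sqrt (real n)) sequentially"
    using eventually_gt_at_top[of 0]
  proof eventually_elim
    case (elim n)
    have "c * sqrt (real n) - 1 \<le> real (nat \<lfloor>c * sqrt (real n)\<rfloor>)" unfolding fl by linarith
    then have "(c * sqrt (real n) - 1) / sqrt (real n) \<le> real (nat \<lfloor>c * sqrt (real n)\<rfloor>) / sqrt (real n)"
      by (rule divide_right_mono) simp
    then show ?case using elim by (simp add: diff_divide_distrib)
  qed
qed

context fast_mixing_process
begin

lemma long_run_var_nonneg:
  assumes "expectation (X 0) = 0" shows "long_run_var M X \<ge> 0"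
  by (rule tendsto_lowerbound[OF block_variance_tendsto[OF assms]]) (auto intro!: always_eventually)

text \<open>Three comparisons are chained: the gaps are deleted, the blocks are decoupled, and the
  N-th power of the characteristic function of one block is compared with that of exp (-x), which
  multiplies the error of a single factor by N. The single factor passes through its second-order
  expansion and 1 - x.\<close>

lemma char_sum_bound:
  assumes mean: "expectation (X 0) = 0" and K: "K > 0"
    and trunc: "\<And>A. finite A \<Longrightarrow> expectation (\<lambda>\<omega>. (\<Sum>t\<in>A. (X t \<omega> - clip K (X t \<omega>)) - expectation (\<lambda>\<omega>. X 0 \<omega> - clip K (X 0 \<omega>)))\<^sup>2) \<le> e * real (card A)"
    and N: "N * (p + q) \<le> n" and v: "v \<ge> 0"
  shows "cmod (char_sum {1..int n} \<theta> - of_real (exp (- (real N * (real p * \<theta>\<^sup>2 * v / 2)))))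
     \<le> \<bar>\<theta>\<bar> * sqrt (var_const * real (n - N * p)) + 4 * real N * alpha q
       + real N * (4 * \<theta>\<^sup>2 * e * real p + 8 / 3 * \<bar>\<theta>\<bar> ^ 3 * K * var_const * (real p)\<^sup>2
           + \<theta>\<^sup>2 / 2 * \<bar>block_var p - real p * v\<bar> + (real p * \<theta>\<^sup>2 * v / 2)\<^sup>2 / 2)"
proof -
  define x where "x = real p * \<theta>\<^sup>2 * v / 2"
  have x: "x \<ge> 0" using v by (simp add: x_def)
  let ?\<psi> = "char_sum {1..int p} \<theta>" and ?A = "blocks p q N" and ?V = "block_var p"
  have sub: "?A \<subseteq> {1..int n}"
  proof -
    have "int (N * (p + q)) \<le> int n" using N by (simp only: of_nat_le_iff)
    then show ?thesis using blocks_subset[of p q N] by force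
  qed
  have 1: "cmod (char_sum {1..int n} \<theta> - char_sum ?A \<theta>) \<le> \<bar>\<theta>\<bar> * sqrt (var_const * real (n - N * p))"
    using char_sum_remove_gap[OF mean _ sub, of \<theta>] by (simp add: card_blocks)
  have 2: "cmod (char_sum ?A \<theta> - ?\<psi> ^ N) \<le> 4 * real N * alpha q" by (rule char_sum_blocks)
  have a: "cmod (?\<psi> - of_real (1 - \<theta>\<^sup>2 * ?V / 2)) \<le> 4 * \<theta>\<^sup>2 * e * real p + 8 / 3 * \<bar>\<theta>\<bar> ^ 3 * K * var_const * (real p)\<^sup>2"
    by (rule char_sum_block_expansion[OF mean K trunc])
  have b: "cmod (of_real (1 - \<theta>\<^sup>2 * ?V / 2) - of_real (1 - x)) \<le> \<theta>\<^sup>2 / 2 * \<bar>?V - real p * v\<bar>"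
  proof -
    have "(1 - \<theta>\<^sup>2 * ?V / 2) - (1 - x) = - (\<theta>\<^sup>2 / 2 * (?V - real p * v))" by (simp add: x_def algebra_simps diff_divide_distrib)
    then have "\<bar>(1 - \<theta>\<^sup>2 * ?V / 2) - (1 - x)\<bar> = \<theta>\<^sup>2 / 2 * \<bar>?V - real p * v\<bar>" by (simp only: abs_minus_cancel) (simp add: abs_mult)
    then show ?thesis by (simp flip: of_real_diff)
  qed
  have c: "cmod (of_real (1 - x) - of_real (exp (- x))) \<le> x\<^sup>2 / 2"
    using exp_minus_second_order[OF x] by (simp flip: of_real_diff)
  have "cmod (?\<psi> - of_real (exp (- x))) \<le> cmod (?\<psi> - of_real (1 - \<theta>\<^sup>2 * ?V / 2)) + cmod (of_real (1 - \<theta>\<^sup>2 * ?V / 2) - of_real (exp (- x)))"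
    by (rule norm_diff_triangle_le[OF order_refl order_refl])
  also have "cmod (of_real (1 - \<theta>\<^sup>2 * ?V / 2) - of_real (exp (- x))) \<le> cmod (of_real (1 - \<theta>\<^sup>2 * ?V / 2) - of_real (1 - x)) + cmod (of_real (1 - x) - of_real (exp (- x)))"
    by (rule norm_diff_triangle_le[OF order_refl order_refl])
  finally have abc: "cmod (?\<psi> - of_real (exp (- x))) \<le> 4 * \<theta>\<^sup>2 * e * real p + 8 / 3 * \<bar>\<theta>\<bar> ^ 3 * K * var_const * (real p)\<^sup>2
           + \<theta>\<^sup>2 / 2 * \<bar>?V - real p * v\<bar> + x\<^sup>2 / 2"
    using a b c by linarith
  have "cmod (?\<psi> ^ N - of_real (exp (- x)) ^ N) \<le> real N * cmod (?\<psi> - of_real (exp (- x)))"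
    by (rule norm_power_diff) (use x char_sum_norm in auto)
  also have "\<dots> \<le> real N * (4 * \<theta>\<^sup>2 * e * real p + 8 / 3 * \<bar>\<theta>\<bar> ^ 3 * K * var_const * (real p)\<^sup>2
           + \<theta>\<^sup>2 / 2 * \<bar>?V - real p * v\<bar> + x\<^sup>2 / 2)"
    using abc by (intro mult_left_mono) auto
  also have "of_real (exp (- x)) ^ N = complex_of_real (exp (- (real N * x)))"
    by (simp flip: of_real_power exp_of_nat_mult)
  finally have 3: "cmod (?\<psi> ^ N - of_real (exp (- (real N * x)))) \<le> real N * (4 * \<theta>\<^sup>2 * e * real p + 8 / 3 * \<bar>\<theta>\<bar> ^ 3 * K * var_const * (real p)\<^sup>2
           + \<theta>\<^sup>2 / 2 * \<bar>?V - real p * v\<bar> + x\<^sup>2 / 2)" .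
  show ?thesis using norm_diff_triangle_le[OF norm_diff_triangle_le[OF 1 2] 3] by (simp add: x_def)
qed

text \<open>Bernstein blocks of length u sqrt n separated by gaps of length u^2 sqrt n: first n tends to
  infinity for fixed u, then u tends to 0. Summability of the mixing coefficients makes the
  decoupling error of order (n / (p q)) (q alpha q) vanish.\<close>
lemma char_sum_tendsto:
  assumes mean: "expectation (X 0) = 0"
  shows "(\<lambda>n. char_sum {1..int n} (\<tau> / sqrt (real n))) \<longlonglongrightarrow> of_real (exp (- (\<tau>\<^sup>2 * long_run_var M X / 2)))"
proof (rule tendstoI)
  fix r :: real assume r: "r > 0"
  define v where "v = long_run_var M X"
  have v: "v \<ge> 0" unfolding v_def by (rule long_run_var_nonneg[OF mean])
  define s where "s = \<tau>\<^sup>2 * v / 2"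
  \<comment> \<open>Makes 4 \<tau>^2 e at most r / 2; the summand 1 covers \<tau> = 0.\<close>
  define e where "e = r / (8 * (\<tau>\<^sup>2 + 1))"
  have \<tau>1: "\<tau>\<^sup>2 + 1 > 0" by (simp add: add_nonneg_pos)
  have e: "e > 0" "4 * \<tau>\<^sup>2 * e < r"
  proof -
    show "e > 0" using r \<tau>1 by (simp add: e_def)
    have "4 * \<tau>\<^sup>2 * r \<le> 4 * (\<tau>\<^sup>2 + 1) * r" using r by (intro mult_right_mono) auto
    also have "\<dots> < r * (8 * (\<tau>\<^sup>2 + 1))" using mult_pos_pos[OF r \<tau>1] by (simp add: algebra_simps)
    finally show "4 * \<tau>\<^sup>2 * e < r" using \<tau>1 by (simp add: e_def pos_divide_less_eq)
  qed
  obtain K where K: "K > 0"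
    and trunc: "\<And>A. finite A \<Longrightarrow> expectation (\<lambda>\<omega>. (\<Sum>t\<in>A. (X t \<omega> - clip K (X t \<omega>)) - expectation (\<lambda>\<omega>. X 0 \<omega> - clip K (X 0 \<omega>)))\<^sup>2) \<le> e * real (card A)"
    using truncation_error_small[OF e(1)] by blast
  \<comment> \<open>The error that survives as n grows: x is the fraction of the sample covered by
    blocks, y the block length divided by sqrt n. As u tends to 0 they tend to 1 and 0, and only 4
    \<tau>^2 e remains.\<close>
  define L where "L x y = \<bar>\<tau>\<bar> * sqrt (var_const * (1 - x)) + 4 * \<tau>\<^sup>2 * e * x + 8 / 3 * \<bar>\<tau>\<bar> ^ 3 * K * var_const * x * y
     + \<bar>exp (- (x * s)) - exp (- s)\<bar>" for x y
  have "((\<lambda>u. L (1 / (1 + u)) u) \<longlongrightarrow> L (1 / (1 + 0)) 0) (at_right 0)"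
    unfolding L_def by (intro tendsto_intros tendsto_ident_at) auto
  moreover have "L (1 / (1 + 0)) 0 < r" using e by (simp add: L_def)
  ultimately have "eventually (\<lambda>u. L (1 / (1 + u)) u < r) (at_right 0)" by (rule order_tendstoD)
  then have "eventually (\<lambda>u. L (1 / (1 + u)) u < r \<and> u > 0) (at_right 0)"
    using eventually_at_right_less[of 0] by eventually_elim auto
  then obtain u where u: "L (1 / (1 + u)) u < r" "u > 0" using eventually_happens trivial_limit_at_right_real by blast
  define p where "p n = nat \<lfloor>u * sqrt (real n)\<rfloor>" for n
  define q where "q n = nat \<lfloor>u\<^sup>2 * sqrt (real n)\<rfloor>" for n
  define N where "N n = n div (p n + q n)" for n
  define y where "y n = real (p n) / sqrt (real n)" for n
  define z where "z n = real (q n) / sqrt (real n)" for n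
  define x where "x n = real (N n * p n) / real n" for n
  have y: "y \<longlonglongrightarrow> u" unfolding y_def p_def by (rule tendsto_floor_sqrt) (use u in simp)
  have z: "z \<longlonglongrightarrow> u\<^sup>2" unfolding z_def q_def by (rule tendsto_floor_sqrt) simp
  have top: "filterlim (\<lambda>n. nat \<lfloor>c * sqrt (real n)\<rfloor>) at_top sequentially" if "c > 0" for c
    by (intro filterlim_compose[OF filterlim_nat_sequentially] filterlim_compose[OF filterlim_floor_sequentially]
        filterlim_tendsto_pos_mult_at_top[OF tendsto_const that] filterlim_compose[OF sqrt_at_top filterlim_real_sequentially])
  have p_top: "filterlim p at_top sequentially" unfolding p_def by (rule top[OF u(2)])
  have q_top: "filterlim q at_top sequentially" unfolding q_def by (rule top) (use u in simp)
  have sq0: "(\<lambda>n. 1 / sqrt (real n)) \<longlonglongrightarrow> 0"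
    by (intro tendsto_divide_0[OF tendsto_const] filterlim_at_top_imp_at_infinity
        filterlim_compose[OF sqrt_at_top filterlim_real_sequentially])
  have p_pos: "eventually (\<lambda>n. p n > 0) sequentially" using p_top[unfolded filterlim_at_top, rule_format, of 1] by (simp add: Suc_le_eq)
  have q_pos: "eventually (\<lambda>n. q n > 0) sequentially" using q_top[unfolded filterlim_at_top, rule_format, of 1] by (simp add: Suc_le_eq)
  \<comment> \<open>Blocks of length p in periods of p + q cover the fraction u / (u + u^2) in the
    limit; rounding the number of periods changes it by at most p / n.\<close>
  have x: "x \<longlonglongrightarrow> 1 / (1 + u)"
  proof -
    have "u + u\<^sup>2 > 0" using u(2) by (intro add_pos_pos) auto
    then have "(\<lambda>n. y n / (y n + z n)) \<longlonglongrightarrow> u / (u + u\<^sup>2)"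
      by (intro tendsto_divide tendsto_add y z) linarith
    moreover have "u / (u + u\<^sup>2) = 1 / (1 + u)"
    proof -
      have "u + u\<^sup>2 = u * (1 + u)" by (simp add: power2_eq_square algebra_simps)
      then show ?thesis using u by simp
    qed
    ultimately have lim: "(\<lambda>n. y n / (y n + z n)) \<longlonglongrightarrow> 1 / (1 + u)" by simp
    have "(\<lambda>n. y n / (y n + z n) - y n * (1 / sqrt (real n))) \<longlonglongrightarrow> 1 / (1 + u) - u * 0"
      by (intro tendsto_diff tendsto_mult lim y sq0)
    then have lim2: "(\<lambda>n. y n / (y n + z n) - y n * (1 / sqrt (real n))) \<longlonglongrightarrow> 1 / (1 + u)" by simp
    have "eventually (\<lambda>n. y n / (y n + z n) - y n * (1 / sqrt (real n)) \<le> x n \<and> x n \<le> y n / (y n + z n)) sequentially"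
      using p_pos eventually_gt_at_top[of 0]
    proof eventually_elim
      case (elim n)
      let ?p = "real (p n)" and ?m = "real (p n + q n)" and ?N = "real (N n)"
      have yz: "y n / (y n + z n) = ?p / ?m"
        using elim by (simp add: y_def z_def add_divide_distrib[symmetric])
      have yn: "y n * (1 / sqrt (real n)) = ?p / real n" using elim by (simp add: y_def)
      have m: "?m > 0" using elim by simp
      have "N n * (p n + q n) \<le> n" by (simp add: N_def)
      then have le: "?N * ?m \<le> real n" by (metis of_nat_le_iff of_nat_mult)
      have "n < (p n + q n) * (N n + 1)" unfolding N_def using elim by (metis Suc_eq_plus1 add_pos_nonneg dividend_less_times_div mult_Suc_right zero_le)
      then have "real n < real ((p n + q n) * (N n + 1))" by (simp only: of_nat_less_iff)
      then have lt: "real n < ?m * (?N + 1)" by (simp only: of_nat_mult of_nat_add of_nat_1)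
      have "x n \<le> ?p / ?m"
      proof -
        have "?N * ?p * ?m \<le> ?p * real n" using mult_left_mono[OF le, of ?p] by (simp add: mult_ac)
        then show ?thesis using elim m by (simp add: x_def divide_le_eq le_divide_eq pos_divide_le_eq mult_ac)
      qed
      moreover have "?p / ?m - ?p / real n \<le> x n"
      proof -
        have "real n / ?m - 1 \<le> ?N" using lt m by (simp add: field_simps)
        then have "(real n / ?m - 1) * (?p / real n) \<le> ?N * (?p / real n)" by (intro mult_right_mono) auto
        moreover have "(real n / ?m - 1) * (?p / real n) = ?p / ?m - ?p / real n" using elim by (simp add: left_diff_distrib diff_divide_distrib)
        ultimately show ?thesis by (simp add: x_def)
      qed
      ultimately show ?case unfolding yz yn by simp
    qed
    then show ?thesis
      by (intro tendsto_sandwich[OF _ _ lim2 lim]) (auto elim: eventually_mono)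
  qed
  \<comment> \<open>In rescaled variables N equals x q / (y z), so N \<open>alpha\<close> q is a
    bounded multiple of q \<open>alpha\<close> q.\<close>
  have mixing: "(\<lambda>n. real (N n) * alpha (q n)) \<longlonglongrightarrow> 0"
  proof -
    have "(\<lambda>n. x n / (y n * z n) * (real (q n) * alpha (q n))) \<longlonglongrightarrow> (1 / (1 + u)) / (u * u\<^sup>2) * 0"
      by (intro tendsto_intros x y z filterlim_compose[OF n_alpha_tendsto_0 q_top]) (use u in auto)
    then have lim: "(\<lambda>n. x n / (y n * z n) * (real (q n) * alpha (q n))) \<longlonglongrightarrow> 0" by simp
    show ?thesis
    proof (rule Lim_transform_eventually[OF lim])
      show "eventually (\<lambda>n. x n / (y n * z n) * (real (q n) * alpha (q n)) = real (N n) * alpha (q n)) sequentially"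
        using p_pos q_pos eventually_gt_at_top[of 0] by eventually_elim (simp add: x_def y_def z_def)
    qed
  qed
  have var: "(\<lambda>n. \<bar>block_var (p n) / real (p n) - v\<bar>) \<longlonglongrightarrow> 0"
  proof -
    have "(\<lambda>n. block_var (p n) / real (p n)) \<longlonglongrightarrow> v"
      unfolding v_def block_var_def by (rule filterlim_compose[OF block_variance_tendsto[OF mean] p_top])
    then show ?thesis using tendsto_rabs_zero LIM_zero by fastforce
  qed
  \<comment> \<open>The bound of \<open>char_sum_bound\<close> in rescaled form, together with the
    cost of replacing x n by 1 in the exponent: L at the current x and y plus three terms that
    vanish as n grows.\<close>
  define R where "R n = L (x n) (y n) + (4 * (real (N n) * alpha (q n)) + \<tau>\<^sup>2 / 2 * x n * \<bar>block_var (p n) / real (p n) - v\<bar>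
       + \<tau> ^ 4 * v\<^sup>2 / 8 * x n * y n * (1 / sqrt (real n)))" for n
  have "R \<longlonglongrightarrow> L (1 / (1 + u)) u + (4 * 0 + \<tau>\<^sup>2 / 2 * (1 / (1 + u)) * 0 + \<tau> ^ 4 * v\<^sup>2 / 8 * (1 / (1 + u)) * u * 0)"
    unfolding R_def L_def by (intro tendsto_intros x y mixing var sq0)
  then have "R \<longlonglongrightarrow> L (1 / (1 + u)) u" by simp
  then have "eventually (\<lambda>n. R n < r) sequentially" using u by (intro order_tendstoD) auto
  then show "eventually (\<lambda>n. dist (char_sum {1..int n} (\<tau> / sqrt (real n))) (of_real (exp (- (\<tau>\<^sup>2 * long_run_var M X / 2)))) < r) sequentially"
    using p_pos eventually_gt_at_top[of 0]
  proof eventually_elim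
    case (elim n)
    define \<theta> where "\<theta> = \<tau> / sqrt (real n)"
    have \<theta>2: "\<theta>\<^sup>2 = \<tau>\<^sup>2 / real n" by (simp add: \<theta>_def power_divide)
    have sqn: "sqrt (real n) > 0" using elim by simp
    have sqn2: "sqrt (real n) * sqrt (real n) = real n" by simp
    have Nle: "N n * (p n + q n) \<le> n" by (simp add: N_def)
    have Np: "N n * p n \<le> n" using Nle by (metis add_leD1 distrib_left)
    let ?b = "block_var (p n)" and ?p = "real (p n)" and ?N = "real (N n)"
    have t1: "\<bar>\<theta>\<bar> * sqrt (var_const * real (n - N n * p n)) = \<bar>\<tau>\<bar> * sqrt (var_const * (1 - x n))"
    proof -
      have "var_const * (1 - x n) = var_const * real (n - N n * p n) / real n"
        using Np elim by (simp add: x_def of_nat_diff diff_divide_distrib right_diff_distrib)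
      then have "sqrt (var_const * (1 - x n)) = sqrt (var_const * real (n - N n * p n)) / sqrt (real n)"
        by (simp add: real_sqrt_divide)
      then show ?thesis by (simp add: \<theta>_def abs_divide)
    qed
    have t2: "?N * (4 * \<theta>\<^sup>2 * e * ?p) = 4 * \<tau>\<^sup>2 * e * x n" by (simp add: \<theta>2 x_def)
    have t3: "?N * (8 / 3 * \<bar>\<theta>\<bar> ^ 3 * K * var_const * ?p\<^sup>2) = 8 / 3 * \<bar>\<tau>\<bar> ^ 3 * K * var_const * x n * y n"
    proof -
      have "\<bar>\<theta>\<bar> ^ 3 = \<bar>\<tau>\<bar> ^ 3 / (real n * sqrt (real n))"
        by (simp add: \<theta>_def abs_divide power_divide numeral_eq_Suc)
      then show ?thesis by (simp add: x_def y_def power2_eq_square mult_ac)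
    qed
    have t4: "?N * (\<theta>\<^sup>2 / 2 * \<bar>?b - ?p * v\<bar>) = \<tau>\<^sup>2 / 2 * x n * \<bar>?b / ?p - v\<bar>"
    proof -
      have "?b - ?p * v = ?p * (?b / ?p - v)" using elim by (simp add: right_diff_distrib)
      then have "\<bar>?b - ?p * v\<bar> = ?p * \<bar>?b / ?p - v\<bar>" by (simp only: abs_mult)
      then show ?thesis by (simp add: \<theta>2 x_def mult_ac)
    qed
    have t5: "?N * ((?p * \<theta>\<^sup>2 * v / 2)\<^sup>2 / 2) = \<tau> ^ 4 * v\<^sup>2 / 8 * x n * y n * (1 / sqrt (real n))"
    proof -
      have "y n * (1 / sqrt (real n)) = ?p / real n" by (simp add: y_def)
      then have C: "\<tau> ^ 4 * v\<^sup>2 / 8 * x n * y n * (1 / sqrt (real n)) = \<tau> ^ 4 * v\<^sup>2 / 8 * (x n * (?p / real n))"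
        by (simp only: mult.assoc)
      have "(?p * \<theta>\<^sup>2 * v / 2)\<^sup>2 / 2 = (\<tau>\<^sup>2)\<^sup>2 * v\<^sup>2 / 8 * (?p / real n)\<^sup>2"
        unfolding \<theta>2 by (simp add: power_mult_distrib power_divide)
      also have "(\<tau>\<^sup>2)\<^sup>2 = \<tau> ^ 4" by (simp flip: power_mult)
      finally have "?N * ((?p * \<theta>\<^sup>2 * v / 2)\<^sup>2 / 2) = \<tau> ^ 4 * v\<^sup>2 / 8 * (?N * (?p / real n)\<^sup>2)"
        by (simp only: mult.left_commute)
      also have "?N * (?p / real n)\<^sup>2 = x n * (?p / real n)" by (simp add: x_def power2_eq_square)
      finally show ?thesis unfolding C .
    qed
    have ex: "?N * (?p * \<theta>\<^sup>2 * v / 2) = x n * s" by (simp add: \<theta>2 x_def s_def)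
    have "cmod (char_sum {1..int n} \<theta> - of_real (exp (- (x n * s)))) \<le>
       \<bar>\<tau>\<bar> * sqrt (var_const * (1 - x n)) + 4 * ?N * alpha (q n) + (4 * \<tau>\<^sup>2 * e * x n + 8 / 3 * \<bar>\<tau>\<bar> ^ 3 * K * var_const * x n * y n
        + \<tau>\<^sup>2 / 2 * x n * \<bar>?b / ?p - v\<bar> + \<tau> ^ 4 * v\<^sup>2 / 8 * x n * y n * (1 / sqrt (real n)))"
      using char_sum_bound[OF mean K trunc Nle v, of \<theta>] unfolding ex distrib_left t1 t2 t3 t4 t5 .
    moreover have "cmod (of_real (exp (- (x n * s))) - of_real (exp (- s))) = \<bar>exp (- (x n * s)) - exp (- s)\<bar>"
      by (simp flip: of_real_diff)
    ultimately have "cmod (char_sum {1..int n} \<theta> - of_real (exp (- s))) \<le> R n"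
      using norm_diff_triangle_le[of "char_sum {1..int n} \<theta>" "of_real (exp (- (x n * s)))" _ "of_real (exp (- s))" "\<bar>exp (- (x n * s)) - exp (- s)\<bar>"]
      unfolding R_def L_def by fastforce
    then show ?case using elim(1) by (simp add: dist_norm \<theta>_def s_def v_def)
  qed
qed

end

section \<open>The normal law as limit of the self-normalised sum\<close>

abbreviation normal_cdf :: "real \<Rightarrow> real" where "normal_cdf \<equiv> cdf std_normal_distribution"

lemma isCont_normal_cdf: "isCont normal_cdf x"
proof -
  interpret real_distribution std_normal_distribution by (rule real_dist_normal_dist)
  have "emeasure std_normal_distribution {x} = (\<integral>\<^sup>+ y. ennreal (std_normal_density y) * indicator {x} y \<partial>lborel)"
    by (rule emeasure_density) auto
  also have "\<dots> = 0" by (rule nn_integral_null_set) (simp add: null_sets_def)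
  finally show ?thesis by (simp add: isCont_cdf measure_def)
qed

text \<open>The density is positive everywhere, so an interval of normal measure 0 would be Lebesgue
  null.\<close>

lemma normal_cdf_strict_mono:
  assumes "a < b" shows "normal_cdf a < normal_cdf b"
proof -
  interpret real_distribution std_normal_distribution by (rule real_dist_normal_dist)
  have "normal_cdf b - normal_cdf a = measure std_normal_distribution {a<..b}" using cdf_diff_eq[OF assms] .
  moreover have "measure std_normal_distribution {a<..b} \<noteq> 0"
  proof
    assume "measure std_normal_distribution {a<..b} = 0"
    then have "emeasure std_normal_distribution {a<..b} = 0" by (simp add: emeasure_eq_measure)
    then have "(\<integral>\<^sup>+ y. ennreal (std_normal_density y) * indicator {a<..b} y \<partial>lborel) = 0"
      by (subst (asm) emeasure_density) auto
    then have "AE y in lborel. ennreal (std_normal_density y) * indicator {a<..b} y = 0"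
      by (subst (asm) nn_integral_0_iff_AE) auto
    then have AE: "AE y in lborel. y \<notin> {a<..b}"
      by (rule AE_mp) (auto intro!: AE_I2 simp: indicator_def normal_density_pos less_imp_neq[THEN not_sym] split: if_splits)
    have "(AE y in lborel. y \<notin> {a<..b}) \<longleftrightarrow> emeasure lborel {a<..b} = 0"
      by (rule AE_iff_measurable) auto
    from iffD1[OF this AE] have "emeasure lborel {a<..b} = 0" .
    then show False using assms by simp
  qed
  ultimately show ?thesis using measure_nonneg[of std_normal_distribution "{a<..b}"] by linarith
qed

lemma normal_quantile:
  assumes "0 < y" "y < 1" obtains c where "normal_cdf c = y"
proof -
  interpret real_distribution std_normal_distribution by (rule real_dist_normal_dist)
  have "eventually (\<lambda>x. normal_cdf x > y) at_top" using cdf_lim_at_top_prob assms by (intro order_tendstoD) auto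
  then obtain u where u: "normal_cdf u > y" by (auto simp: eventually_at_top_linorder)
  have "eventually (\<lambda>x. normal_cdf x < y) at_bot" using cdf_lim_at_bot assms by (intro order_tendstoD) auto
  then obtain l where l: "normal_cdf l < y" by (auto simp: eventually_at_bot_linorder)
  have "l \<le> u" using u l cdf_nondecreasing[of u l] by linarith
  then obtain c where "normal_cdf c = y"
    using IVT[of normal_cdf l y u] isCont_normal_cdf u l by auto
  then show ?thesis using that by blast
qed

context fast_mixing_process
begin

lemma central_limit:
  assumes mean: "expectation (X 0) = 0" and v: "long_run_var M X > 0"
  shows "(\<lambda>n. prob {\<omega>\<in>space M. (\<Sum>t\<in>{1..int n}. X t \<omega>) / (sqrt (long_run_var M X) * sqrt (real n)) \<le> x}) \<longlonglongrightarrow> normal_cdf x"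
proof -
  define \<sigma> where "\<sigma> = sqrt (long_run_var M X)"
  have \<sigma>: "\<sigma> > 0" "\<sigma>\<^sup>2 = long_run_var M X" using v by (auto simp: \<sigma>_def)
  define U where "U n \<omega> = (\<Sum>t\<in>{1..int n}. X t \<omega>) / (\<sigma> * sqrt (real n))" for n \<omega>
  have Um [measurable]: "U n \<in> borel_measurable M" for n unfolding U_def by measurable
  have "weak_conv_m (\<lambda>n. distr M borel (U n)) std_normal_distribution"
  proof (rule levy_continuity)
    show "real_distribution (distr M borel (U n))" for n by (rule real_distribution_distr) measurable
    show "real_distribution std_normal_distribution" by (rule real_dist_normal_dist)
    fix \<tau> :: real
    have "char (distr M borel (U n)) \<tau> = char_sum {1..int n} (\<tau> / \<sigma> / sqrt (real n))" for n
    proof -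
      have "char (distr M borel (U n)) \<tau> = expectation (\<lambda>\<omega>. iexp (\<tau> * U n \<omega>))"
        unfolding char_def by (subst integral_distr) auto
      also have "\<dots> = char_sum {1..int n} (\<tau> / \<sigma> / sqrt (real n))"
        unfolding char_sum_def U_def by (simp add: field_simps)
      finally show ?thesis .
    qed
    moreover have "(\<lambda>n. char_sum {1..int n} (\<tau> / \<sigma> / sqrt (real n))) \<longlonglongrightarrow> of_real (exp (- ((\<tau> / \<sigma>)\<^sup>2 * long_run_var M X / 2)))"
      by (rule char_sum_tendsto[OF mean])
    moreover have "(\<tau> / \<sigma>)\<^sup>2 * long_run_var M X = \<tau>\<^sup>2" using \<sigma> by (simp add: power_divide flip: \<sigma>(2))
    ultimately show "(\<lambda>n. char (distr M borel (U n)) \<tau>) \<longlonglongrightarrow> char std_normal_distribution \<tau>"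
      by (simp add: char_std_normal_distribution)
  qed
  then have "(\<lambda>n. cdf (distr M borel (U n)) x) \<longlonglongrightarrow> normal_cdf x"
    using isCont_normal_cdf unfolding weak_conv_m_def weak_conv_def by blast
  moreover have "cdf (distr M borel (U n)) x = prob {\<omega>\<in>space M. U n \<omega> \<le> x}" for n
    by (auto simp: cdf_def measure_distr intro!: arg_cong[where f = prob])
  ultimately show ?thesis by (simp add: U_def \<sigma>_def)
qed

text \<open>If the second moment vanished, so would all covariances and with them the long-run
  variance.\<close>

lemma second_moment_pos:
  assumes v: "long_run_var M X > 0"
  shows "expectation (\<lambda>\<omega>. (X 0 \<omega>)\<^sup>2) > 0"
proof (rule ccontr)
  assume "\<not> ?thesis"
  then have 0: "expectation (\<lambda>\<omega>. (X 0 \<omega>)\<^sup>2) = 0" by (simp add: not_less antisym)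
  have t: "expectation (\<lambda>\<omega>. (X t \<omega>)\<^sup>2) = 0" for t using expectation_marginal[of "\<lambda>x. x\<^sup>2" t] 0 by simp
  have "cov M (X 0) (X t) = 0" for t
    using abs_cov_le_squares[of "X 0" "X t"] X_square_integrable 0 t by simp
  then show False using v by (simp add: long_run_var_def)
qed

text \<open>Slutsky's argument: T = U / W with U asymptotically standard normal and W converging in
  probability to w, so T <= x amounts to U <= x W. The limit is centred normal with standard
  deviation 1 / w, which accounts for serial dependence.\<close>

lemma Tstat_conv_normal:
  assumes mean: "expectation (X 0) = 0" and v: "long_run_var M X > 0"
  defines "w \<equiv> sqrt (expectation (\<lambda>\<omega>. (X 0 \<omega>)\<^sup>2)) / sqrt (long_run_var M X)"
  shows "(\<lambda>n. prob {\<omega>\<in>space M. Tstat X n \<omega> \<le> x}) \<longlonglongrightarrow> normal_cdf (x * w)"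
proof -
  define \<sigma> where "\<sigma> = sqrt (long_run_var M X)"
  define m2 where "m2 = expectation (\<lambda>\<omega>. (X 0 \<omega>)\<^sup>2)"
  have \<sigma>: "\<sigma> > 0" using v by (simp add: \<sigma>_def)
  have m2: "m2 > 0" using second_moment_pos[OF v] by (simp add: m2_def)
  have w: "w = sqrt m2 / \<sigma>" "w > 0" using \<sigma> m2 by (auto simp: w_def m2_def \<sigma>_def)
  define U where "U n \<omega> = (\<Sum>t\<in>{1..int n}. X t \<omega>) / (\<sigma> * sqrt (real n))" for n \<omega>
  define W where "W n \<omega> = sqrt ((\<Sum>t=1..n. (X (int t) \<omega>)\<^sup>2) / real n) / \<sigma>" for n \<omega>
  have [measurable]: "U n \<in> borel_measurable M" "W n \<in> borel_measurable M" for n unfolding U_def W_def by measurable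
  have clt: "(\<lambda>n. prob {\<omega>\<in>space M. U n \<omega> \<le> y}) \<longlonglongrightarrow> normal_cdf y" for y
    using central_limit[OF mean v] by (simp add: U_def \<sigma>_def)
  have Wconv: "(\<lambda>n. prob {\<omega>\<in>space M. \<bar>W n \<omega> - w\<bar> \<ge> d}) \<longlonglongrightarrow> 0" if d: "d > 0" for d
  proof (rule tendsto_sandwich[OF _ _ tendsto_const])
    show "(\<lambda>n. prob {\<omega>\<in>space M. \<bar>(\<Sum>t=1..n. (X (int t) \<omega>)\<^sup>2) / real n - m2\<bar> \<ge> d * \<sigma> * sqrt m2}) \<longlonglongrightarrow> 0"
      unfolding m2_def by (rule sum_squares_lln[OF alpha_tendsto_0 X_square_integrable]) (use d \<sigma> m2 in \<open>simp add: m2_def\<close>)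
    show "eventually (\<lambda>n. prob {\<omega>\<in>space M. \<bar>W n \<omega> - w\<bar> \<ge> d} \<le> prob {\<omega>\<in>space M. \<bar>(\<Sum>t=1..n. (X (int t) \<omega>)\<^sup>2) / real n - m2\<bar> \<ge> d * \<sigma> * sqrt m2}) sequentially"
    proof (intro always_eventually allI finite_measure_mono)
      fix n
      \<comment> \<open>Multiplying |sqrt Q - sqrt m2| by sqrt m2 <= sqrt Q + sqrt m2 gives at most
        |Q - m2|, which reduces the root to the mean of squares.\<close>
      have *: "d * \<sigma> * sqrt m2 \<le> \<bar>Q - m2\<bar>" if Q: "Q \<ge> 0" "d \<le> \<bar>sqrt Q / \<sigma> - w\<bar>" for Q
      proof -
        have "sqrt Q / \<sigma> - w = (sqrt Q - sqrt m2) / \<sigma>" by (simp add: w(1) diff_divide_distrib)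
        then have "d * \<sigma> \<le> \<bar>sqrt Q - sqrt m2\<bar>" using Q(2) \<sigma> by (simp add: abs_divide pos_le_divide_eq)
        then have "d * \<sigma> * sqrt m2 \<le> \<bar>sqrt Q - sqrt m2\<bar> * (sqrt Q + sqrt m2)"
          using d \<sigma> m2 Q(1) by (intro mult_mono) auto
        also have "\<dots> = \<bar>(sqrt Q - sqrt m2) * (sqrt Q + sqrt m2)\<bar>" using Q(1) m2 by (simp add: abs_mult)
        also have "(sqrt Q - sqrt m2) * (sqrt Q + sqrt m2) = Q - m2" using Q(1) m2 by (simp add: algebra_simps)
        finally show ?thesis .
      qed
      have Q0: "(\<Sum>t=1..n. (X (int t) \<omega>)\<^sup>2) / real n \<ge> 0" for \<omega> by (simp add: sum_nonneg)
      show "{\<omega>\<in>space M. \<bar>W n \<omega> - w\<bar> \<ge> d} \<subseteq> {\<omega>\<in>space M. \<bar>(\<Sum>t=1..n. (X (int t) \<omega>)\<^sup>2) / real n - m2\<bar> \<ge> d * \<sigma> * sqrt m2}"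
        using *[OF Q0] unfolding W_def by blast
    qed measurable
  qed auto
  show ?thesis
  proof (rule tendstoI)
    fix r :: real assume r: "r > 0"
    obtain d0 where d0: "d0 > 0" "\<And>y. \<bar>y - x * w\<bar> < d0 \<Longrightarrow> \<bar>normal_cdf y - normal_cdf (x * w)\<bar> < r / 3"
      using isCont_normal_cdf[of "x * w"] r unfolding continuous_at_eps_delta dist_real_def by (meson divide_pos_pos zero_less_numeral)
    define h where "h = d0 / 2"
    have h: "h > 0" "h < d0" using d0 by (auto simp: h_def)
    \<comment> \<open>The bound by w keeps W positive; the other bound gives |x| d <= h, where |x| +
      1 avoids a division by 0 at x = 0.\<close>
    define d where "d = min w (h / (\<bar>x\<bar> + 1))"
    have x1: "\<bar>x\<bar> + 1 > 0" by linarith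
    have d: "d > 0" "d \<le> w" using w h x1 by (auto simp: d_def)
    have xd: "\<bar>x\<bar> * d \<le> h"
    proof -
      have "\<bar>x\<bar> * d \<le> (\<bar>x\<bar> + 1) * (h / (\<bar>x\<bar> + 1))" using d by (intro mult_mono) (auto simp: d_def)
      then show ?thesis using x1 by simp
    qed
    have e1: "eventually (\<lambda>n. prob {\<omega>\<in>space M. \<bar>W n \<omega> - w\<bar> \<ge> d} < r / 3) sequentially"
      using Wconv[OF d(1)] r by (intro order_tendstoD) auto
    have e2: "eventually (\<lambda>n. \<bar>prob {\<omega>\<in>space M. U n \<omega> \<le> x * w + h} - normal_cdf (x * w + h)\<bar> < r / 3) sequentially"
      using tendstoD[OF clt, of "r / 3"] r by (simp add: dist_real_def)
    have e3: "eventually (\<lambda>n. \<bar>prob {\<omega>\<in>space M. U n \<omega> \<le> x * w - h} - normal_cdf (x * w - h)\<bar> < r / 3) sequentially"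
      using tendstoD[OF clt, of "r / 3"] r by (simp add: dist_real_def)
    have F: "\<bar>normal_cdf (x * w + h) - normal_cdf (x * w)\<bar> < r / 3" "\<bar>normal_cdf (x * w - h) - normal_cdf (x * w)\<bar> < r / 3"
      by (rule d0(2), use h in simp)+
    show "eventually (\<lambda>n. dist (prob {\<omega>\<in>space M. Tstat X n \<omega> \<le> x}) (normal_cdf (x * w)) < r) sequentially"
      using e1 e2 e3 eventually_gt_at_top[of 0]
    proof eventually_elim
      case (elim n)
      have key: "Tstat X n \<omega> \<le> x \<longleftrightarrow> U n \<omega> \<le> x * W n \<omega>" "\<bar>x * W n \<omega> - x * w\<bar> \<le> h" if W: "\<bar>W n \<omega> - w\<bar> < d" for \<omega>
      proof -
        let ?Q = "\<Sum>t=1..n. (X (int t) \<omega>)\<^sup>2"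
        have Wpos: "W n \<omega> > 0" using W d by linarith
        have "U n \<omega> = Tstat X n \<omega> * W n \<omega>"
        proof -
          have "sqrt ?Q \<noteq> 0" using Wpos by (auto simp: W_def)
          then show ?thesis using elim(4) \<sigma> sum_int_atLeastAtMost[of "\<lambda>t. X t \<omega>" n]
            by (simp add: U_def W_def Tstat_def real_sqrt_divide mult.commute)
        qed
        then show "Tstat X n \<omega> \<le> x \<longleftrightarrow> U n \<omega> \<le> x * W n \<omega>" using Wpos by simp
        have "\<bar>x * W n \<omega> - x * w\<bar> = \<bar>x\<bar> * \<bar>W n \<omega> - w\<bar>" by (simp flip: right_diff_distrib abs_mult)
        also have "\<dots> \<le> \<bar>x\<bar> * d" using W by (intro mult_left_mono) auto
        finally show "\<bar>x * W n \<omega> - x * w\<bar> \<le> h" using xd by linarith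
      qed
      have up: "prob {\<omega>\<in>space M. Tstat X n \<omega> \<le> x} \<le> prob {\<omega>\<in>space M. U n \<omega> \<le> x * w + h} + prob {\<omega>\<in>space M. \<bar>W n \<omega> - w\<bar> \<ge> d}"
      proof (rule prob_Un_le)
        show "{\<omega>\<in>space M. Tstat X n \<omega> \<le> x} \<subseteq> {\<omega>\<in>space M. U n \<omega> \<le> x * w + h} \<union> {\<omega>\<in>space M. \<bar>W n \<omega> - w\<bar> \<ge> d}"
        proof
          fix \<omega> assume \<omega>: "\<omega> \<in> {\<omega>\<in>space M. Tstat X n \<omega> \<le> x}"
          show "\<omega> \<in> {\<omega>\<in>space M. U n \<omega> \<le> x * w + h} \<union> {\<omega>\<in>space M. \<bar>W n \<omega> - w\<bar> \<ge> d}"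
            using key[of \<omega>] \<omega> by (cases "\<bar>W n \<omega> - w\<bar> < d") auto
        qed
      qed measurable
      have low: "prob {\<omega>\<in>space M. U n \<omega> \<le> x * w - h} \<le> prob {\<omega>\<in>space M. Tstat X n \<omega> \<le> x} + prob {\<omega>\<in>space M. \<bar>W n \<omega> - w\<bar> \<ge> d}"
      proof (rule prob_Un_le)
        show "{\<omega>\<in>space M. U n \<omega> \<le> x * w - h} \<subseteq> {\<omega>\<in>space M. Tstat X n \<omega> \<le> x} \<union> {\<omega>\<in>space M. \<bar>W n \<omega> - w\<bar> \<ge> d}"
        proof
          fix \<omega> assume \<omega>: "\<omega> \<in> {\<omega>\<in>space M. U n \<omega> \<le> x * w - h}"
          show "\<omega> \<in> {\<omega>\<in>space M. Tstat X n \<omega> \<le> x} \<union> {\<omega>\<in>space M. \<bar>W n \<omega> - w\<bar> \<ge> d}"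
            using key[of \<omega>] \<omega> by (cases "\<bar>W n \<omega> - w\<bar> < d") auto
        qed
      qed measurable
      show ?case unfolding dist_real_def using elim F up low by linarith
    qed
  qed
qed

text \<open>The limit distribution function is continuous and strictly increasing, so every level in
  (0, 1) has a quantile with the strict inequalities that \<open>noncover_prob_tendsto\<close> asks
  for.\<close>

theorem noncover_prob_tendsto_fast_mixing:
  assumes b: "filterlim b at_top sequentially" "(\<lambda>n. real (b n) / real n) \<longlonglongrightarrow> 0"
    and \<eta>: "0 < \<eta>" "\<eta> < 1"
    and mean: "expectation (X 0) = 0" and v: "long_run_var M X > 0"
  shows "noncover_prob M X b \<eta> \<longlonglongrightarrow> \<eta>"
proof -
  define w where "w = sqrt (expectation (\<lambda>\<omega>. (X 0 \<omega>)\<^sup>2)) / sqrt (long_run_var M X)"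
  have w: "w > 0" using v second_moment_pos[OF v] by (simp add: w_def)
  define F where "F x = normal_cdf (x * w)" for x
  have cont: "isCont F x" for x
    unfolding F_def by (rule isCont_o2[where g = normal_cdf, OF _ isCont_normal_cdf]) simp
  have quantile: "\<exists>c. (\<forall>x<c. F x < y) \<and> (\<forall>x>c. y < F x)" if y: "0 < y" "y < 1" for y
  proof -
    obtain c where c: "normal_cdf c = y" using normal_quantile[OF y] by blast
    show ?thesis
    proof (intro exI[of _ "c / w"] conjI allI impI)
      fix x assume "x < c / w"
      then show "F x < y" using w normal_cdf_strict_mono[of "x * w" c] by (simp add: F_def c pos_less_divide_eq)
    next
      fix x assume "x > c / w"
      then show "F x > y" using w normal_cdf_strict_mono[of c "x * w"] by (simp add: F_def c pos_divide_less_eq)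
    qed
  qed
  obtain c1 where c1: "\<And>x. x < c1 \<Longrightarrow> F x < \<eta>/2" "\<And>x. c1 < x \<Longrightarrow> \<eta>/2 < F x" using quantile[of "\<eta>/2"] \<eta> by auto
  obtain c2 where c2: "\<And>x. x < c2 \<Longrightarrow> F x < 1 - \<eta>/2" "\<And>x. c2 < x \<Longrightarrow> 1 - \<eta>/2 < F x" using quantile[of "1 - \<eta>/2"] \<eta> by auto
  show ?thesis
  proof (rule noncover_prob_tendsto[OF b alpha_tendsto_0 \<eta> _ _ c1 _ c2])
    show "(\<lambda>n. prob {\<omega>\<in>space M. Tstat X n \<omega> \<le> x}) \<longlonglongrightarrow> F x" for x
      unfolding F_def w_def by (rule Tstat_conv_normal[OF mean v])
    show "\<exists>\<delta>>0. \<forall>x\<in>ball c1 \<delta>. isCont F x" "\<exists>\<delta>>0. \<forall>x\<in>ball c2 \<delta>. isCont F x"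
      using cont by (auto intro: exI[of _ 1])
  qed
qed

end

theorem theorem7:
  fixes M :: "'a measure" and X :: "int \<Rightarrow> 'a \<Rightarrow> real" and \<eta> :: real
    and b :: "nat \<Rightarrow> nat" and a :: "nat \<Rightarrow> real" and \<kappa> :: real
    and \<nu> :: "(real \<times> real) measure"
  assumes "prob_space M"
    and "stationary M X"
    and "0 < \<eta>" and "\<eta> < 1"
    and "filterlim b at_top sequentially"
    and "(\<lambda>n. real (b n) / real n) \<longlonglongrightarrow> 0"
  shows
    "((\<integral>\<omega>. X 0 \<omega> \<partial>M) = 0 \<and>
       ((assm_FV M X \<and> long_run_var M X > 0) \<or>
        (assm_RV M X \<kappa> \<and> norm_seq M X a \<and> assm_ACMX M X a \<and> 1 < \<kappa> \<and> \<kappa> < 2 \<and>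
         conv_distr2 M (scaled_pair X a) \<nu> \<and>
         (\<exists>\<delta>>0. \<forall>x\<in>ball (ratio_quantile \<nu> (\<eta>/2)) \<delta>. isCont (ratio_cdf \<nu>) x) \<and>
         (\<exists>\<delta>>0. \<forall>x\<in>ball (ratio_quantile \<nu> (1 - \<eta>/2)) \<delta>. isCont (ratio_cdf \<nu>) x)))
      \<longrightarrow> noncover_prob M X b \<eta> \<longlonglongrightarrow> \<eta>)
   \<and>
    ((assm_FV M X \<or> (assm_RV M X \<kappa> \<and> norm_seq M X a \<and> assm_ACMX M X a \<and> 1 < \<kappa> \<and> \<kappa> < 2)) \<and>
      (\<integral>\<omega>. X 0 \<omega> \<partial>M) \<noteq> 0
      \<longrightarrow> noncover_prob M X b \<eta> \<longlonglongrightarrow> 1)"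
proof (intro conjI impI)
  interpret stationary_process M X using assms(1,2) by (simp add: stationary_process_def stationary_process_axioms_def)
  have fast: "\<exists>\<epsilon>. fast_mixing_process M X \<epsilon>" if "assm_FV M X"
    using that stationary_process_axioms
    by (auto simp: assm_FV_def fast_mixing_process_def fast_mixing_process_axioms_def)
  have heavy: "heavy_tailed_process M X \<kappa> a"
    if "assm_RV M X \<kappa>" "norm_seq M X a" "assm_ACMX M X a" "1 < \<kappa>" "\<kappa> < 2"
    using that stationary_process_axioms
    by (auto simp: assm_RV_def regvar_proc_def heavy_tailed_process_def heavy_tailed_process_axioms_def)
  note b = assms(5,6) and \<eta> = assms(3,4)
  {
    assume H: "(\<integral>\<omega>. X 0 \<omega> \<partial>M) = 0 \<and>
       ((assm_FV M X \<and> long_run_var M X > 0) \<or>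
        (assm_RV M X \<kappa> \<and> norm_seq M X a \<and> assm_ACMX M X a \<and> 1 < \<kappa> \<and> \<kappa> < 2 \<and>
         conv_distr2 M (scaled_pair X a) \<nu> \<and>
         (\<exists>\<delta>>0. \<forall>x\<in>ball (ratio_quantile \<nu> (\<eta>/2)) \<delta>. isCont (ratio_cdf \<nu>) x) \<and>
         (\<exists>\<delta>>0. \<forall>x\<in>ball (ratio_quantile \<nu> (1 - \<eta>/2)) \<delta>. isCont (ratio_cdf \<nu>) x)))"
    then have mean: "expectation (X 0) = 0" by simp
    from H consider (FV) "assm_FV M X" "long_run_var M X > 0"
      | (RV) "heavy_tailed_process M X \<kappa> a" "conv_distr2 M (scaled_pair X a) \<nu>"
         "\<exists>\<delta>>0. \<forall>x\<in>ball (ratio_quantile \<nu> (\<eta>/2)) \<delta>. isCont (ratio_cdf \<nu>) x"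
         "\<exists>\<delta>>0. \<forall>x\<in>ball (ratio_quantile \<nu> (1 - \<eta>/2)) \<delta>. isCont (ratio_cdf \<nu>) x"
      using heavy by blast
    then show "noncover_prob M X b \<eta> \<longlonglongrightarrow> \<eta>"
    proof cases
      case FV
      then obtain \<epsilon> where F: "fast_mixing_process M X \<epsilon>" using fast by blast
      show ?thesis
        by (rule fast_mixing_process.noncover_prob_tendsto_fast_mixing[OF F b \<eta> mean FV(2)])
    next
      case RV
      then have L: "heavy_tailed_limit M X \<kappa> a \<nu>"
        by (simp add: heavy_tailed_limit_def heavy_tailed_limit_axioms_def)
      show ?thesis
        by (rule heavy_tailed_limit.noncover_prob_tendsto_heavy_tailed[OF L b \<eta> RV(3,4)])
    qed
  next
    assume H: "(assm_FV M X \<or> (assm_RV M X \<kappa> \<and> norm_seq M X a \<and> assm_ACMX M X a \<and> 1 < \<kappa> \<and> \<kappa> < 2)) \<and>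
      (\<integral>\<omega>. X 0 \<omega> \<partial>M) \<noteq> 0"
    then have mean: "expectation (X 0) \<noteq> 0" by simp
    from H consider (FV) "assm_FV M X" | (RV) "heavy_tailed_process M X \<kappa> a" using heavy by blast
    then show "noncover_prob M X b \<eta> \<longlonglongrightarrow> 1"
    proof cases
      case FV
      then obtain \<epsilon> where F: "fast_mixing_process M X \<epsilon>" using fast by blast
      show ?thesis
        by (rule noncover_prob_tendsto_1_square_integrable[OF b fast_mixing_process.alpha_tendsto_0[OF F] \<eta>
              fast_mixing_process.X_square_integrable[OF F] mean])
    next
      case RV
      show ?thesis
        by (rule heavy_tailed_process.noncover_prob_tendsto_1_heavy_tailed[OF RV b \<eta> mean])
    qed
  }
qed

end
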